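(* Let $X$ be the interval $[0,1]$ or the circle with Lebesgue measure $\lambda$. Let $f\in\mathcal D(X)$ be a finite-to-1 Markov map. Then $f$ has a nonzero $\sigma$-finite invariant Borel measure which is absolutely continuous with respect to $\lambda$.
   Context: A $\lambda$-partition of $X$ is a countable collection of pairwise disjoint ($\sigma$-compact) Borel subsets of $X$, each of positive finite $\lambda$-measure, whose union has full $\lambda$-measure in $X$. The Schwarzian derivative of a $C^3$ map $g$ at a point where $Dg\ne0$ is $Sg=\frac{D^3g}{Dg}-\frac32\left(\frac{D^2g}{Dg}\right)^2$. $\mathcal D(X)$ is the class of maps $f:X\to X$ having a dense orbit and such that there is a $\lambda$-partition $\mathcal P$ of $X$ consisting of open intervals with the property that for every $I\in\mathcal P$ the restriction $f|I$ is a ($C^3$) diffeomorphism onto its image with negative Schwarzian derivative. $f\in\mathcal D(X)$ is a Markov map if such a $\lambda$-partition $\mathcal P$ into open intervals (on each of which $f$ is a diffeomorphism onto its image with negative Schwarzian derivative) can be chosen so that for every $I\in\mathcal P$ the image $f(I)$ is, up to a set of $\lambda$-measure zero, a union of elements of $\mathcal P$. It is a finite-to-1 Markov map if moreover, for this $\mathcal P$, for every $I\in\mathcal P$ the set $f^{-1}(I)$ is, up to a set of $\lambda$-measure zero, contained in the union of a finite subcollection of $\mathcal P$. A measure $\mu$ is invariant if $\mu(f^{-1}(A))=\mu(A)$ for all Borel $A$; it is $\sigma$-finite if, up to a $\mu$-null set, $X$ is a countable disjoint union of sets of finite $\mu$-measure.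
   Formalization: The dense orbit must meet discontinuities of f only finitely often (else arbitrary values of f on a null set give counterexamples), and "f(I) is, up to measure zero, a union of elements of P" is read as: f(I) contains that union and exceeds it by a null set. *)

theory Defs
  imports "HOL-Analysis.Analysis"
begin

text \<open>
  Both spaces are handled through a parametrisation \<open>p\<close> of the space by the real line:
  the identity for \<open>[0,1]\<close>, and \<open>t \<mapsto> exp (2 \<pi> i t)\<close> for the circle. The space itself is
  \<open>space M\<close>, where \<open>M\<close> is Lebesgue measure on its Borel sets (of total mass 1).
\<close>

definition interval_param :: "real \<Rightarrow> real" where
  "interval_param t = t"

definition interval_lebesgue :: "real measure" where
  "interval_lebesgue = restrict_space lborel {0..1}"

definition circle_param :: "real \<Rightarrow> complex" where
  "circle_param t = cis (2 * pi * t)"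

definition circle_lebesgue :: "complex measure" where
  "circle_lebesgue =
     distr (restrict_space lborel {0..1}) (restrict_space borel (sphere 0 1)) circle_param"

definition sigma_compact :: "'a::topological_space set \<Rightarrow> bool" where
  "sigma_compact A \<longleftrightarrow> (\<exists>K :: nat \<Rightarrow> 'a set. (\<forall>n. compact (K n)) \<and> A = (\<Union>n. K n))"

definition lambda_partition :: "'a::topological_space measure \<Rightarrow> 'a set set \<Rightarrow> bool" where
  "lambda_partition M P \<longleftrightarrow>
     countable P \<and> disjoint P \<and>
     (\<forall>I\<in>P. I \<in> sets M \<and> sigma_compact I \<and> 0 < emeasure M I \<and> emeasure M I < \<infinity>) \<and>
     space M - \<Union>P \<in> null_sets M"

text \<open>In the next definitions \<open>S\<close> is always an open set.\<close>

definition C3_on :: "real set \<Rightarrow> (real \<Rightarrow> real) \<Rightarrow> bool" where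
  "C3_on S g \<longleftrightarrow>
     (\<forall>k<3. \<forall>x\<in>S. (deriv ^^ k) g field_differentiable at x) \<and> continuous_on S ((deriv ^^ 3) g)"

definition C3_diffeo_on :: "real set \<Rightarrow> (real \<Rightarrow> real) \<Rightarrow> bool" where
  "C3_diffeo_on S g \<longleftrightarrow>
     C3_on S g \<and> inj_on g S \<and> open (g ` S) \<and> C3_on (g ` S) (inv_into S g)"

definition schwarzian :: "(real \<Rightarrow> real) \<Rightarrow> real \<Rightarrow> real" where
  "schwarzian g x =
     (deriv ^^ 3) g x / deriv g x - 3 / 2 * ((deriv ^^ 2) g x / deriv g x)\<^sup>2"

text \<open>
  \<open>I\<close> is the open interval \<open>p ` {a<..<b}\<close> (on the circle, injectivity of \<open>p\<close> forces
  \<open>b \<le> a + 1\<close>), and the restriction of \<open>f\<close> to \<open>I\<close>, written in the coordinate \<open>p\<close> as \<open>g\<close>, is a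
  diffeomorphism onto its image with negative Schwarzian derivative. The last conjunct says
  that \<open>f\<close>, and not only its lift \<open>g\<close>, is injective on \<open>I\<close>. Lifts through \<open>p\<close> are unique up to
  integer translations, so neither the diffeomorphism property nor the Schwarzian derivative
  depends on the choice of \<open>a\<close>, \<open>b\<close> and \<open>g\<close>.
\<close>

definition neg_schwarzian_branch ::
    "(real \<Rightarrow> 'a) \<Rightarrow> ('a \<Rightarrow> 'a) \<Rightarrow> 'a set \<Rightarrow> bool" where
  "neg_schwarzian_branch p f I \<longleftrightarrow>
     (\<exists>a b g. a < b \<and> inj_on p {a<..<b} \<and> I = p ` {a<..<b} \<and>
        (\<forall>t\<in>{a<..<b}. f (p t) = p (g t)) \<and>
        C3_diffeo_on {a<..<b} g \<and> (\<forall>t\<in>{a<..<b}. schwarzian g t < 0) \<and>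
        inj_on p (g ` {a<..<b}))"

definition neg_schwarzian_partition ::
    "(real \<Rightarrow> 'a::topological_space) \<Rightarrow> 'a measure \<Rightarrow> ('a \<Rightarrow> 'a) \<Rightarrow> 'a set set \<Rightarrow> bool" where
  "neg_schwarzian_partition p M f P \<longleftrightarrow>
     lambda_partition M P \<and> (\<forall>I\<in>P. neg_schwarzian_branch p f I)"

text \<open>
  A piecewise smooth map is only meaningful away from its discontinuities: the values there are
  arbitrary, and may send the orbit anywhere. A dense orbit is therefore one that meets the
  discontinuities of \<open>f\<close> at most finitely often. The second conjunct is automatic if \<open>f\<close> is
  continuous, or more generally if it has only finitely many discontinuities (an orbit that
  meets one of them twice is finite).
\<close>

definition has_dense_orbit :: "'a::t2_space set \<Rightarrow> ('a \<Rightarrow> 'a) \<Rightarrow> bool" where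
  "has_dense_orbit X f \<longleftrightarrow>
     (\<exists>x\<in>X. X \<subseteq> closure (range (\<lambda>n. (f ^^ n) x)) \<and>
        (\<forall>\<^sub>F n in sequentially. continuous (at ((f ^^ n) x) within X) f))"

definition class_D :: "(real \<Rightarrow> 'a::t2_space) \<Rightarrow> 'a measure \<Rightarrow> ('a \<Rightarrow> 'a) \<Rightarrow> bool" where
  "class_D p M f \<longleftrightarrow>
     f \<in> space M \<rightarrow> space M \<and> has_dense_orbit (space M) f \<and>
     (\<exists>P. neg_schwarzian_partition p M f P)"

text \<open>
  The image of \<open>I\<close> is the union of the elements of \<open>Q\<close> and a null set. On \<open>[0,1]\<close> this is the
  same as requiring the symmetric difference to be null. On the circle it is not: an image
  \<open>f ` I\<close> that is the circle minus one point has to omit a point outside \<open>\<Union>P\<close>. Otherwise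
  \<open>P\<close> could be a single arc, and a homeomorphism with one break point and negative Schwarzian derivative
  elsewhere would count; such a map can be minimal and have no absolutely continuous
  \<open>\<sigma>\<close>-finite invariant measure.
\<close>

definition markov_partition :: "'a measure \<Rightarrow> ('a \<Rightarrow> 'a) \<Rightarrow> 'a set set \<Rightarrow> bool" where
  "markov_partition M f P \<longleftrightarrow>
     (\<forall>I\<in>P. \<exists>Q\<subseteq>P. \<Union>Q \<subseteq> f ` I \<and> f ` I - \<Union>Q \<in> null_sets M)"

definition finite_to_one_partition :: "'a measure \<Rightarrow> ('a \<Rightarrow> 'a) \<Rightarrow> 'a set set \<Rightarrow> bool" where
  "finite_to_one_partition M f P \<longleftrightarrow>
     (\<forall>I\<in>P. \<exists>F\<subseteq>P. finite F \<and> (AE x in M. f x \<in> I \<longrightarrow> x \<in> \<Union>F))"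

definition finite_to_one_markov_map ::
    "(real \<Rightarrow> 'a::t2_space) \<Rightarrow> 'a measure \<Rightarrow> ('a \<Rightarrow> 'a) \<Rightarrow> bool" where
  "finite_to_one_markov_map p M f \<longleftrightarrow>
     class_D p M f \<and>
     (\<exists>P. neg_schwarzian_partition p M f P \<and> markov_partition M f P \<and>
        finite_to_one_partition M f P)"

text \<open>
  \<open>f\<close> is not assumed to be Borel on the null set outside the partition, so \<open>f -` A\<close> is in general
  only measurable for the completion. If \<open>f\<close> is Borel, the completion can be dropped.
\<close>

definition invariant_measure :: "('a \<Rightarrow> 'a) \<Rightarrow> 'a measure \<Rightarrow> bool" where
  "invariant_measure f \<mu> \<longleftrightarrow>
     (\<forall>A\<in>sets \<mu>. f -` A \<inter> space \<mu> \<in> sets (completion \<mu>) \<and>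
        emeasure (completion \<mu>) (f -` A \<inter> space \<mu>) = emeasure \<mu> A)"

end

theory Submission
  imports Defs
begin

text \<open>
  In the coordinate given by the parametrisation, every inverse branch \<open>\<psi>\<close> of an iterate of \<open>f\<close>
  that lands in an element of the partition has nonnegative Schwarzian derivative, so that
  \<open>1 / sqrt \<bar>\<psi>'\<bar>\<close> is concave. Hence the densities of the images of Lebesgue measure under the
  iterates of \<open>f\<close> satisfy, inside every element, a Harnack inequality whose constant does not
  depend on the iterate. The Markov property and the dense orbit make the induced random walk on the
  elements irreducible, and an invariant measure is obtained as a limit of normalised sums of
  such images, as for Markov chains. If some compact set has infinite expected sojourn
  time, take the sums \<open>\<Sum>i<n. f\<^sup>i \<lambda>\<close>. Otherwise the partition is infinite, and one takes, as in Harris'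
  theorem on transient chains, the Green measures \<open>\<Sum>i. f\<^sup>i (\<lambda>|J)\<close> with \<open>J\<close> running through distinct
  elements. Finite-to-oneness means that no mass is lost in the limit of the invariance relation,
  since the preimage of a compact part of an element is contained, up to a null set, in finitely many
  such compact parts.
\<close>

section \<open>Limits of asymptotically invariant set functions\<close>

text \<open>The Harnack constant blows up at the end points of an element, so neither the total mass
  of a normalised sum nor its mass near the end points is controlled. Bounds are available only on
  the sets \<open>E k\<close>, and the normalisation uses the mass of a single compact interval
  \<open>K i0 n0\<close>. Irreducibility makes one interval suffice: a part of positive measure of
  every \<open>K i k\<close> reaches it at some fixed time.

  Both constructions satisfy the invariance relation up to an explicit defect. For sums of images of
  \<open>lam\<close> it consists of the two end terms of a telescoping sum, which stay bounded while
  the normalisation tends to infinity. For a Green measure it is the starting mass on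
  \<open>J n\<close>, which need not become small but leaves every \<open>E k\<close>. The latter is
  impossible with finitely many elements, and this is why that case has to be excluded by proving
  recurrence.\<close>

lemma compact_UNIV_fun:
  assumes "compact (UNIV :: 'b::topological_space set)"
  shows "compact (UNIV :: ('a \<Rightarrow> 'b) set)"
proof -
  have "compact_space (product_topology (\<lambda>_::'a. euclidean :: 'b topology) UNIV)"
    unfolding compact_space_product_topology using assms by (simp add: compact_space_def)
  then show ?thesis
    unfolding euclidean_product_topology by (simp add: compact_space_def)
qed

text \<open>By Tychonoff's theorem the sequence \<open>b\<close>, viewed as points of a power of the
  compact space \<open>ennreal\<close>, has a cluster point. The index set is in general
  uncountable, so a cluster point need not be the limit of a subsequence; convergence along a finer
  filter takes its place.\<close>

lemma simultaneous_cluster_limit: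
  fixes b :: "nat \<Rightarrow> 'x \<Rightarrow> ennreal"
  obtains F L where "F \<le> sequentially" "F \<noteq> bot" "\<And>x. ((\<lambda>n. b n x) \<longlongrightarrow> L x) F"
proof -
  have "compact (UNIV :: ('x \<Rightarrow> ennreal) set)"
    by (intro compact_UNIV_fun compact_UNIV)
  moreover have "filtermap b sequentially \<noteq> bot"
    by (simp add: filtermap_bot_iff)
  ultimately obtain L where L: "inf (nhds L) (filtermap b sequentially) \<noteq> bot"
    unfolding compact_filter by auto
  \<comment> \<open>\<open>F\<close> is generated by the tails of the sequence restricted to indices
    at which \<open>b\<close> is near \<open>L\<close>. It is proper because \<open>L\<close> is a
    cluster point.\<close>
  define F where "F = inf (filtercomap b (nhds L)) sequentially"
  have "F \<noteq> bot"
  proof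
    assume "F = bot"
    then have "eventually (\<lambda>_. False) F" by simp
    then obtain P Q where PQ: "eventually P (filtercomap b (nhds L))" "eventually Q sequentially"
      "\<And>n. P n \<Longrightarrow> Q n \<Longrightarrow> False"
      unfolding F_def eventually_inf by metis
    obtain R where R: "eventually R (nhds L)" "\<And>n. R (b n) \<Longrightarrow> P n"
      using PQ(1) unfolding eventually_filtercomap by metis
    have "eventually (\<lambda>x. \<not> R x) (filtermap b sequentially)"
      using PQ(2) unfolding eventually_filtermap
      by (rule eventually_mono) (use PQ(3) R(2) in blast)
    then have "eventually (\<lambda>_. False) (inf (nhds L) (filtermap b sequentially))"
      unfolding eventually_inf using R(1) by blast
    then show False using L by (simp add: eventually_False)
  qed
  moreover have "F \<le> sequentially" by (simp add: F_def)
  moreover have "((\<lambda>n. b n x) \<longlongrightarrow> L x) F" for x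
  proof -
    have "filterlim b (nhds L) F"
      unfolding F_def filterlim_iff_le_filtercomap by simp
    moreover have "filterlim (\<lambda>g::'x \<Rightarrow> ennreal. g x) (nhds (L x)) (nhds L)"
      unfolding filterlim_def le_filter_def eventually_filtermap
    proof (intro allI impI)
      fix P assume "eventually P (nhds (L x))"
      then obtain U where U: "open U" "L x \<in> U" "\<And>y. y \<in> U \<Longrightarrow> P y"
        unfolding eventually_nhds by blast
      have "open ((\<lambda>g::'x \<Rightarrow> ennreal. g x) -` U)"
        by (intro open_vimage U continuous_on_product_coordinates)
      then show "eventually (\<lambda>g. P (g x)) (nhds L)"
        unfolding eventually_nhds using U by (intro exI[of _ "(\<lambda>g. g x) -` U"]) auto
    qed
    ultimately show ?thesis
      by (rule filterlim_compose[rotated])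
  qed
  ultimately show thesis using that by blast
qed

text \<open>
  On each \<open>E k\<close> the limit along a cluster filter is dominated by \<open>M\<close>; this makes the merely
  finitely additive limit countably additive there. Since preimages of \<open>E k\<close> stay in some
  \<open>E k'\<close>, no mass escapes when the invariance relation is passed to the limit.
\<close>

theorem invariant_measure_of_asymptotically_invariant:
  fixes b :: "nat \<Rightarrow> 'a set \<Rightarrow> ennreal" and E :: "nat \<Rightarrow> 'a set"
  assumes T[measurable]: "T \<in> measurable M M"
    and nonsing: "\<And>N. N \<in> null_sets M \<Longrightarrow> T -` N \<inter> space M \<in> null_sets M"
    and E[measurable]: "\<And>k. E k \<in> sets M" and "incseq E"
    and E_fin: "\<And>k. emeasure M (E k) < \<infinity>"
    and E_full: "space M - (\<Union>k. E k) \<in> null_sets M"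
    and add: "\<And>n A B. A \<in> sets M \<Longrightarrow> B \<in> sets M \<Longrightarrow> A \<inter> B = {} \<Longrightarrow> b n (A \<union> B) = b n A + b n B"
    and null: "\<And>n A. A \<in> null_sets M \<Longrightarrow> b n A = 0"
    and dom: "\<And>k. \<exists>C::real. \<forall>\<^sub>F n in sequentially. \<forall>A\<in>sets M. A \<subseteq> E k \<longrightarrow> b n A \<le> ennreal C * emeasure M A"
    and inv: "\<And>k A. A \<in> sets M \<Longrightarrow> A \<subseteq> E k \<Longrightarrow> \<exists>d e. d \<longlonglongrightarrow> 0 \<and> e \<longlonglongrightarrow> 0 \<and>
               (\<forall>\<^sub>F n in sequentially. b n (T -` A \<inter> space M) + d n = b n A + e n)"
    and preim: "\<And>k. \<exists>k'. (T -` E k \<inter> space M) - E k' \<in> null_sets M"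
    and K0: "K0 \<in> sets M" "K0 \<subseteq> E k0" "\<forall>\<^sub>F n in sequentially. b n K0 = 1"
  obtains \<mu> where "sets \<mu> = sets M" "emeasure \<mu> (space M) \<noteq> 0" "\<And>k. emeasure \<mu> (E k) < \<infinity>"
    "\<And>N. N \<in> null_sets M \<Longrightarrow> emeasure \<mu> N = 0"
    "\<And>A. A \<in> sets M \<Longrightarrow> emeasure \<mu> (T -` A \<inter> space M) = emeasure \<mu> A"
proof -
  obtain F L where F: "F \<le> sequentially" "F \<noteq> bot" and L: "\<And>A. ((\<lambda>n. b n A) \<longlongrightarrow> L A) F"
    using simultaneous_cluster_limit[of b] by metis
  have evF: "eventually P F" if "eventually P sequentially" for P
    using F(1) that by (rule filter_leD)
  have L_add: "L (A \<union> B) = L A + L B" if "A \<in> sets M" "B \<in> sets M" "A \<inter> B = {}" for A B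
  proof -
    have "((\<lambda>n. b n A + b n B) \<longlongrightarrow> L A + L B) F"
      by (intro tendsto_add L)
    with L[of "A \<union> B"] show ?thesis
      using tendsto_unique[OF F(2)] that by (simp add: add)
  qed
  have L_null: "L A = 0" if "A \<in> null_sets M" for A
    using L[of A] tendsto_unique[OF F(2) _ tendsto_const[of "0::ennreal"]] that by (simp add: null)
  have L_mono: "L A \<le> L B" if "A \<in> sets M" "B \<in> sets M" "A \<subseteq> B" for A B
    using L_add[of A "B - A"] that by (auto simp: Un_absorb1)
  have "\<exists>C::real. \<forall>A\<in>sets M. A \<subseteq> E k \<longrightarrow> L A \<le> ennreal C * emeasure M A" for k
  proof -
    obtain C where C: "\<forall>\<^sub>F n in sequentially. \<forall>A\<in>sets M. A \<subseteq> E k \<longrightarrow> b n A \<le> ennreal C * emeasure M A"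
      using dom by blast
    have "L A \<le> ennreal C * emeasure M A" if "A \<in> sets M" "A \<subseteq> E k" for A
      by (rule tendsto_upperbound[OF L _ F(2)])
         (use evF[OF C] that in \<open>auto elim: eventually_mono\<close>)
    then show ?thesis by blast
  qed
  then obtain C :: "nat \<Rightarrow> real" where C: "\<And>k A. A \<in> sets M \<Longrightarrow> A \<subseteq> E k \<Longrightarrow> L A \<le> ennreal (C k) * emeasure M A"
    by metis
  have L_inv: "L (T -` A \<inter> space M) = L A" if A: "A \<in> sets M" "A \<subseteq> E k" for A k
  proof -
    obtain d e where de: "d \<longlonglongrightarrow> 0" "e \<longlonglongrightarrow> 0"
      "\<forall>\<^sub>F n in sequentially. b n (T -` A \<inter> space M) + d n = b n A + e n"
      using inv[OF A] by blast
    have 1: "((\<lambda>n. b n (T -` A \<inter> space M) + d n) \<longlongrightarrow> L (T -` A \<inter> space M) + 0) F"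
      by (intro tendsto_add L tendsto_mono[OF F(1) de(1)])
    have 2: "((\<lambda>n. b n A + e n) \<longlongrightarrow> L A + 0) F"
      by (intro tendsto_add L tendsto_mono[OF F(1) de(2)])
    have "((\<lambda>n. b n (T -` A \<inter> space M) + d n) \<longlongrightarrow> L A + 0) F"
      by (rule tendsto_cong[THEN iffD2, OF evF[OF de(3)] 2])
    with 1 show ?thesis using tendsto_unique[OF F(2)] by fastforce
  qed
  \<comment> \<open>On the whole space \<open>L\<close> is only finitely additive. Cut down to
    \<open>E k\<close> it is dominated by \<open>M\<close> and becomes a genuine measure
    \<open>m k\<close>; these increase with \<open>k\<close>, and their supremum will be the
    invariant measure.\<close>
  define m where "m k A = L (A \<inter> E k)" for k A
  have m_incseq: "incseq (\<lambda>k. m k A)" if "A \<in> sets M" for A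
    unfolding m_def using that \<open>incseq E\<close> by (intro monoI L_mono) (auto simp: mono_def)
  have m_cadd: "(\<Sum>i. m k (A i)) = m k (\<Union>i. A i)" if A: "range A \<subseteq> sets M" "disjoint_family A" for A :: "nat \<Rightarrow> 'a set" and k
  proof -
    have [measurable]: "A i \<in> sets M" for i using A by auto
    define R where "R n = (\<Union>i\<in>{n..}. A i) \<inter> E k" for n
    have [measurable]: "R n \<in> sets M" for n unfolding R_def by measurable
    have split: "(\<Sum>i<n. m k (A i)) + L (R n) = m k (\<Union>i. A i)" for n
    proof (induction n)
      case 0
      then show ?case by (simp add: m_def R_def)
    next
      case (Suc n)
      have eq: "R n = (A n \<inter> E k) \<union> R (Suc n)"
      proof -
        have "{n..} = insert n {Suc n..}" by auto
        then show ?thesis unfolding R_def by auto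
      qed
      have "(A n \<inter> E k) \<inter> R (Suc n) = {}"
      proof -
        have "A n \<inter> A j = {}" if "j \<ge> Suc n" for j
          using A(2) that by (auto simp: disjoint_family_on_def)
        then show ?thesis unfolding R_def by blast
      qed
      then have "L (R n) = m k (A n) + L (R (Suc n))"
        using L_add[of "A n \<inter> E k" "R (Suc n)"] by (simp add: eq[symmetric] m_def)
      then show ?case using Suc by (simp add: add.assoc)
    qed
    \<comment> \<open>The tails \<open>R n\<close> decrease to the empty set inside a set of finite
      measure. Their \<open>M\<close>-measure therefore tends to 0, and by domination so does
      \<open>L (R n)\<close>, the remainder in finite additivity.\<close>
    have "(\<lambda>n. emeasure M (R n)) \<longlonglongrightarrow> emeasure M (\<Inter>n. R n)"
    proof (rule Lim_emeasure_decseq)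
      show "decseq R" unfolding R_def by (intro antimonoI) (auto intro: order_trans)
      show "emeasure M (R i) \<noteq> \<infinity>" for i
        using emeasure_mono[of "R i" "E k" M] E_fin[of k] unfolding R_def
        by (auto simp: less_top top_unique)
    qed auto
    moreover have "(\<Inter>n. R n) = {}"
    proof -
      have False if x: "\<forall>n. x \<in> R n" for x
      proof -
        obtain i where i: "x \<in> A i" using x unfolding R_def by blast
        obtain j where j: "j \<ge> Suc i" "x \<in> A j" using x[rule_format, of "Suc i"] unfolding R_def by auto
        then have "A i \<inter> A j = {}" using A(2) by (auto simp: disjoint_family_on_def)
        then show False using i j by blast
      qed
      then show ?thesis by blast
    qed
    ultimately have "(\<lambda>n. emeasure M (R n)) \<longlonglongrightarrow> 0" by simp
    then have "(\<lambda>n. ennreal (C k) * emeasure M (R n)) \<longlonglongrightarrow> ennreal (C k) * 0"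
      by (intro ennreal_tendsto_cmult) auto
    then have R0: "(\<lambda>n. L (R n)) \<longlonglongrightarrow> 0"
    proof -
      assume *: "(\<lambda>n. ennreal (C k) * emeasure M (R n)) \<longlonglongrightarrow> ennreal (C k) * 0"
      have "L (R n) \<le> ennreal (C k) * emeasure M (R n)" for n
        by (rule C) (auto simp: R_def)
      then show ?thesis
        using tendsto_sandwich[of "\<lambda>_. 0" "\<lambda>n. L (R n)" sequentially
            "\<lambda>n. ennreal (C k) * emeasure M (R n)" 0] * by simp
    qed
    have "(\<lambda>n. (\<Sum>i<n. m k (A i)) + L (R n)) \<longlonglongrightarrow> (\<Sum>i. m k (A i)) + 0"
      by (intro tendsto_add summable_LIMSEQ R0) auto
    then have "(\<lambda>n::nat. m k (\<Union>i. A i)) \<longlonglongrightarrow> (\<Sum>i. m k (A i))" unfolding split by simp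
    then show ?thesis by (rule LIMSEQ_unique[OF _ tendsto_const])
  qed
  define \<mu> where "\<mu> = measure_of (space M) (sets M) (\<lambda>A. SUP k. m k A)"
  have sets_\<mu>[simp]: "sets \<mu> = sets M" by (simp add: \<mu>_def)
  have em: "emeasure \<mu> A = (SUP k. m k A)" if "A \<in> sets M" for A
  proof (rule emeasure_measure_of[OF \<mu>_def])
    show "sets M \<subseteq> Pow (space M)" by (rule sets.space_closed)
    show "positive (sets \<mu>) (\<lambda>A. SUP k. m k A)"
      using L_null by (auto simp: positive_def m_def)
    show "countably_additive (sets \<mu>) (\<lambda>A. SUP k. m k A)"
    proof (rule countably_additiveI)
      fix A :: "nat \<Rightarrow> 'a set" assume A: "range A \<subseteq> sets \<mu>" "disjoint_family A"
      have "(\<Sum>i. SUP k. m k (A i)) = (SUP k. \<Sum>i. m k (A i))"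
        using A m_incseq by (intro ennreal_suminf_SUP_eq) auto
      also have "\<dots> = (SUP k. m k (\<Union>i. A i))" using A by (simp add: m_cadd)
      finally show "(\<Sum>i. SUP k. m k (A i)) = (SUP k. m k (\<Union>i. A i))" .
    qed
    show "A \<in> sets \<mu>" using that by simp
  qed
  \<comment> \<open>On sets that lie in no single \<open>E k\<close> the value of \<open>L\<close>
    may exceed that of \<open>\<mu>\<close>, because mass can escape in the limit. Below,
    \<open>L\<close> is compared with \<open>\<mu>\<close> only inside one
    \<open>E k\<close>.\<close>
  have em_sub: "emeasure \<mu> A = L A" if "A \<in> sets M" "A \<subseteq> E k" for A k
  proof -
    have "m j A = L A" if "j \<ge> k" for j
    proof -
      have "A \<inter> E j = A" using \<open>A \<subseteq> E k\<close> incseqD[OF \<open>incseq E\<close> that] by blast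
      then show ?thesis by (simp add: m_def)
    qed
    then have "(\<lambda>j. m j A) \<longlonglongrightarrow> L A"
      by (intro tendsto_eventually) (auto simp: eventually_sequentially)
    then show ?thesis
      using LIMSEQ_SUP[OF m_incseq[OF that(1)]] LIMSEQ_unique em[OF that(1)] by metis
  qed
  have nullset: "emeasure \<mu> N = 0" if "N \<in> null_sets M" for N
  proof -
    have "m k N = 0" for k
      unfolding m_def using that by (intro L_null) (auto intro: null_set_Int2)
    then show ?thesis using that by (subst em) (auto simp: null_setsD2)
  qed
  have emE: "emeasure \<mu> (T -` A \<inter> space M) = emeasure \<mu> A" if A: "A \<in> sets M" "A \<subseteq> E k" for A k
  proof -
    let ?B = "T -` A \<inter> space M"
    obtain k' where k': "(T -` E k \<inter> space M) - E k' \<in> null_sets M" using preim by blast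
    have [measurable]: "?B \<in> sets M" using A by measurable
    have n: "?B - E k' \<in> null_sets M"
      by (rule null_sets_subset[OF k']) (use A in auto)
    have e: "?B = (?B \<inter> E k') \<union> (?B - E k')" by auto
    have "L ?B = L (?B \<inter> E k') + L (?B - E k')"
      by (subst e, rule L_add) auto
    then have "L ?B = L (?B \<inter> E k')" using L_null[OF n] by simp
    moreover have "emeasure \<mu> ?B = emeasure \<mu> (?B \<inter> E k') + emeasure \<mu> (?B - E k')"
      by (subst e, rule plus_emeasure[symmetric]) auto
    ultimately show ?thesis
      using nullset[OF n] em_sub[of "?B \<inter> E k'" k'] L_inv[OF A] em_sub[OF A] by simp
  qed
  show thesis
  proof (rule that)
    show "sets \<mu> = sets M" by simp
    have "L K0 = 1"
    proof (rule tendsto_unique[OF F(2) L])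
      show "((\<lambda>n. b n K0) \<longlongrightarrow> 1) F"
        by (rule tendsto_eventually[OF evF[OF K0(3)]])
    qed
    then have "emeasure \<mu> K0 = 1" using em_sub[OF K0(1,2)] by simp
    moreover have "emeasure \<mu> K0 \<le> emeasure \<mu> (space M)"
      using K0(1) sets.sets_into_space by (intro emeasure_mono) auto
    ultimately show "emeasure \<mu> (space M) \<noteq> 0" by auto
    show "emeasure \<mu> (E k) < \<infinity>" for k
    proof -
      have "emeasure \<mu> (E k) \<le> ennreal (C k) * emeasure M (E k)"
        using em_sub[of "E k" k] C[of "E k" k] by simp
      also have "\<dots> < \<infinity>" using E_fin[of k] by (simp add: ennreal_mult_less_top)
      finally show ?thesis .
    qed
    show "emeasure \<mu> (T -` A \<inter> space M) = emeasure \<mu> A" if A[measurable]: "A \<in> sets M" for A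
    proof -
      let ?N = "space M - (\<Union>k. E k)"
      have decomp: "emeasure \<mu> B = (SUP k. emeasure \<mu> (B \<inter> D k))"
        if B[measurable]: "B \<in> sets M" and D: "\<And>k. D k \<in> sets M" "incseq D" "space M - (\<Union>k. D k) \<in> null_sets M" for B and D :: "nat \<Rightarrow> 'a set"
      proof -
        note [measurable] = D(1)
        have "emeasure \<mu> B = emeasure \<mu> (\<Union>k. B \<inter> D k) + emeasure \<mu> (B - (\<Union>k. D k))"
        proof (subst plus_emeasure)
          show "emeasure \<mu> B = emeasure \<mu> ((\<Union>k. B \<inter> D k) \<union> (B - (\<Union>k. D k)))"
            by (rule arg_cong[of _ _ "emeasure \<mu>"]) blast
        qed auto
        also have "B - (\<Union>k. D k) \<in> null_sets M"
          by (rule null_sets_subset[OF D(3)]) (use sets.sets_into_space[OF B] in auto)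
        then have "emeasure \<mu> (B - (\<Union>k. D k)) = 0" by (rule nullset)
        also have "emeasure \<mu> (\<Union>k. B \<inter> D k) = (SUP k. emeasure \<mu> (B \<inter> D k))"
          using D(2) by (intro SUP_emeasure_incseq[symmetric]) (auto simp: mono_def)
        finally show ?thesis by simp
      qed
      \<comment> \<open>The preimage of \<open>A\<close> is exhausted by the preimages of the
        \<open>E k\<close>, not by the \<open>E k\<close> themselves: each piece is then the
        preimage of a subset of \<open>E k\<close>, for which invariance is known. Nonsingularity of
        \<open>T\<close> shows that the pieces fill the space up to a null set.\<close>
      have "space M - (\<Union>k. T -` E k \<inter> space M) \<in> null_sets M"
        by (rule null_sets_subset[OF nonsing[OF E_full]])
           (auto dest: measurable_space[OF T])
      moreover have "incseq (\<lambda>k. T -` E k \<inter> space M)"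
        using \<open>incseq E\<close> by (fastforce simp: mono_def)
      ultimately have "emeasure \<mu> (T -` A \<inter> space M) =
          (SUP k. emeasure \<mu> ((T -` A \<inter> space M) \<inter> (T -` E k \<inter> space M)))"
        by (intro decomp) auto
      also have "\<dots> = (SUP k. emeasure \<mu> (T -` (A \<inter> E k) \<inter> space M))"
        by (intro SUP_cong arg_cong[of _ _ "emeasure \<mu>"]) auto
      also have "\<dots> = (SUP k. emeasure \<mu> (A \<inter> E k))"
        by (intro SUP_cong emE refl) auto
      also have "\<dots> = emeasure \<mu> A"
        using decomp[OF A E \<open>incseq E\<close> E_full] by simp
      finally show ?thesis .
    qed
  qed (rule nullset)
qed

section \<open>Distortion of maps with nonnegative Schwarzian derivative\<close>

text \<open>The inequality is S\<psi> \<ge> 0 multiplied by \<open>2 * (\<psi>1 t)\<^sup>2\<close>.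
  The first derivative is an argument because its absolute value is the Jacobian in the change of
  variables.\<close>

definition nonneg_schwarzian_on :: "real set \<Rightarrow> (real \<Rightarrow> real) \<Rightarrow> (real \<Rightarrow> real) \<Rightarrow> bool" where
  "nonneg_schwarzian_on S \<psi> \<psi>1 \<longleftrightarrow>
     (\<exists>\<psi>2 \<psi>3. \<forall>t\<in>S. (\<psi> has_real_derivative \<psi>1 t) (at t) \<and> (\<psi>1 has_real_derivative \<psi>2 t) (at t) \<and>
        (\<psi>2 has_real_derivative \<psi>3 t) (at t) \<and> \<psi>1 t \<noteq> 0 \<and> 3 * (\<psi>2 t)\<^sup>2 \<le> 2 * \<psi>1 t * \<psi>3 t)"

lemma nonneg_schwarzian_on_uminus:
  assumes "nonneg_schwarzian_on S \<psi> \<psi>1"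
  shows "nonneg_schwarzian_on S (\<lambda>t. - \<psi> t) (\<lambda>t. - \<psi>1 t)"
proof -
  obtain \<psi>2 \<psi>3 where "\<forall>t\<in>S. (\<psi> has_real_derivative \<psi>1 t) (at t) \<and> (\<psi>1 has_real_derivative \<psi>2 t) (at t) \<and>
        (\<psi>2 has_real_derivative \<psi>3 t) (at t) \<and> \<psi>1 t \<noteq> 0 \<and> 3 * (\<psi>2 t)\<^sup>2 \<le> 2 * \<psi>1 t * \<psi>3 t"
    using assms unfolding nonneg_schwarzian_on_def by blast
  then show ?thesis unfolding nonneg_schwarzian_on_def
    by (intro exI[of _ "\<lambda>t. - \<psi>2 t"] exI[of _ "\<lambda>t. - \<psi>3 t"]) (auto intro!: DERIV_minus)
qed

lemma nonneg_schwarzian_on_sign: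
  assumes "nonneg_schwarzian_on {a<..<b} \<psi> \<psi>1"
  shows "(\<forall>t\<in>{a<..<b}. \<psi>1 t > 0) \<or> (\<forall>t\<in>{a<..<b}. \<psi>1 t < 0)"
proof (rule ccontr)
  assume "\<not> ?thesis"
  then obtain s t where st: "s \<in> {a<..<b}" "t \<in> {a<..<b}" "\<psi>1 s \<le> 0" "\<psi>1 t \<ge> 0"
    by (meson not_le)
  have "continuous_on {a<..<b} \<psi>1"
    using assms unfolding nonneg_schwarzian_on_def
    by (auto intro!: continuous_at_imp_continuous_on intro: DERIV_isCont)
  then have "connected (\<psi>1 ` {a<..<b})" by (intro connected_continuous_image) auto
  then have "0 \<in> \<psi>1 ` {a<..<b}"
    using st unfolding connected_iff_interval by blast
  then show False using assms unfolding nonneg_schwarzian_on_def by auto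
qed

text \<open>
  \<open>(1 / sqrt \<psi>')'' = - S\<psi> / (2 * sqrt \<psi>')\<close>, and multiplying by an affine function of \<open>\<psi>\<close> only
  multiplies this second derivative by the same function: the other terms cancel.
\<close>

lemma nonneg_schwarzian_concave:
  fixes \<alpha> \<beta> :: real
  assumes \<psi>: "nonneg_schwarzian_on {a<..<b} \<psi> \<psi>1"
    and pos: "\<And>t. t \<in> {a<..<b} \<Longrightarrow> \<psi>1 t > 0"
    and nn: "\<And>t. t \<in> {a<..<b} \<Longrightarrow> \<alpha> + \<beta> * \<psi> t \<ge> 0"
  shows "convex_on {a<..<b} (\<lambda>t. - ((\<alpha> + \<beta> * \<psi> t) / sqrt (\<psi>1 t)))"
proof -
  obtain \<psi>2 \<psi>3 where D: "\<And>t. t\<in>{a<..<b} \<Longrightarrow> (\<psi> has_real_derivative \<psi>1 t) (at t)"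
        "\<And>t. t\<in>{a<..<b} \<Longrightarrow> (\<psi>1 has_real_derivative \<psi>2 t) (at t)"
        "\<And>t. t\<in>{a<..<b} \<Longrightarrow> (\<psi>2 has_real_derivative \<psi>3 t) (at t)"
        "\<And>t. t\<in>{a<..<b} \<Longrightarrow> 3 * (\<psi>2 t)\<^sup>2 \<le> 2 * \<psi>1 t * \<psi>3 t"
    using \<psi> unfolding nonneg_schwarzian_on_def by blast
  define d where "d t = - (\<beta> * sqrt (\<psi>1 t)) + (\<alpha> + \<beta> * \<psi> t) * \<psi>2 t / (2 * \<psi>1 t * sqrt (\<psi>1 t))" for t
  define e where "e t = (\<alpha> + \<beta> * \<psi> t) * (2 * \<psi>1 t * \<psi>3 t - 3 * (\<psi>2 t)\<^sup>2) / (4 * (\<psi>1 t)\<^sup>2 * sqrt (\<psi>1 t))" for t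
  show ?thesis
  proof (rule f''_ge0_imp_convex[where f' = d and f'' = e])
    fix t assume t: "t \<in> {a<..<b}"
    note P = pos[OF t]
    \<comment> \<open>With \<open>r\<close> for the square root of \<open>\<psi>1 t\<close>, all
      derivative formulas become identities between rational expressions in \<open>r\<close>, which
      \<open>field_simps\<close> can decide.\<close>
    define r where "r = sqrt (\<psi>1 t)"
    have r: "r > 0" "\<psi>1 t = r\<^sup>2" using P by (simp_all add: r_def)
    have rn: "r \<noteq> 0" using r by simp
    have s: "((\<lambda>t. sqrt (\<psi>1 t)) has_real_derivative \<psi>2 t / (2 * r)) (at t)"
      using DERIV_chain2[OF DERIV_real_sqrt D(2)[OF t]] P by (simp add: r_def field_simps)
    have l: "((\<lambda>t. \<alpha> + \<beta> * \<psi> t) has_real_derivative \<beta> * \<psi>1 t) (at t)"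
      by (rule derivative_eq_intros D[OF t] refl | simp)+
    have "((\<lambda>t. - ((\<alpha> + \<beta> * \<psi> t) / sqrt (\<psi>1 t))) has_real_derivative
        - ((\<beta> * \<psi>1 t * sqrt (\<psi>1 t) - (\<alpha> + \<beta> * \<psi> t) * (\<psi>2 t / (2 * r))) / (sqrt (\<psi>1 t) * sqrt (\<psi>1 t)))) (at t)"
      by (rule DERIV_minus DERIV_divide l s)+ (use rn in \<open>simp add: r_def\<close>)
    then show "((\<lambda>t. - ((\<alpha> + \<beta> * \<psi> t) / sqrt (\<psi>1 t))) has_real_derivative d t) (at t)"
      by (rule DERIV_cong) (use rn r(1) in \<open>simp add: d_def r_def[symmetric] r(2), simp add: field_simps power2_eq_square\<close>)
    have "(d has_real_derivative - (\<beta> * (\<psi>2 t / (2 * r))) +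
       (((\<beta> * \<psi>1 t) * \<psi>2 t + \<psi>3 t * (\<alpha> + \<beta> * \<psi> t)) * (2 * \<psi>1 t * sqrt (\<psi>1 t)) -
        ((\<alpha> + \<beta> * \<psi> t) * \<psi>2 t) * ((2 * \<psi>2 t) * sqrt (\<psi>1 t) + \<psi>2 t / (2 * r) * (2 * \<psi>1 t))) /
       ((2 * \<psi>1 t * sqrt (\<psi>1 t)) * (2 * \<psi>1 t * sqrt (\<psi>1 t)))) (at t)"
      unfolding d_def
      by (rule DERIV_add DERIV_minus DERIV_divide DERIV_mult DERIV_cmult l s D[OF t])+
         (use rn P in \<open>simp add: r_def\<close>)
    then show "(d has_real_derivative e t) (at t)"
      by (rule DERIV_cong) (use rn r(1) in \<open>simp add: e_def r_def[symmetric] r(2), simp add: field_simps power2_eq_square power4_eq_xxxx\<close>)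
    show "0 \<le> e t"
      unfolding e_def using nn[OF t] D(4)[OF t] P by (intro divide_nonneg_pos mult_nonneg_nonneg) auto
  qed simp
qed

text \<open>For concave \<open>v \<ge> 0\<close> the quotient \<open>v t / (t - a)\<close> decreases
  and \<open>v t / (b - t)\<close> increases. Since nothing is known about \<open>v\<close> at the
  end points, the chord inequality is used with an interior point \<open>p\<close>, the term with
  \<open>v p\<close> is dropped by nonnegativity, and \<open>p\<close> tends to the end
  point.\<close>

lemma concave_slope_bounds:
  fixes v :: "real \<Rightarrow> real"
  assumes v: "convex_on {a<..<b} (\<lambda>t. - v t)" and nn: "\<And>t. t \<in> {a<..<b} \<Longrightarrow> v t \<ge> 0"
    and xy: "a < x" "x \<le> y" "y < b"
  shows "(x - a) * v y \<le> (y - a) * v x" "(b - y) * v x \<le> (b - x) * v y"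
proof -
  have comb: "(q - p) * v s \<ge> (q - s) * v p + (s - p) * v q" if "a < p" "p \<le> s" "s \<le> q" "q < b" for p q s
  proof (cases "p = q")
    case False
    then have pq: "p < q" using that by auto
    define \<tau> where "\<tau> = (s - p)/(q - p)"
    have \<tau>: "0 \<le> \<tau>" "\<tau> \<le> 1" "\<tau> * (q - p) = s - p" using that pq by (auto simp: \<tau>_def field_simps)
    have "(1 - \<tau>) *\<^sub>R p + \<tau> *\<^sub>R q = p + \<tau> * (q - p)"
      by (simp add: algebra_simps)
    then have e: "(1 - \<tau>) *\<^sub>R p + \<tau> *\<^sub>R q = s" using \<tau> by simp
    have "- v ((1 - \<tau>) *\<^sub>R p + \<tau> *\<^sub>R q) \<le> (1 - \<tau>) * (- v p) + \<tau> * (- v q)"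
      using that \<tau> by (intro convex_onD[OF v]) auto
    then have "(q - p) * (- v s) \<le> (q - p) * ((1 - \<tau>) * (- v p) + \<tau> * (- v q))"
      unfolding e using pq by (intro mult_left_mono) auto
    also have "\<dots> = - ((q - p) - \<tau> * (q - p)) * v p - (\<tau> * (q - p)) * v q"
      by (simp add: algebra_simps)
    also have "\<dots> = - ((q - s) * v p + (s - p) * v q)"
      unfolding \<tau>(3) by (simp add: algebra_simps)
    finally show ?thesis by simp
  qed (use that in auto)
  show "(x - a) * v y \<le> (y - a) * v x"
  proof (rule tendsto_le[where F = "at_right a"])
    show "((\<lambda>p. (y - p) * v x) \<longlongrightarrow> (y - a) * v x) (at_right a)"
      by (intro tendsto_intros)
    show "((\<lambda>p. (x - p) * v y) \<longlongrightarrow> (x - a) * v y) (at_right a)"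
      by (intro tendsto_intros)
    have "\<forall>\<^sub>F p in at_right a. p \<in> {a<..<x}" using xy by (intro eventually_at_right_real)
    then show "\<forall>\<^sub>F p in at_right a. (x - p) * v y \<le> (y - p) * v x"
    proof (rule eventually_mono)
      fix p assume "p \<in> {a<..<x}"
      then have p: "a < p" "p < x" by auto
      have "(y - x) * v p \<ge> 0" using xy p by (intro mult_nonneg_nonneg nn) auto
      then show "(x - p) * v y \<le> (y - p) * v x" using comb[of p x y] p xy by linarith
    qed
  qed simp
  show "(b - y) * v x \<le> (b - x) * v y"
  proof (rule tendsto_le[where F = "at_left b"])
    show "((\<lambda>p. (p - x) * v y) \<longlongrightarrow> (b - x) * v y) (at_left b)"
      by (intro tendsto_intros)
    show "((\<lambda>p. (p - y) * v x) \<longlongrightarrow> (b - y) * v x) (at_left b)"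
      by (intro tendsto_intros)
    have "\<forall>\<^sub>F p in at_left b. p \<in> {y<..<b}" using xy by (intro eventually_at_left_real)
    then show "\<forall>\<^sub>F p in at_left b. (p - y) * v x \<le> (p - x) * v y"
    proof (rule eventually_mono)
      fix p assume "p \<in> {y<..<b}"
      then have p: "y < p" "p < b" by auto
      have "(y - x) * v p \<ge> 0" using xy p by (intro mult_nonneg_nonneg nn) auto
      then show "(p - y) * v x \<le> (p - x) * v y" using comb[of x y p] p xy by linarith
    qed
  qed simp
qed

text \<open>These are the slope bounds for the concave function
  \<open>(\<alpha> + \<beta> * \<psi> t) / sqrt \<bar>\<psi>1 t\<bar>\<close>, squared and cleared
  of denominators. The affine factor keeps track of the position of \<open>\<psi> t\<close> in the
  target interval, as needed when a density given there is pulled back.\<close>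

lemma nonneg_schwarzian_distortion:
  fixes \<alpha> \<beta> :: real
  assumes \<psi>: "nonneg_schwarzian_on {a<..<b} \<psi> \<psi>1"
    and l: "\<And>t. t \<in> {a<..<b} \<Longrightarrow> \<alpha> + \<beta> * \<psi> t \<ge> 0"
    and xy: "a < x" "x \<le> y" "y < b"
  shows "(x - a)\<^sup>2 * \<bar>\<psi>1 x\<bar> * (\<alpha> + \<beta> * \<psi> y)\<^sup>2 \<le> (y - a)\<^sup>2 * \<bar>\<psi>1 y\<bar> * (\<alpha> + \<beta> * \<psi> x)\<^sup>2" (is "?A \<psi> \<psi>1 \<beta>")
    "(b - y)\<^sup>2 * \<bar>\<psi>1 y\<bar> * (\<alpha> + \<beta> * \<psi> x)\<^sup>2 \<le> (b - x)\<^sup>2 * \<bar>\<psi>1 x\<bar> * (\<alpha> + \<beta> * \<psi> y)\<^sup>2" (is "?B \<psi> \<psi>1 \<beta>")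
proof -
  have main: "?A \<psi> \<psi>1 \<beta> \<and> ?B \<psi> \<psi>1 \<beta>"
    if \<psi>: "nonneg_schwarzian_on {a<..<b} \<psi> \<psi>1" and pos: "\<And>t. t \<in> {a<..<b} \<Longrightarrow> \<psi>1 t > 0"
      and l: "\<And>t. t \<in> {a<..<b} \<Longrightarrow> \<alpha> + \<beta> * \<psi> t \<ge> 0" for \<psi> \<psi>1 and \<beta> :: real
  proof -
    define v where "v t = (\<alpha> + \<beta> * \<psi> t) / sqrt (\<psi>1 t)" for t
    have nn: "v t \<ge> 0" if "t \<in> {a<..<b}" for t
      unfolding v_def using pos[OF that] l[OF that] by simp
    have cv: "convex_on {a<..<b} (\<lambda>t. - v t)"
      unfolding v_def by (rule nonneg_schwarzian_concave[OF \<psi> pos l])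
    note s = concave_slope_bounds[OF cv nn xy]
    have px: "\<psi>1 x > 0" and py: "\<psi>1 y > 0" and vx: "v x \<ge> 0" and vy: "v y \<ge> 0"
      using xy by (auto intro!: pos nn)
    have sq: "(\<alpha> + \<beta> * \<psi> t)\<^sup>2 = (v t)\<^sup>2 * \<psi>1 t" if "\<psi>1 t > 0" for t
      unfolding v_def using that by (simp add: power_divide)
    have 1: "((x - a) * v y)\<^sup>2 \<le> ((y - a) * v x)\<^sup>2" "((b - y) * v x)\<^sup>2 \<le> ((b - x) * v y)\<^sup>2"
      using xy vx vy by (intro power_mono s mult_nonneg_nonneg; simp)+
    have "((x - a) * v y)\<^sup>2 * (\<psi>1 x * \<psi>1 y) \<le> ((y - a) * v x)\<^sup>2 * (\<psi>1 x * \<psi>1 y)"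
      "((b - y) * v x)\<^sup>2 * (\<psi>1 x * \<psi>1 y) \<le> ((b - x) * v y)\<^sup>2 * (\<psi>1 x * \<psi>1 y)"
      using px py 1 by (intro mult_right_mono; simp)+
    then show ?thesis
      unfolding sq[OF px] sq[OF py] using px py by (simp add: power_mult_distrib mult_ac)
  qed
  consider "\<And>t. t \<in> {a<..<b} \<Longrightarrow> \<psi>1 t > 0" | "\<And>t. t \<in> {a<..<b} \<Longrightarrow> \<psi>1 t < 0"
    using nonneg_schwarzian_on_sign[OF \<psi>] by blast
  then have "?A \<psi> \<psi>1 \<beta> \<and> ?B \<psi> \<psi>1 \<beta>"
  proof cases
    case 1 then show ?thesis by (intro main \<psi> l)
  next
    case 2
    \<comment> \<open>A decreasing \<open>\<psi>\<close> is reflected; negating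
      \<open>\<beta>\<close> as well leaves the affine factor unchanged.\<close>
    have "?A (\<lambda>t. - \<psi> t) (\<lambda>t. - \<psi>1 t) (- \<beta>) \<and> ?B (\<lambda>t. - \<psi> t) (\<lambda>t. - \<psi>1 t) (- \<beta>)"
      by (intro main nonneg_schwarzian_on_uminus \<psi>) (use 2 l in auto)
    then show ?thesis by simp
  qed
  then show "?A \<psi> \<psi>1 \<beta>" "?B \<psi> \<psi>1 \<beta>" by auto
qed

text \<open>
  Densities that are dominated on \<open>{a<..<b}\<close> by the two extremal Moebius densities
  \<open>1 / (t - a)\<^sup>2\<close> and \<open>1 / (b - t)\<^sup>2\<close> in the strong sense that the quotients are monotone. Unlike
  a Harnack inequality with a fixed constant, this is preserved exactly by pulling back along
  inverse branches.
\<close>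

definition moebius_dominated :: "real \<Rightarrow> real \<Rightarrow> (real \<Rightarrow> ennreal) \<Rightarrow> bool" where
  "moebius_dominated a b w \<longleftrightarrow>
     (\<forall>x y. a < x \<longrightarrow> x \<le> y \<longrightarrow> y < b \<longrightarrow>
        ennreal ((x - a)\<^sup>2) * w x \<le> ennreal ((y - a)\<^sup>2) * w y \<and>
        ennreal ((b - y)\<^sup>2) * w y \<le> ennreal ((b - x)\<^sup>2) * w x)"

lemma moebius_dominatedD:
  assumes "moebius_dominated a b w" "a < x" "x \<le> y" "y < b"
  shows "ennreal ((x - a)\<^sup>2) * w x \<le> ennreal ((y - a)\<^sup>2) * w y"
    "ennreal ((b - y)\<^sup>2) * w y \<le> ennreal ((b - x)\<^sup>2) * w x"
  using assms by (auto simp: moebius_dominated_def)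

lemma moebius_dominated_const: "moebius_dominated a b (\<lambda>_. c)"
  unfolding moebius_dominated_def
  by (auto intro!: mult_right_mono ennreal_leI power_mono)

lemma moebius_dominated_sum:
  assumes "\<And>j. j \<in> J \<Longrightarrow> moebius_dominated a b (w j)"
  shows "moebius_dominated a b (\<lambda>t. \<Sum>j\<in>J. w j t)"
  unfolding moebius_dominated_def sum_distrib_left
  using assms by (auto intro!: sum_mono dest: moebius_dominatedD)

lemma ennreal_mult_mult:
  "0 \<le> x \<Longrightarrow> 0 \<le> y \<Longrightarrow> ennreal x * (ennreal y * z) = ennreal (x * y) * z"
  by (simp add: ennreal_mult mult.assoc)

text \<open>For l = \<psi> - c or l = d - \<psi>, the distortion estimate compares Jacobians up to a
  quotient of values of l squared, and the hypothesis on \<open>w\<close> compares its values up to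
  the reciprocal of the same quotient, so nothing is lost. Which end point of the target is taken
  depends on the order of \<open>\<psi> x\<close> and \<open>\<psi> y\<close>.\<close>

lemma moebius_dominated_pullback:
  assumes \<psi>: "nonneg_schwarzian_on {a<..<b} \<psi> \<psi>1" and im: "\<psi> ` {a<..<b} \<subseteq> {c<..<d}"
    and w: "moebius_dominated c d w"
  shows "moebius_dominated a b (\<lambda>t. w (\<psi> t) * ennreal \<bar>\<psi>1 t\<bar>)"
  unfolding moebius_dominated_def
proof (intro allI impI conjI)
  fix x y assume xy: "a < x" "x \<le> y" "y < b"
  have im': "c < \<psi> t" "\<psi> t < d" if "t \<in> {a<..<b}" for t using im that by fastforce+
  \<comment> \<open>The two inequalities are multiplied and \<open>L * L'\<close> is cancelled. All
    divisions take place in the real coefficients, since \<open>w\<close> may be infinite.\<close>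
  have combine: "ennreal p * (w s * ennreal \<bar>m\<bar>) \<le> ennreal q * (w s' * ennreal \<bar>m'\<bar>)"
    if "p * \<bar>m\<bar> * L' \<le> q * \<bar>m'\<bar> * L" "ennreal L * w s \<le> ennreal L' * w s'" "L > 0" "L' > 0" "p \<ge> 0" "q \<ge> 0"
    for p q m m' L L' :: real and s s' :: real
  proof -
    have "ennreal p * (w s * ennreal \<bar>m\<bar>) = ennreal p * (ennreal \<bar>m\<bar> * w s)"
      by (simp add: mult.commute)
    also have "\<dots> = ennreal (p * \<bar>m\<bar> / L * L) * w s"
      using that by (simp add: ennreal_mult_mult)
    also have "\<dots> = ennreal (p * \<bar>m\<bar> / L) * (ennreal L * w s)"
      using that by (subst ennreal_mult_mult) auto
    also have "\<dots> \<le> ennreal (p * \<bar>m\<bar> / L) * (ennreal L' * w s')"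
      using that by (intro mult_left_mono) auto
    also have "\<dots> = ennreal (p * \<bar>m\<bar> * L' / L) * w s'"
      using that by (simp add: ennreal_mult_mult)
    also have "\<dots> \<le> ennreal (q * \<bar>m'\<bar>) * w s'"
      using that by (intro mult_right_mono ennreal_leI) (auto simp: field_simps)
    also have "\<dots> = ennreal q * (w s' * ennreal \<bar>m'\<bar>)"
      using that by (simp add: ennreal_mult_mult[symmetric] mult.commute[of "w s'"])
    finally show ?thesis .
  qed
  have x: "x \<in> {a<..<b}" and y: "y \<in> {a<..<b}" using xy by auto
  note D1 = nonneg_schwarzian_distortion[OF \<psi> _ xy, of "-c" 1, simplified]
  note D2 = nonneg_schwarzian_distortion[OF \<psi> _ xy, of "d" "-1", simplified]
  have D1': "(x - a)\<^sup>2 * \<bar>\<psi>1 x\<bar> * (\<psi> y - c)\<^sup>2 \<le> (y - a)\<^sup>2 * \<bar>\<psi>1 y\<bar> * (\<psi> x - c)\<^sup>2"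
     "(b - y)\<^sup>2 * \<bar>\<psi>1 y\<bar> * (\<psi> x - c)\<^sup>2 \<le> (b - x)\<^sup>2 * \<bar>\<psi>1 x\<bar> * (\<psi> y - c)\<^sup>2"
    using D1 im' by (auto simp: less_imp_le)
  have D2': "(x - a)\<^sup>2 * \<bar>\<psi>1 x\<bar> * (d - \<psi> y)\<^sup>2 \<le> (y - a)\<^sup>2 * \<bar>\<psi>1 y\<bar> * (d - \<psi> x)\<^sup>2"
     "(b - y)\<^sup>2 * \<bar>\<psi>1 y\<bar> * (d - \<psi> x)\<^sup>2 \<le> (b - x)\<^sup>2 * \<bar>\<psi>1 x\<bar> * (d - \<psi> y)\<^sup>2"
    using D2 im' by (auto simp: less_imp_le)
  have nz: "(\<psi> t - c)\<^sup>2 > 0" "(d - \<psi> t)\<^sup>2 > 0" if "t \<in> {a<..<b}" for t using im'[OF that] by auto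
  show "ennreal ((x - a)\<^sup>2) * (w (\<psi> x) * ennreal \<bar>\<psi>1 x\<bar>) \<le> ennreal ((y - a)\<^sup>2) * (w (\<psi> y) * ennreal \<bar>\<psi>1 y\<bar>)"
  proof (cases "\<psi> x \<le> \<psi> y")
    case True
    show ?thesis
      by (rule combine[OF D1'(1) moebius_dominatedD(1)[OF w]]) (use im' nz x y True in auto)
  next
    case False
    show ?thesis
      by (rule combine[OF D2'(1) moebius_dominatedD(2)[OF w]]) (use im' nz x y False in auto)
  qed
  show "ennreal ((b - y)\<^sup>2) * (w (\<psi> y) * ennreal \<bar>\<psi>1 y\<bar>) \<le> ennreal ((b - x)\<^sup>2) * (w (\<psi> x) * ennreal \<bar>\<psi>1 x\<bar>)"
  proof (cases "\<psi> x \<le> \<psi> y")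
    case True
    show ?thesis
      by (rule combine[OF D2'(2) moebius_dominatedD(2)[OF w]]) (use im' nz x y True in auto)
  next
    case False
    show ?thesis
      by (rule combine[OF D1'(2) moebius_dominatedD(1)[OF w]]) (use im' nz x y False in auto)
  qed
qed

text \<open>For points of the middle part the distances to either end point lie between
  \<open>d\<close> and \<open>b - a\<close>, so the quotient of two squared distances is at most the
  stated constant.\<close>

lemma moebius_dominated_harnack:
  assumes w: "moebius_dominated a b w" and d: "d > 0"
    and x: "x \<in> {a + d..b - d}" and y: "y \<in> {a + d..b - d}"
  shows "w y \<le> ennreal (((b - a) / d)\<^sup>2) * w x"
proof -
  have *: "w y \<le> ennreal (((b - a) / d)\<^sup>2) * w x"
    if "ennreal (p\<^sup>2) * w y \<le> ennreal (q\<^sup>2) * w x" "d \<le> p" "0 \<le> q" "q \<le> b - a" for p q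
  proof -
    have "w y = ennreal (inverse (p\<^sup>2)) * (ennreal (p\<^sup>2) * w y)"
      using that d by (simp add: ennreal_mult_mult)
    also have "\<dots> \<le> ennreal (inverse (p\<^sup>2)) * (ennreal (q\<^sup>2) * w x)"
      using that by (intro mult_left_mono) auto
    also have "\<dots> = ennreal (q\<^sup>2 / p\<^sup>2) * w x"
      by (subst ennreal_mult_mult) (simp_all add: divide_inverse mult.commute)
    also have "\<dots> \<le> ennreal (((b - a) / d)\<^sup>2) * w x"
      unfolding power_divide using that d
      by (intro mult_right_mono ennreal_leI frac_le power_mono) auto
    finally show ?thesis .
  qed
  show ?thesis
  proof (cases "x \<le> y")
    case True
    show ?thesis
      by (rule *[OF moebius_dominatedD(2)[OF w]]) (use x y d True in auto)
  next
    case False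
    show ?thesis
      by (rule *[OF moebius_dominatedD(1)[OF w]]) (use x y d False in auto)
  qed
qed

text \<open>The substitution rule is applied on compact intervals that exhaust the open one, and
  monotone convergence does the rest. Nothing is assumed about \<psi> and its derivative at the end
  points \<open>a\<close> and \<open>b\<close>.\<close>

lemma nn_integral_increasing_image:
  fixes f :: "real \<Rightarrow> ennreal"
  assumes f[measurable]: "f \<in> borel_measurable borel" and ab: "a < b"
    and D: "\<And>t. t \<in> {a<..<b} \<Longrightarrow> (\<psi> has_real_derivative \<psi>1 t) (at t)"
    and cont: "continuous_on {a<..<b} \<psi>1" and pos: "\<And>t. t \<in> {a<..<b} \<Longrightarrow> \<psi>1 t > 0"
  shows "(\<integral>\<^sup>+x. f x * indicator (\<psi> ` {a<..<b}) x \<partial>lborel) =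
    (\<integral>\<^sup>+t. f (\<psi> t) * ennreal (\<psi>1 t) * indicator {a<..<b} t \<partial>lborel)"
proof -
  let ?S = "{a<..<b}"
  \<comment> \<open>With \<open>+ 3\<close> at most a third is removed on each side, so
    \<open>l n < r n\<close> holds from \<open>n = 0\<close> on.\<close>
  define l where "l n = a + (b - a) / (real n + 3)" for n
  define r where "r n = b - (b - a) / (real n + 3)" for n
  have lr: "a < l n" "l n < r n" "r n < b" for n
  proof -
    define e where "e = (b - a) / (real n + 3)"
    have "e \<le> (b - a) / 3" unfolding e_def using ab by (intro divide_left_mono) auto
    moreover have "e > 0" using ab by (simp add: e_def)
    ultimately show "a < l n" "l n < r n" "r n < b"
      using ab unfolding l_def r_def e_def[symmetric] by auto
  qed
  have anti: "(b - a) / (real n + 3) \<le> (b - a) / (real m + 3)" if "m \<le> n" for m n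
    using that ab by (intro divide_left_mono) auto
  have contpsi: "continuous_on ?S \<psi>"
    by (intro continuous_at_imp_continuous_on ballI DERIV_isCont[OF D])
  have mono: "\<psi> s \<le> \<psi> t" if "s \<le> t" "s \<in> ?S" "t \<in> ?S" for s t
  proof (rule DERIV_nonneg_imp_nondecreasing[OF that(1)])
    show "\<exists>y. (\<psi> has_real_derivative y) (at x) \<and> 0 \<le> y" if "s \<le> x" "x \<le> t" for x
      using D[of x] pos[of x] that \<open>s \<in> ?S\<close> \<open>t \<in> ?S\<close> by (intro exI[of _ "\<psi>1 x"]) auto
  qed
  have ex: "\<exists>n. t \<in> {l n..r n}" if "t \<in> ?S" for t
  proof -
    define m where "m = min (t - a) (b - t)"
    have m: "m > 0" using that by (auto simp: m_def)
    obtain n :: nat where n: "(b - a) / m < real n"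
      using reals_Archimedean2 by blast
    then have "b - a < real n * m" using m by (simp add: pos_divide_less_eq)
    also have "\<dots> \<le> m * (real n + 3)" using m by (simp add: algebra_simps)
    finally have "(b - a) / (real n + 3) \<le> m" by (simp add: pos_divide_le_eq)
    then have "(b - a) / (real n + 3) \<le> t - a" "(b - a) / (real n + 3) \<le> b - t" by (auto simp: m_def)
    then show ?thesis by (intro exI[of _ n]) (auto simp: l_def r_def)
  qed
  have US: "(\<Union>n. {l n..r n}) = ?S"
  proof
    show "(\<Union>n. {l n..r n}) \<subseteq> ?S"
    proof (intro UN_least subsetI)
      fix n t assume "t \<in> {l n..r n}"
      then show "t \<in> ?S" using lr[of n] by auto
    qed
  qed (use ex in blast)
  have image: "\<psi> ` {l n..r n} = {\<psi> (l n)..\<psi> (r n)}" for n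
  proof -
    have sub: "{l n..r n} \<subseteq> ?S" using lr[of n] by auto
    have "continuous_on {l n..r n} \<psi>" by (rule continuous_on_subset[OF contpsi sub])
    then have "\<exists>x\<ge>l n. x \<le> r n \<and> \<psi> x = y" if "\<psi> (l n) \<le> y" "y \<le> \<psi> (r n)" for y
      using that lr(2)[of n] by (intro IVT') auto
    then have "{\<psi> (l n)..\<psi> (r n)} \<subseteq> \<psi> ` {l n..r n}" by fastforce
    moreover have "\<psi> (l n) \<le> \<psi> x \<and> \<psi> x \<le> \<psi> (r n)" if "x \<in> {l n..r n}" for x
      using that sub lr(2)[of n] by (auto intro!: mono)
    ultimately show ?thesis by auto
  qed
  have Upsi: "(\<Union>n. {\<psi> (l n)..\<psi> (r n)}) = \<psi> ` ?S"
    unfolding image[symmetric] US[symmetric] by blast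
  have incS: "incseq (\<lambda>n. {l n..r n})"
  proof (intro monoI)
    fix m n :: nat assume "m \<le> n"
    then show "{l m..r m} \<subseteq> {l n..r n}" using anti[of m n] by (auto simp: l_def r_def)
  qed
  have incpsi: "incseq (\<lambda>n. {\<psi> (l n)..\<psi> (r n)})"
    unfolding image[symmetric] by (intro monoI image_mono incseqD[OF incS])
  \<comment> \<open>Cutting off by the indicator makes \<psi> and its derivative Borel on the whole
    line; they are continuous only on \<open>?S\<close>.\<close>
  define h where "h t = f (indicator ?S t *\<^sub>R \<psi> t) * ennreal (indicator ?S t *\<^sub>R \<psi>1 t)" for t
  have [measurable]: "(\<lambda>t. indicator ?S t *\<^sub>R \<psi> t) \<in> borel_measurable borel"
     "(\<lambda>t. indicator ?S t *\<^sub>R \<psi>1 t) \<in> borel_measurable borel"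
    by (intro borel_measurable_continuous_on_indicator contpsi cont; simp)+
  have h[measurable]: "h \<in> borel_measurable borel" unfolding h_def by measurable
  have step: "(\<integral>\<^sup>+x. f x * indicator {\<psi> (l n)..\<psi> (r n)} x \<partial>lborel) = (\<integral>\<^sup>+t. h t * indicator {l n..r n} t \<partial>lborel)" for n
  proof -
    have sub: "{l n..r n} \<subseteq> ?S" using lr[of n] by auto
    have "(\<integral>\<^sup>+x. f x * indicator {\<psi> (l n)..\<psi> (r n)} x \<partial>lborel) =
      (\<integral>\<^sup>+t. f (\<psi> t) * ennreal (\<psi>1 t) * indicator {l n..r n} t \<partial>lborel)"
      using sub lr(2)[of n]
      by (intro nn_integral_substitution_aux f D continuous_on_subset[OF cont] less_imp_le[OF pos]) auto
    also have "\<dots> = (\<integral>\<^sup>+t. h t * indicator {l n..r n} t \<partial>lborel)"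
      using sub by (intro nn_integral_cong) (auto simp: h_def indicator_def)
    finally show ?thesis .
  qed
  have dens: "(\<integral>\<^sup>+x. g x * indicator (\<Union>n. A n) x \<partial>lborel) = (SUP n. \<integral>\<^sup>+x. g x * indicator (A n) x \<partial>lborel)"
    if [measurable]: "g \<in> borel_measurable borel" "\<And>n. A n \<in> sets borel" and "incseq A"
    for g :: "real \<Rightarrow> ennreal" and A :: "nat \<Rightarrow> real set"
  proof -
    have "emeasure (density lborel g) (\<Union>n. A n) = (SUP n. emeasure (density lborel g) (A n))"
      using \<open>incseq A\<close> by (intro SUP_emeasure_incseq[symmetric]) auto
    then show ?thesis by (simp add: emeasure_density)
  qed
  have "(\<integral>\<^sup>+x. f x * indicator (\<psi> ` ?S) x \<partial>lborel) = (\<integral>\<^sup>+t. h t * indicator ?S t \<partial>lborel)"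
    using dens[OF f _ incpsi] dens[OF h _ incS] unfolding Upsi US step by simp
  also have "\<dots> = (\<integral>\<^sup>+t. f (\<psi> t) * ennreal (\<psi>1 t) * indicator ?S t \<partial>lborel)"
    by (intro nn_integral_cong) (auto simp: h_def indicator_def)
  finally show ?thesis .
qed

text \<open>The general set \<open>A\<close> is reduced to the whole interval by moving the
  indicator of its image into \<open>w\<close>. A decreasing \<psi> is reduced to an increasing one
  by reflecting the line, which preserves \<open>lborel\<close>.\<close>

lemma nn_integral_nonneg_schwarzian_image:
  fixes w :: "real \<Rightarrow> ennreal"
  assumes w[measurable]: "w \<in> borel_measurable borel" and ab: "a < b"
    and \<psi>: "nonneg_schwarzian_on {a<..<b} \<psi> \<psi>1" and A: "A \<subseteq> {a<..<b}"
    and im: "\<psi> ` A \<in> sets borel" and inj: "inj_on \<psi> {a<..<b}"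
  shows "(\<integral>\<^sup>+x. w x * indicator (\<psi> ` A) x \<partial>lborel) =
    (\<integral>\<^sup>+t. w (\<psi> t) * ennreal \<bar>\<psi>1 t\<bar> * indicator A t \<partial>lborel)"
proof -
  have main: "(\<integral>\<^sup>+x. w x * indicator (\<psi> ` A) x \<partial>lborel) =
      (\<integral>\<^sup>+t. w (\<psi> t) * ennreal \<bar>\<psi>1 t\<bar> * indicator A t \<partial>lborel)"
    if [measurable]: "w \<in> borel_measurable borel" and \<psi>: "nonneg_schwarzian_on {a<..<b} \<psi> \<psi>1"
      and im: "\<psi> ` A \<in> sets borel" and inj: "inj_on \<psi> {a<..<b}"
      and pos: "\<And>t. t \<in> {a<..<b} \<Longrightarrow> \<psi>1 t > 0"
    for w :: "real \<Rightarrow> ennreal" and \<psi> \<psi>1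
  proof -
    note [measurable] = im
    have "(\<integral>\<^sup>+x. w x * indicator (\<psi> ` A) x \<partial>lborel) =
      (\<integral>\<^sup>+x. (w x * indicator (\<psi> ` A) x) * indicator (\<psi> ` {a<..<b}) x \<partial>lborel)"
      using A by (intro nn_integral_cong) (auto simp: indicator_def)
    also have "\<dots> = (\<integral>\<^sup>+t. (w (\<psi> t) * indicator (\<psi> ` A) (\<psi> t)) * ennreal (\<psi>1 t) * indicator {a<..<b} t \<partial>lborel)"
    proof (rule nn_integral_increasing_image[OF _ ab _ _ pos])
      show "(\<psi> has_real_derivative \<psi>1 t) (at t)" if "t \<in> {a<..<b}" for t
        using \<psi> that unfolding nonneg_schwarzian_on_def by blast
      show "continuous_on {a<..<b} \<psi>1"
        using \<psi> unfolding nonneg_schwarzian_on_def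
        by (auto intro!: continuous_at_imp_continuous_on intro: DERIV_isCont)
    qed auto
    also have "\<dots> = (\<integral>\<^sup>+t. w (\<psi> t) * ennreal \<bar>\<psi>1 t\<bar> * indicator A t \<partial>lborel)"
    proof (intro nn_integral_cong)
      fix t
      show "(w (\<psi> t) * indicator (\<psi> ` A) (\<psi> t)) * ennreal (\<psi>1 t) * indicator {a<..<b} t =
         w (\<psi> t) * ennreal \<bar>\<psi>1 t\<bar> * indicator A t"
      proof (cases "t \<in> {a<..<b}")
        case True
        then show ?thesis using pos[OF True] inj_on_image_mem_iff[OF inj True A] by (auto simp: indicator_def)
      qed (use A in \<open>auto simp: indicator_def\<close>)
    qed
    finally show ?thesis .
  qed
  consider "\<And>t. t \<in> {a<..<b} \<Longrightarrow> \<psi>1 t > 0" | "\<And>t. t \<in> {a<..<b} \<Longrightarrow> \<psi>1 t < 0"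
    using nonneg_schwarzian_on_sign[OF \<psi>] by blast
  then show ?thesis
  proof cases
    case 1 then show ?thesis by (intro main w \<psi> im inj)
  next
    case 2
    have eqim: "(\<lambda>t. - \<psi> t) ` A = uminus -` (\<psi> ` A)"
      by (auto simp: image_iff) (metis minus_minus)
    have m: "(\<lambda>t. - \<psi> t) ` A \<in> sets borel"
      unfolding eqim using measurable_sets[OF borel_measurable_uminus[OF measurable_ident] im] by simp
    have "(\<integral>\<^sup>+x. w x * indicator (\<psi> ` A) x \<partial>lborel) =
        (\<integral>\<^sup>+x. w x * indicator (\<psi> ` A) x \<partial>distr lborel borel uminus)"
      by (simp add: lborel_distr_uminus)
    also have "\<dots> = (\<integral>\<^sup>+x. w (- x) * indicator (\<psi> ` A) (- x) \<partial>lborel)"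
      using im by (subst nn_integral_distr) auto
    also have "\<dots> = (\<integral>\<^sup>+x. w (- x) * indicator ((\<lambda>t. - \<psi> t) ` A) x \<partial>lborel)"
      unfolding eqim by (intro nn_integral_cong) (auto simp: indicator_def)
    also have "\<dots> = (\<integral>\<^sup>+t. w (- (- \<psi> t)) * ennreal \<bar>- \<psi>1 t\<bar> * indicator A t \<partial>lborel)"
      by (rule main[where \<psi> = "\<lambda>t. - \<psi> t"])
         (use 2 m inj in \<open>auto intro!: nonneg_schwarzian_on_uminus \<psi> simp: inj_on_def\<close>)
    finally show ?thesis by simp
  qed
qed

section \<open>Markov systems of intervals on the real line\<close>

lemma moebius_dominated_cong:
  assumes "\<And>t. a < t \<Longrightarrow> t < b \<Longrightarrow> w t = w' t"
  shows "moebius_dominated a b w = moebius_dominated a b w'"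
proof -
  have "a < x \<longrightarrow> x \<le> y \<longrightarrow> y < b \<longrightarrow> w x = w' x \<and> w y = w' y" for x y
    using assms by (meson le_less_trans less_le_trans)
  then show ?thesis unfolding moebius_dominated_def by metis
qed

text \<open>The pointwise Harnack inequality is integrated over \<open>A\<close> in one variable and
  over \<open>B\<close> in the other. The product form avoids division by a measure that may
  vanish.\<close>

lemma nn_integral_harnack:
  assumes w[measurable]: "w \<in> borel_measurable borel" and dom: "moebius_dominated a b w" and d: "d > 0"
    and [measurable]: "A \<in> sets borel" "B \<in> sets borel" and AB: "A \<subseteq> {a + d..b - d}" "B \<subseteq> {a + d..b - d}"
  shows "(\<integral>\<^sup>+x. w x * indicator A x \<partial>lborel) * emeasure lborel B
    \<le> ennreal (((b - a) / d)\<^sup>2) * emeasure lborel A * (\<integral>\<^sup>+x. w x * indicator B x \<partial>lborel)"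
proof -
  let ?C = "ennreal (((b - a) / d)\<^sup>2)"
  have *: "(\<integral>\<^sup>+x. w x * indicator A x \<partial>lborel) \<le> ?C * emeasure lborel A * w y" if "y \<in> B" for y
  proof -
    have "(\<integral>\<^sup>+x. w x * indicator A x \<partial>lborel) \<le> (\<integral>\<^sup>+x. (?C * w y) * indicator A x \<partial>lborel)"
    proof (intro nn_integral_mono)
      fix x
      show "w x * indicator A x \<le> (?C * w y) * indicator A x"
      proof (cases "x \<in> A")
        case True
        then have "w x \<le> ?C * w y"
          using that AB by (intro moebius_dominated_harnack[OF dom d]) auto
        then show ?thesis by (intro mult_right_mono) auto
      qed auto
    qed
    also have "\<dots> = ?C * w y * emeasure lborel A"
      by (subst nn_integral_cmult_indicator) auto
    finally show ?thesis by (simp add: mult_ac)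
  qed
  have "(\<integral>\<^sup>+x. w x * indicator A x \<partial>lborel) * emeasure lborel B =
      (\<integral>\<^sup>+y. (\<integral>\<^sup>+x. w x * indicator A x \<partial>lborel) * indicator B y \<partial>lborel)"
    by (subst nn_integral_cmult_indicator) auto
  also have "\<dots> \<le> (\<integral>\<^sup>+y. ?C * emeasure lborel A * (w y * indicator B y) \<partial>lborel)"
    using * by (intro nn_integral_mono) (auto simp: indicator_def)
  also have "\<dots> = ?C * emeasure lborel A * (\<integral>\<^sup>+x. w x * indicator B x \<partial>lborel)"
    by (rule nn_integral_cmult) simp
  finally show ?thesis .
qed

text \<open>The Markov property is encoded by inverse branches: \<open>\<psi> j i\<close> is defined
  on all of \<open>I i\<close> and takes values in \<open>I j\<close>, for \<open>j\<close> in the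
  finite set \<open>pre i\<close>. \<open>T\<close> is a total Borel function on the line whose
  values outside \<open>Y\<close>, and on a null subset of \<open>Y\<close>, are arbitrary.
  \<open>I\<close> and \<open>Y\<close> are parameters with defining equations so that an
  interpretation can supply its own constants.\<close>

locale markov_line =
  fixes Ix :: "'i set" and lo hi :: "'i \<Rightarrow> real" and T :: "real \<Rightarrow> real"
    and pre :: "'i \<Rightarrow> 'i set" and \<psi> \<psi>1 :: "'i \<Rightarrow> 'i \<Rightarrow> real \<Rightarrow> real"
  fixes I :: "'i \<Rightarrow> real set" and Y :: "real set"
  defines "I \<equiv> \<lambda>i. {lo i<..<hi i}" and "Y \<equiv> \<Union>i\<in>Ix. I i"
  assumes countable_Ix: "countable Ix" and Ix_nonempty: "Ix \<noteq> {}"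
    and lo_less_hi: "\<And>i. i \<in> Ix \<Longrightarrow> lo i < hi i"
    and disjoint_I: "disjoint_family_on I Ix"
    and finite_Y: "emeasure lborel Y < \<infinity>"
    and T_measurable[measurable]: "T \<in> borel_measurable borel"
    and finite_pre: "\<And>i. i \<in> Ix \<Longrightarrow> finite (pre i)" and pre_subset: "\<And>i. i \<in> Ix \<Longrightarrow> pre i \<subseteq> Ix"
    and branch: "\<And>i j. i \<in> Ix \<Longrightarrow> j \<in> pre i \<Longrightarrow> nonneg_schwarzian_on (I i) (\<psi> j i) (\<psi>1 j i)"
    and branch_image: "\<And>i j. i \<in> Ix \<Longrightarrow> j \<in> pre i \<Longrightarrow> \<psi> j i ` I i \<subseteq> I j"
    and branch_open: "\<And>i j. i \<in> Ix \<Longrightarrow> j \<in> pre i \<Longrightarrow> open (\<psi> j i ` I i)"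
    and T_branch: "\<And>i j t. i \<in> Ix \<Longrightarrow> j \<in> pre i \<Longrightarrow> t \<in> I i \<Longrightarrow> T (\<psi> j i t) = t"
    and branches_cover: "\<And>i. i \<in> Ix \<Longrightarrow> (Y \<inter> T -` I i) - (\<Union>j\<in>pre i. \<psi> j i ` I i) \<in> null_sets lborel"
    and T_Y: "Y \<inter> T -` (- Y) \<in> null_sets lborel"
begin

lemma I_measurable[measurable, simp]: "I i \<in> sets borel"
  by (simp add: I_def)

lemma Y_measurable[measurable, simp]: "Y \<in> sets borel"
  unfolding Y_def using countable_Ix by (intro sets.countable_UN') auto

lemma I_subset_Y: "i \<in> Ix \<Longrightarrow> I i \<subseteq> Y"
  by (auto simp: Y_def)

lemma I_disjoint: "i \<in> Ix \<Longrightarrow> j \<in> Ix \<Longrightarrow> x \<in> I i \<Longrightarrow> x \<in> I j \<Longrightarrow> i = j"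
  using disjoint_I by (auto simp: disjoint_family_on_def)

section \<open>Measures with Moebius dominated densities and their images under the map\<close>

definition lam :: "real measure" where
  "lam = density lborel (indicator Y)"

lemma sets_lam[measurable_cong, simp]: "sets lam = sets borel" and space_lam[simp]: "space lam = UNIV"
  by (simp_all add: lam_def)

lemma emeasure_lam: "A \<in> sets borel \<Longrightarrow> emeasure lam A = emeasure lborel (Y \<inter> A)"
  by (simp add: lam_def emeasure_restricted)

lemma null_sets_lam_iff: "N \<in> null_sets lam \<longleftrightarrow> N \<in> sets borel \<and> Y \<inter> N \<in> null_sets lborel"
  by (auto simp: null_sets_def emeasure_lam)

lemma emeasure_lam_le: "A \<in> sets borel \<Longrightarrow> emeasure lam A \<le> emeasure lborel Y"
  by (auto simp: emeasure_lam intro: emeasure_mono)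

lemma branch_inj: "i \<in> Ix \<Longrightarrow> j \<in> pre i \<Longrightarrow> inj_on (\<psi> j i) (I i)"
  by (metis T_branch inj_onI)

text \<open>Writing images under an inverse branch as preimages under \<open>T\<close> reduces their
  measurability to that of \<open>T\<close>.\<close>

lemma branch_image_eq:
  assumes "i \<in> Ix" "j \<in> pre i" "A \<subseteq> I i"
  shows "\<psi> j i ` A = \<psi> j i ` I i \<inter> T -` A"
  using assms T_branch by (auto simp: image_iff subset_iff)

lemma branch_image_measurable:
  assumes "i \<in> Ix" "j \<in> pre i" "A \<subseteq> I i" "A \<in> sets borel"
  shows "\<psi> j i ` A \<in> sets borel"
proof -
  have "\<psi> j i ` I i \<in> sets borel" using branch_open assms by (intro borel_open) blast
  moreover have "T -` A \<in> sets borel" using measurable_sets[OF T_measurable assms(4)] by simp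
  ultimately show ?thesis unfolding branch_image_eq[OF assms(1-3)] by simp
qed

text \<open>This is the class of measures for which the Harnack inequality holds in every element
  with a constant independent of the measure. It is closed under images by \<open>T\<close>, so it
  contains all measures whose sums are considered later.\<close>

definition regular :: "real measure \<Rightarrow> bool" where
  "regular \<nu> \<longleftrightarrow> sets \<nu> = sets borel \<and> emeasure \<nu> (- Y) = 0 \<and>
     (\<forall>i\<in>Ix. \<exists>w\<in>borel_measurable borel. moebius_dominated (lo i) (hi i) w \<and>
        (\<forall>A\<in>sets borel. A \<subseteq> I i \<longrightarrow> emeasure \<nu> A = (\<integral>\<^sup>+x. w x * indicator A x \<partial>lborel)))"

lemma regular_null:
  assumes "regular \<nu>" "N \<in> null_sets lam"
  shows "N \<in> null_sets \<nu>"
proof -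
  have [measurable]: "N \<in> sets borel" and [simp]: "sets \<nu> = sets borel"
    using assms by (auto simp: null_sets_lam_iff regular_def)
  have "N \<inter> I i \<in> null_sets \<nu>" if i: "i \<in> Ix" for i
  proof -
    obtain w where w: "w \<in> borel_measurable borel"
      "\<And>A. A \<in> sets borel \<Longrightarrow> A \<subseteq> I i \<Longrightarrow> emeasure \<nu> A = (\<integral>\<^sup>+x. w x * indicator A x \<partial>lborel)"
      using assms(1) i unfolding regular_def by blast
    have "Y \<inter> N \<in> null_sets lborel" using assms(2) by (simp add: null_sets_lam_iff)
    then have "N \<inter> I i \<in> null_sets lborel"
      by (rule null_sets_subset) (use I_subset_Y[OF i] in auto)
    then have "(\<integral>\<^sup>+x. w x * indicator (N \<inter> I i) x \<partial>lborel) = 0"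
      by (rule nn_integral_null_set)
    then show ?thesis using w by (auto simp: null_sets_def)
  qed
  then have "(\<Union>i\<in>Ix. N \<inter> I i) \<in> null_sets \<nu>" by (rule null_sets_UN'[OF countable_Ix])
  moreover have "- Y \<in> null_sets \<nu>" using assms(1) by (auto simp: regular_def null_sets_def)
  ultimately have "(\<Union>i\<in>Ix. N \<inter> I i) \<union> - Y \<in> null_sets \<nu>" by (rule null_sets.Un)
  then show ?thesis by (rule null_sets_subset) (auto simp: Y_def)
qed

text \<open>On each element the density is the constant 0 or 1. This supplies the starting measures:
  \<open>lam\<close> itself for the recurrent case, a single element for Green measures.\<close>

lemma regular_restrict:
  assumes "S \<subseteq> Ix"
  shows "regular (density lborel (indicator (\<Union>i\<in>S. I i)))"
proof -
  have [measurable]: "(\<Union>i\<in>S. I i) \<in> sets borel"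
    using countable_subset[OF assms countable_Ix] by (intro sets.countable_UN') auto
  show ?thesis unfolding regular_def
  proof (intro conjI ballI)
    show "emeasure (density lborel (indicator (\<Union>i\<in>S. I i))) (- Y) = 0"
    proof -
      have "(\<Union>i\<in>S. I i) \<inter> - Y = {}" using assms by (auto simp: Y_def)
      moreover have "- Y \<in> sets borel" by auto
      ultimately show ?thesis by (subst emeasure_restricted) auto
    qed
    fix i assume i: "i \<in> Ix"
    show "\<exists>w\<in>borel_measurable borel. moebius_dominated (lo i) (hi i) w \<and>
        (\<forall>A\<in>sets borel. A \<subseteq> I i \<longrightarrow> emeasure (density lborel (indicator (\<Union>i\<in>S. I i))) A = (\<integral>\<^sup>+x. w x * indicator A x \<partial>lborel))"
    proof (intro bexI[of _ "\<lambda>_. if i \<in> S then 1 else 0"] conjI ballI impI)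
      fix A assume A: "A \<in> sets borel" "A \<subseteq> I i"
      have "(\<Union>i\<in>S. I i) \<inter> A = (if i \<in> S then A else {})"
        using A(2) I_disjoint i assms by auto blast+
      then show "emeasure (density lborel (indicator (\<Union>i\<in>S. I i))) A = (\<integral>\<^sup>+x. (if i \<in> S then 1 else 0) * indicator A x \<partial>lborel)"
        using A(1) by (subst emeasure_restricted) auto
    qed (auto intro: moebius_dominated_const)
  qed simp
qed

lemma regular_lam: "regular lam"
  unfolding lam_def Y_def by (rule regular_restrict) simp

lemma preimage_branches_null:
  assumes i: "i \<in> Ix" and A: "A \<subseteq> I i" "A \<in> sets borel"
  shows "T -` A - (\<Union>j\<in>pre i. \<psi> j i ` A) \<in> null_sets lam"
proof -
  have m: "T -` A \<in> sets borel" "(\<Union>j\<in>pre i. \<psi> j i ` A) \<in> sets borel"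
    using measurable_sets[OF T_measurable A(2)] branch_image_measurable[OF i _ A] finite_pre[OF i] by auto
  have "Y \<inter> (T -` A - (\<Union>j\<in>pre i. \<psi> j i ` A)) \<in> null_sets lborel"
  proof (rule null_sets_subset[OF branches_cover[OF i]])
    show "Y \<inter> (T -` A - (\<Union>j\<in>pre i. \<psi> j i ` A)) \<subseteq> Y \<inter> T -` I i - (\<Union>j\<in>pre i. \<psi> j i ` I i)"
      using A(1) branch_image_eq[OF i _ A(1)] by auto
  qed (use m in auto)
  then show ?thesis using m by (auto simp: null_sets_lam_iff)
qed

text \<open>The new density on \<open>I i\<close> is given by the transfer operator: the sum over
  \<open>pre i\<close> of the old densities composed with the inverse branches and multiplied by
  their Jacobians. Each summand is a pullback, and Moebius domination survives pullbacks and finite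
  sums.\<close>

lemma regular_push:
  assumes \<nu>: "regular \<nu>"
  shows "regular (distr \<nu> borel T)"
proof -
  have sets_\<nu>[measurable_cong, simp]: "sets \<nu> = sets borel" using \<nu> by (simp add: regular_def)
  then have [simp]: "space \<nu> = UNIV" using sets_eq_imp_space_eq by fastforce
  have em: "emeasure (distr \<nu> borel T) A = emeasure \<nu> (T -` A)" if "A \<in> sets borel" for A
    using that by (subst emeasure_distr) auto
  show ?thesis unfolding regular_def
  proof (intro conjI ballI)
    have "T -` (- Y) \<in> null_sets lam"
      using T_Y measurable_sets[OF T_measurable, of "- Y"] by (auto simp: null_sets_lam_iff)
    then have "T -` (- Y) \<in> null_sets \<nu>" by (rule regular_null[OF \<nu>])
    then show "emeasure (distr \<nu> borel T) (- Y) = 0" by (subst em) auto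
    fix i assume i: "i \<in> Ix"
    have "\<exists>w. w\<in>borel_measurable borel \<and> moebius_dominated (lo j) (hi j) w \<and>
        (\<forall>A\<in>sets borel. A \<subseteq> I j \<longrightarrow> emeasure \<nu> A = (\<integral>\<^sup>+x. w x * indicator A x \<partial>lborel))" if "j \<in> Ix" for j
      using \<nu> that unfolding regular_def by blast
    then obtain w where w: "\<And>j. j \<in> Ix \<Longrightarrow> w j \<in> borel_measurable borel"
      "\<And>j. j \<in> Ix \<Longrightarrow> moebius_dominated (lo j) (hi j) (w j)"
      "\<And>j A. j \<in> Ix \<Longrightarrow> A \<in> sets borel \<Longrightarrow> A \<subseteq> I j \<Longrightarrow> emeasure \<nu> A = (\<integral>\<^sup>+x. w j x * indicator A x \<partial>lborel)"
      by metis
    note pre = pre_subset[OF i, THEN subsetD]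
    \<comment> \<open>The indicators make the branches and their derivatives Borel on the whole
      line; on \<open>I i\<close> they change nothing.\<close>
    define w' where "w' t = (\<Sum>j\<in>pre i. w j (indicator (I i) t *\<^sub>R \<psi> j i t) * ennreal \<bar>indicator (I i) t *\<^sub>R \<psi>1 j i t\<bar>)" for t
    have w'_eq: "w' t = (\<Sum>j\<in>pre i. w j (\<psi> j i t) * ennreal \<bar>\<psi>1 j i t\<bar>)" if "t \<in> I i" for t
      unfolding w'_def using that by simp
    have cont: "continuous_on (I i) (\<psi> j i)" "continuous_on (I i) (\<psi>1 j i)" if "j \<in> pre i" for j
      using branch[OF i that] unfolding nonneg_schwarzian_on_def
      by (auto intro!: continuous_at_imp_continuous_on intro: DERIV_isCont)
    have ind: "(\<lambda>t. indicator (I i) t *\<^sub>R \<psi> j i t) \<in> borel_measurable borel"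
        "(\<lambda>t. indicator (I i) t *\<^sub>R \<psi>1 j i t) \<in> borel_measurable borel" if "j \<in> pre i" for j
      by (intro borel_measurable_continuous_on_indicator cont that I_measurable)+
    have summand: "(\<lambda>t. w j (indicator (I i) t *\<^sub>R \<psi> j i t) * ennreal \<bar>indicator (I i) t *\<^sub>R \<psi>1 j i t\<bar>) \<in> borel_measurable borel"
      if j: "j \<in> pre i" for j
    proof -
      have [measurable]: "(\<lambda>t. w j (indicator (I i) t *\<^sub>R \<psi> j i t)) \<in> borel_measurable borel"
        by (rule measurable_compose[OF ind(1)[OF j] w(1)[OF pre[OF j]]])
      note [measurable] = ind(2)[OF j]
      show ?thesis by measurable
    qed
    have "moebius_dominated (lo i) (hi i) (\<lambda>t. \<Sum>j\<in>pre i. w j (\<psi> j i t) * ennreal \<bar>\<psi>1 j i t\<bar>)"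
      using branch[OF i] branch_image[OF i]
      by (intro moebius_dominated_sum moebius_dominated_pullback[OF _ _ w(2)[OF pre]]) (auto simp: I_def)
    then have dom: "moebius_dominated (lo i) (hi i) w'"
      by (subst moebius_dominated_cong[OF w'_eq]) (auto simp: I_def)
    have meas: "w' \<in> borel_measurable borel"
      unfolding w'_def
      by (intro borel_measurable_sum summand)
    have "emeasure (distr \<nu> borel T) A = (\<integral>\<^sup>+x. w' x * indicator A x \<partial>lborel)" if A: "A \<in> sets borel" "A \<subseteq> I i" for A
    proof -
      have mA[measurable]: "\<psi> j i ` A \<in> sets borel" if "j \<in> pre i" for j
        by (rule branch_image_measurable[OF i that A(2,1)])
      let ?B = "\<Union>j\<in>pre i. \<psi> j i ` A"
      have B: "?B \<in> sets borel" using mA finite_pre[OF i] by auto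
      have TA: "T -` A \<in> sets borel" using measurable_sets[OF T_measurable A(1)] by simp
      have "?B \<subseteq> T -` A" using T_branch[OF i] A(2) by auto
      then have "emeasure \<nu> (T -` A) = emeasure \<nu> ?B + emeasure \<nu> (T -` A - ?B)"
        using B TA by (subst plus_emeasure) (auto simp: Un_absorb1)
      also have "emeasure \<nu> (T -` A - ?B) = 0"
        using regular_null[OF \<nu> preimage_branches_null[OF i A(2,1)]] by auto
      also have "emeasure \<nu> ?B = (\<Sum>j\<in>pre i. emeasure \<nu> (\<psi> j i ` A))"
      proof (rule sum_emeasure[symmetric])
        have "\<psi> j i ` A \<subseteq> I j" if "j \<in> pre i" for j using branch_image[OF i that] A(2) by blast
        then show "disjoint_family_on (\<lambda>j. \<psi> j i ` A) (pre i)"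
          using disjoint_I pre unfolding disjoint_family_on_def by blast
      qed (use mA finite_pre[OF i] in auto)
      also have "\<dots> = (\<Sum>j\<in>pre i. \<integral>\<^sup>+t. w j (\<psi> j i t) * ennreal \<bar>\<psi>1 j i t\<bar> * indicator A t \<partial>lborel)"
      proof (rule sum.cong[OF refl])
        fix j assume j: "j \<in> pre i"
        have "emeasure \<nu> (\<psi> j i ` A) = (\<integral>\<^sup>+x. w j x * indicator (\<psi> j i ` A) x \<partial>lborel)"
          using branch_image[OF i j] A(2) by (intro w(3) pre[OF j] mA[OF j]) blast
        also have "\<dots> = (\<integral>\<^sup>+t. w j (\<psi> j i t) * ennreal \<bar>\<psi>1 j i t\<bar> * indicator A t \<partial>lborel)"
          using A(2) branch_inj[OF i j] branch[OF i j]
          by (intro nn_integral_nonneg_schwarzian_image[OF w(1)[OF pre[OF j]] lo_less_hi[OF i]] mA[OF j]) (auto simp: I_def)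
        finally show "emeasure \<nu> (\<psi> j i ` A) = \<dots>" .
      qed
      also have "\<dots> = (\<Sum>j\<in>pre i. \<integral>\<^sup>+t. w j (indicator (I i) t *\<^sub>R \<psi> j i t) * ennreal \<bar>indicator (I i) t *\<^sub>R \<psi>1 j i t\<bar> * indicator A t \<partial>lborel)"
        using A(2) by (intro sum.cong nn_integral_cong refl) (auto simp: indicator_def)
      also have "\<dots> = (\<integral>\<^sup>+t. w' t * indicator A t \<partial>lborel)"
        unfolding w'_def sum_distrib_right
      proof (rule nn_integral_sum[symmetric])
        fix j assume j: "j \<in> pre i"
        show "(\<lambda>t. w j (indicator (I i) t *\<^sub>R \<psi> j i t) * ennreal \<bar>indicator (I i) t *\<^sub>R \<psi>1 j i t\<bar> * indicator A t) \<in> borel_measurable lborel"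
          using summand[OF j] A(1) by simp
      qed
      finally show ?thesis using A(1) by (simp add: em)
    qed
    with dom meas show "\<exists>w\<in>borel_measurable borel. moebius_dominated (lo i) (hi i) w \<and>
        (\<forall>A\<in>sets borel. A \<subseteq> I i \<longrightarrow> emeasure (distr \<nu> borel T) A = (\<integral>\<^sup>+x. w x * indicator A x \<partial>lborel))"
      by blast
  qed simp
qed

lemma iterate_measurable[measurable, simp]: "T ^^ n \<in> borel_measurable borel"
  by (induction n) auto

lemma iterate_vimage_measurable[measurable]: "A \<in> sets borel \<Longrightarrow> (T ^^ n) -` A \<in> sets borel"
  using measurable_sets[OF iterate_measurable] by fastforce

lemma regular_iterate: "regular \<nu> \<Longrightarrow> regular (distr \<nu> borel (T ^^ n))"
proof (induction n)
  case 0
  then have e: "distr \<nu> borel (T ^^ 0) = \<nu>"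
    using distr_id2[of borel \<nu>] by (simp add: regular_def id_def)
  show ?case unfolding e by (rule 0)
next
  case (Suc n)
  have s: "sets \<nu> = sets borel" using Suc by (simp add: regular_def)
  have m: "T ^^ n \<in> measurable \<nu> borel" using s by (simp cong: measurable_cong_sets)
  have "distr (distr \<nu> borel (T ^^ n)) borel T = distr \<nu> borel (T ^^ Suc n)"
    by (subst distr_distr[OF T_measurable m]) simp
  then show ?case using regular_push[OF Suc.IH[OF Suc.prems]] by metis
qed

lemma emeasure_iterate:
  assumes "regular \<nu>" "A \<in> sets borel"
  shows "emeasure (distr \<nu> borel (T ^^ n)) A = emeasure \<nu> ((T ^^ n) -` A)"
proof -
  have s: "sets \<nu> = sets borel" using assms by (simp add: regular_def)
  then have "space \<nu> = UNIV" using sets_eq_imp_space_eq by fastforce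
  moreover have "T ^^ n \<in> measurable \<nu> borel" using s by (simp cong: measurable_cong_sets)
  ultimately show ?thesis using assms by (subst emeasure_distr) auto
qed

text \<open>The image of \<open>lam\<close> under an iterate is again regular, hence absolutely
  continuous with respect to \<open>lam\<close>.\<close>

lemma nonsingular:
  assumes "N \<in> null_sets lam"
  shows "(T ^^ n) -` N \<in> null_sets lam"
proof -
  have N: "N \<in> sets borel" using assms by (simp add: null_sets_lam_iff)
  have "N \<in> null_sets (distr lam borel (T ^^ n))"
    by (rule regular_null[OF regular_iterate[OF regular_lam] assms])
  then show ?thesis
    using emeasure_iterate[OF regular_lam N] iterate_vimage_measurable[OF N]
    by (auto simp: null_sets_def)
qed

section \<open>Exhaustion by finite unions of compact intervals\<close>

definition del :: "'i \<Rightarrow> nat \<Rightarrow> real" where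
  "del i k = (hi i - lo i) / (real k + 3)"

text \<open>Because of the \<open>+ 3\<close> in \<open>del\<close>, the interval
  \<open>K i 0\<close> is the middle third of the element. So every \<open>K i k\<close> has
  interior points, as irreducibility requires of its target sets.\<close>

definition K :: "'i \<Rightarrow> nat \<Rightarrow> real set" where
  "K i k = {lo i + del i k..hi i - del i k}"

definition idx :: "nat \<Rightarrow> 'i set" where
  "idx k = {i\<in>Ix. to_nat_on Ix i \<le> k}"

definition E :: "nat \<Rightarrow> real set" where
  "E k = (\<Union>i\<in>idx k. K i k)"

lemma del_bounds: "i \<in> Ix \<Longrightarrow> 0 < del i k" "i \<in> Ix \<Longrightarrow> 3 * del i k \<le> hi i - lo i"
proof -
  assume i: "i \<in> Ix"
  show "0 < del i k" using lo_less_hi[OF i] by (simp add: del_def)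
  have "del i k \<le> (hi i - lo i) / 3"
    unfolding del_def using lo_less_hi[OF i] by (intro divide_left_mono) auto
  then show "3 * del i k \<le> hi i - lo i" by simp
qed

lemma del_antimono: "i \<in> Ix \<Longrightarrow> m \<le> n \<Longrightarrow> del i n \<le> del i m"
  unfolding del_def using lo_less_hi[of i] by (intro divide_left_mono) auto

lemma K_subset_I: "i \<in> Ix \<Longrightarrow> K i k \<subseteq> I i"
  using del_bounds(1)[of i k] by (auto simp: K_def I_def)

lemma K_mono: "i \<in> Ix \<Longrightarrow> m \<le> n \<Longrightarrow> K i m \<subseteq> K i n"
  using del_antimono[of i m n] by (auto simp: K_def)

lemma K_measurable[measurable, simp]: "K i k \<in> sets borel"
  by (simp add: K_def)

lemma K_interior:
  assumes "i \<in> Ix"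
  shows "open (interior (K i k))" "interior (K i k) \<noteq> {}" "interior (K i k) \<subseteq> K i k"
  using del_bounds[OF assms, of k] interior_subset by (auto simp: K_def)

lemma compact_subset_K:
  assumes i: "i \<in> Ix" and C: "compact C" "C \<subseteq> I i"
  shows "\<forall>\<^sub>F k in sequentially. C \<subseteq> K i k"
proof (cases "C = {}")
  case False
  obtain x where x: "x \<in> C" "\<And>z. z \<in> C \<Longrightarrow> x \<le> z" using compact_attains_inf[OF C(1) False] by blast
  obtain y where y: "y \<in> C" "\<And>z. z \<in> C \<Longrightarrow> z \<le> y" using compact_attains_sup[OF C(1) False] by blast
  define e where "e = min (x - lo i) (hi i - y)"
  have e: "e > 0" using x(1) y(1) C(2) by (auto simp: e_def I_def)
  have "(\<lambda>k. (hi i - lo i) / (real k + 3)) \<longlonglongrightarrow> 0"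
    using LIMSEQ_ignore_initial_segment[OF lim_const_over_n[of "hi i - lo i"], of 3] by (simp add: add.commute)
  then have "\<forall>\<^sub>F k in sequentially. del i k < e"
    unfolding del_def using e by (rule order_tendstoD(2))
  then show ?thesis
  proof (rule eventually_mono)
    fix k assume "del i k < e"
    then show "C \<subseteq> K i k" using x(2) y(2) by (fastforce simp: K_def e_def)
  qed
qed auto

lemma idx_finite[simp]: "finite (idx k)"
proof -
  have "inj_on (to_nat_on Ix) (idx k)"
    using inj_on_to_nat_on[OF countable_Ix] by (rule inj_on_subset) (auto simp: idx_def)
  moreover have "finite (to_nat_on Ix ` idx k)"
    by (rule finite_subset[of _ "{..k}"]) (auto simp: idx_def)
  ultimately show ?thesis using finite_imageD by blast
qed

lemma idx_subset: "idx k \<subseteq> Ix"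
  by (auto simp: idx_def)

lemma E_measurable[measurable, simp]: "E k \<in> sets borel"
  unfolding E_def by (intro sets.finite_UN) auto

lemma E_subset_Y: "E k \<subseteq> Y"
  using K_subset_I I_subset_Y idx_subset unfolding E_def by blast

lemma E_mono: "m \<le> n \<Longrightarrow> E m \<subseteq> E n"
  using K_mono unfolding E_def idx_def by fastforce

lemma compact_subset_E:
  assumes i: "i \<in> Ix" and C: "compact C" "C \<subseteq> I i"
  shows "\<forall>\<^sub>F k in sequentially. C \<subseteq> E k"
  using compact_subset_K[OF assms] eventually_ge_at_top[of "to_nat_on Ix i"]
  by eventually_elim (use i in \<open>auto simp: E_def idx_def\<close>)

lemma E_union: "(\<Union>k. E k) = Y"
proof
  show "Y \<subseteq> (\<Union>k. E k)"
  proof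
    fix x assume "x \<in> Y"
    then obtain i where i: "i \<in> Ix" "x \<in> I i" by (auto simp: Y_def)
    have "\<forall>\<^sub>F k in sequentially. {x} \<subseteq> E k" by (rule compact_subset_E[OF i(1)]) (use i in auto)
    then show "x \<in> (\<Union>k. E k)" by (auto simp: eventually_sequentially)
  qed
qed (use E_subset_Y in blast)

text \<open>An inverse branch is continuous on the whole of \<open>I i\<close>, so it maps
  \<open>K i k\<close> onto a compact subset of the open interval \<open>I j\<close>, which some
  \<open>E m\<close> contains. Only finitely many pairs \<open>i\<close>, \<open>j\<close> occur, so
  one index \<open>k'\<close> serves them all.\<close>

lemma preimage_E: "\<exists>k'. T -` E k - E k' \<in> null_sets lam"
proof -
  have *: "\<forall>\<^sub>F m in sequentially. \<psi> j i ` K i k \<subseteq> E m" if i: "i \<in> idx k" and j: "j \<in> pre i" for i j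
  proof -
    have i': "i \<in> Ix" using i idx_subset by blast
    have "continuous_on (I i) (\<psi> j i)"
      using branch[OF i' j] unfolding nonneg_schwarzian_on_def
      by (auto intro!: continuous_at_imp_continuous_on intro: DERIV_isCont)
    then have "compact (\<psi> j i ` K i k)"
      by (intro compact_continuous_image continuous_on_subset[OF _ K_subset_I[OF i']]) (auto simp: K_def)
    moreover have "\<psi> j i ` K i k \<subseteq> I j" using branch_image[OF i' j] K_subset_I[OF i'] by blast
    ultimately show ?thesis using pre_subset[OF i'] j by (intro compact_subset_E) auto
  qed
  have "\<forall>\<^sub>F m in sequentially. \<forall>i\<in>idx k. \<forall>j\<in>pre i. \<psi> j i ` K i k \<subseteq> E m"
    using finite_pre idx_subset by (intro eventually_ball_finite ballI *) auto
  then obtain k' where k': "\<And>i j. i \<in> idx k \<Longrightarrow> j \<in> pre i \<Longrightarrow> \<psi> j i ` K i k \<subseteq> E k'"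
    unfolding eventually_sequentially by blast
  have "(\<Union>i\<in>idx k. T -` K i k - (\<Union>j\<in>pre i. \<psi> j i ` K i k)) \<in> null_sets lam"
  proof (rule null_sets_UN')
    show "countable (idx k)" by (simp add: countable_finite)
    show "T -` K i k - (\<Union>j\<in>pre i. \<psi> j i ` K i k) \<in> null_sets lam" if "i \<in> idx k" for i
      using that idx_subset by (intro preimage_branches_null K_subset_I) auto
  qed
  moreover have "T -` E k - E k' \<subseteq> (\<Union>i\<in>idx k. T -` K i k - (\<Union>j\<in>pre i. \<psi> j i ` K i k))"
    using k' unfolding E_def[of k] by blast
  moreover have "T -` E k - E k' \<in> sets lam" using iterate_vimage_measurable[of "E k" 1] by simp
  ultimately show ?thesis using null_sets_subset by blast
qed

end

section \<open>Invariant measures in the irreducible case\<close>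

lemma ennreal_sum_shift_le:
  fixes a :: "nat \<Rightarrow> ennreal"
  assumes "\<And>n. a n \<le> c"
  shows "(\<Sum>i<n. a (i + m)) \<le> (\<Sum>i<n. a i) + of_nat m * c"
proof -
  have "(\<Sum>i<n. a (i + m)) = sum a {m..<n + m}"
    by (metis (no_types) add.left_neutral atLeast0LessThan sum.shift_bounds_nat_ivl)
  also have "\<dots> \<le> sum a {..<n + m}"
    by (intro sum_mono2) auto
  also have "\<dots> = sum a {..<n} + sum a {n..<n + m}"
    by (metis atLeast0LessThan le_add1 sum.atLeastLessThan_concat zero_le)
  also have "sum a {n..<n + m} \<le> of_nat m * c"
    using sum_bounded_above[of "{n..<n + m}" a c] assms by simp
  finally show ?thesis by (simp add: add_left_mono)
qed

lemma ennreal_suminf_shift_le: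
  fixes a :: "nat \<Rightarrow> ennreal"
  shows "(\<Sum>i. a (i + m)) \<le> (\<Sum>i. a i)"
proof -
  have "(\<Sum>i. a i) = (\<Sum>i. a (i + m)) + (\<Sum>i<m. a i)"
    by (rule suminf_offset) simp
  then show ?thesis by simp
qed

text \<open>Positive measure, and not merely a nonempty intersection, is demanded because the
  Harnack inequality compares measures of sets.\<close>

locale irreducible_markov_line = markov_line +
  assumes irreducible: "\<And>U V. open U \<Longrightarrow> open V \<Longrightarrow> U \<noteq> {} \<Longrightarrow> V \<noteq> {} \<Longrightarrow> U \<subseteq> Y \<Longrightarrow> V \<subseteq> Y \<Longrightarrow>
    \<exists>n. emeasure lborel (U \<inter> (T ^^ n) -` V) > 0"
begin

text \<open>By irreducibility some part \<open>B\<close> of \<open>K i k\<close> of positive measure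
  enters \<open>K i0 n0\<close> after \<open>m\<close> steps. The Harnack inequality inside
  \<open>K i k\<close> bounds the mass of \<open>A\<close> by that of \<open>B\<close>, and
  \<open>B\<close> lies in the preimage of \<open>K i0 n0\<close> under the \<open>m\<close>-th
  iterate. The constants do not involve the measure, so normalising the visits to one compact
  interval controls all the sets \<open>E k\<close>.\<close>

lemma sojourn_dominates:
  assumes i0: "i0 \<in> Ix"
  shows "\<exists>(C::real) m0. \<forall>\<nu>. regular \<nu> \<longrightarrow> (\<forall>A\<in>sets borel. A \<subseteq> E k \<longrightarrow>
      emeasure \<nu> A \<le> ennreal C * emeasure lam A * (\<Sum>m\<le>m0. emeasure \<nu> ((T ^^ m) -` K i0 n0)))"
proof -
  let ?V = "\<lambda>m. (T ^^ m) -` K i0 n0"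
  have V[measurable]: "?V m \<in> sets borel" for m by (rule iterate_vimage_measurable) simp
  have "\<exists>(C::real) m. C \<ge> 0 \<and> (\<forall>\<nu>. regular \<nu> \<longrightarrow> (\<forall>A\<in>sets borel. A \<subseteq> K i k \<longrightarrow>
      emeasure \<nu> A \<le> ennreal C * emeasure lam A * emeasure \<nu> (?V m)))" if i: "i \<in> idx k" for i
  proof -
    have i': "i \<in> Ix" using i idx_subset by blast
    obtain m where m: "emeasure lborel (interior (K i k) \<inter> (T ^^ m) -` interior (K i0 n0)) > 0"
      using irreducible[of "interior (K i k)" "interior (K i0 n0)"] K_interior[OF i'] K_interior[OF i0]
        K_subset_I[OF i'] K_subset_I[OF i0] I_subset_Y[OF i'] I_subset_Y[OF i0] by (meson order_trans)
    define B where "B = K i k \<inter> ?V m"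
    have B[measurable]: "B \<in> sets borel" unfolding B_def by measurable
    have "emeasure lborel (interior (K i k) \<inter> (T ^^ m) -` interior (K i0 n0)) \<le> emeasure lborel B"
      using K_interior(3)[OF i', of k] K_interior(3)[OF i0, of n0] by (intro emeasure_mono) (auto simp: B_def)
    with m have B0: "emeasure lborel B > 0" by auto
    have "emeasure lborel B \<le> emeasure lborel (K i k)" by (intro emeasure_mono) (auto simp: B_def)
    also have "\<dots> < \<infinity>" by (auto simp: K_def emeasure_lborel_Icc_eq)
    finally obtain \<beta> where \<beta>: "emeasure lborel B = ennreal \<beta>" "\<beta> > 0"
      using B0 by (cases "emeasure lborel B") auto
    \<comment> \<open>This is the Harnack constant of \<open>K i k\<close> divided by the Lebesgue
      measure of \<open>B\<close>.\<close>
    define C where "C = ((hi i - lo i) / del i k)\<^sup>2 / \<beta>"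
    have C0: "C \<ge> 0" using \<beta> by (simp add: C_def)
    have "emeasure \<nu> A \<le> ennreal C * emeasure lam A * emeasure \<nu> (?V m)"
      if \<nu>: "regular \<nu>" and A: "A \<in> sets borel" "A \<subseteq> K i k" for \<nu> A
    proof -
      have [simp]: "sets \<nu> = sets borel" using \<nu> by (simp add: regular_def)
      obtain w where w: "w \<in> borel_measurable borel" "moebius_dominated (lo i) (hi i) w"
        "\<And>A. A \<in> sets borel \<Longrightarrow> A \<subseteq> I i \<Longrightarrow> emeasure \<nu> A = (\<integral>\<^sup>+x. w x * indicator A x \<partial>lborel)"
        using \<nu> i' unfolding regular_def by blast
      have sub: "A \<subseteq> I i" "B \<subseteq> I i" using A K_subset_I[OF i'] unfolding B_def by blast+
      have lamA: "emeasure lam A = emeasure lborel A"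
        using sub(1) I_subset_Y[OF i'] A(1) by (subst emeasure_lam) (auto intro: arg_cong[of _ _ "emeasure lborel"])
      have "emeasure \<nu> A * ennreal \<beta> \<le> ennreal (((hi i - lo i) / del i k)\<^sup>2) * emeasure lam A * emeasure \<nu> B"
        unfolding lamA \<beta>(1)[symmetric] w(3)[OF A(1) sub(1)] w(3)[OF B sub(2)]
        by (rule nn_integral_harnack[OF w(1,2) del_bounds(1)[OF i']]) (use A in \<open>auto simp: K_def B_def\<close>)
      also have "((hi i - lo i) / del i k)\<^sup>2 = \<beta> * C" using \<beta> by (simp add: C_def)
      also have "ennreal (\<beta> * C) = ennreal \<beta> * ennreal C" using \<beta> C0 by (simp add: ennreal_mult)
      finally have "ennreal \<beta> * emeasure \<nu> A \<le> ennreal \<beta> * (ennreal C * emeasure lam A * emeasure \<nu> B)"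
        by (simp add: mult_ac)
      then have "emeasure \<nu> A \<le> ennreal C * emeasure lam A * emeasure \<nu> B"
        using \<beta>(2) by (subst (asm) ennreal_mult_le_mult_iff) auto
      also have "\<dots> \<le> ennreal C * emeasure lam A * emeasure \<nu> (?V m)"
        by (intro mult_left_mono emeasure_mono) (auto simp: B_def)
      finally show ?thesis .
    qed
    then show ?thesis using C0 by blast
  qed
  then obtain C :: "'a \<Rightarrow> real" and mm :: "'a \<Rightarrow> nat" where C: "\<And>i. i \<in> idx k \<Longrightarrow> C i \<ge> 0"
    "\<And>i \<nu> A. i \<in> idx k \<Longrightarrow> regular \<nu> \<Longrightarrow> A \<in> sets borel \<Longrightarrow> A \<subseteq> K i k \<Longrightarrow>
      emeasure \<nu> A \<le> ennreal (C i) * emeasure lam A * emeasure \<nu> (?V (mm i))"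
    by metis
  have "finite (mm ` idx k)" by simp
  then obtain m0 where m0: "\<And>i. i \<in> idx k \<Longrightarrow> mm i \<le> m0"
    by (meson finite_nat_set_iff_bounded_le imageI)
  show ?thesis
  proof (intro exI allI impI ballI)
    fix \<nu> A assume \<nu>: "regular \<nu>" and A[measurable]: "A \<in> sets borel" and AE: "A \<subseteq> E k"
    have [measurable_cong, simp]: "sets \<nu> = sets borel" using \<nu> by (simp add: regular_def)
    let ?S = "\<Sum>m\<le>m0. emeasure \<nu> (?V m)"
    have "emeasure \<nu> A \<le> (\<Sum>i\<in>idx k. emeasure \<nu> (A \<inter> K i k))"
    proof -
      have "A = (\<Union>i\<in>idx k. A \<inter> K i k)" using AE unfolding E_def by blast
      then have "emeasure \<nu> A = emeasure \<nu> (\<Union>i\<in>idx k. A \<inter> K i k)" by simp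
      also have "\<dots> \<le> (\<Sum>i\<in>idx k. emeasure \<nu> (A \<inter> K i k))"
        by (rule emeasure_subadditive_finite) auto
      finally show ?thesis .
    qed
    also have "\<dots> \<le> (\<Sum>i\<in>idx k. ennreal (C i) * (emeasure lam A * ?S))"
    proof (rule sum_mono)
      fix i assume i: "i \<in> idx k"
      have "emeasure \<nu> (A \<inter> K i k) \<le> ennreal (C i) * emeasure lam (A \<inter> K i k) * emeasure \<nu> (?V (mm i))"
        by (rule C(2)[OF i \<nu>]) auto
      also have "\<dots> \<le> ennreal (C i) * emeasure lam A * ?S"
      proof (intro mult_mono emeasure_mono order_refl)
        show "emeasure \<nu> (?V (mm i)) \<le> ?S"
          by (rule member_le_sum) (use m0[OF i] in auto)
      qed auto
      finally show "emeasure \<nu> (A \<inter> K i k) \<le> ennreal (C i) * (emeasure lam A * ?S)" by (simp add: mult_ac)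
    qed
    also have "\<dots> = ennreal (\<Sum>i\<in>idx k. C i) * emeasure lam A * ?S"
      using C(1) by (simp add: sum_distrib_right[symmetric] sum_ennreal mult.assoc)
    finally show "emeasure \<nu> A \<le> ennreal (\<Sum>i\<in>idx k. C i) * emeasure lam A * ?S" .
  qed
qed

text \<open>The sums are divided by \<open>S n\<close>, the expected time spent in
  \<open>K i0 n0\<close> before time \<open>n\<close>. The invariance relation fails only by the
  terms at times 0 and \<open>n\<close>, each at most the total mass \<open>\<Lambda>\<close>, and
  \<open>S n\<close> tends to infinity.\<close>

lemma invariant_measure_if_recurrent:
  assumes i0: "i0 \<in> Ix" and rec: "(\<Sum>n. emeasure lam ((T ^^ n) -` K i0 n0)) = \<infinity>"
  obtains \<mu> where "sets \<mu> = sets borel" "emeasure \<mu> UNIV \<noteq> 0" "\<And>k. emeasure \<mu> (E k) < \<infinity>"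
    "\<And>N. N \<in> null_sets lam \<Longrightarrow> emeasure \<mu> N = 0"
    "\<And>A. A \<in> sets borel \<Longrightarrow> emeasure \<mu> (T -` A) = emeasure \<mu> A"
proof -
  define a where "a n = emeasure lam ((T ^^ n) -` K i0 n0)" for n
  define S where "S n = (\<Sum>i<n. a i)" for n
  define \<Lambda> where "\<Lambda> = measure lborel Y"
  have \<Lambda>: "emeasure lborel Y = ennreal \<Lambda>" "\<Lambda> \<ge> 0"
    using finite_Y by (auto simp: \<Lambda>_def emeasure_eq_ennreal_measure)
  have lam_le: "emeasure lam A \<le> ennreal \<Lambda>" if "A \<in> sets borel" for A
    using emeasure_lam_le[OF that] \<Lambda> by simp
  have a_le: "a n \<le> ennreal \<Lambda>" for n
    unfolding a_def by (intro lam_le iterate_vimage_measurable) simp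
  have S_lim: "S \<longlonglongrightarrow> \<infinity>"
    using summable_LIMSEQ[of a] rec unfolding S_def a_def by simp
  have S_fin: "S n < \<infinity>" for n
    unfolding S_def using le_less_trans[OF a_le, of \<infinity>] by (simp add: less_top)
  have S1: "\<forall>\<^sub>F n in sequentially. 1 < S n"
    by (rule order_tendstoD(1)[OF S_lim]) simp
  have to0: "(\<lambda>n. c n / S n) \<longlonglongrightarrow> 0" if "\<And>n. c n \<le> ennreal \<Lambda>" for c
  proof (rule tendsto_sandwich[of "\<lambda>_. 0" _ _ "\<lambda>n. ennreal \<Lambda> / S n"])
    have "(\<lambda>n. inverse (S n)) \<longlonglongrightarrow> inverse \<infinity>"
    proof -
      have "continuous_on UNIV (\<lambda>x::ennreal. inverse x)" by (intro continuous_intros)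
      from continuous_on_tendsto_compose[OF this S_lim] show ?thesis by simp
    qed
    then have "(\<lambda>n. ennreal \<Lambda> * inverse (S n)) \<longlonglongrightarrow> ennreal \<Lambda> * inverse \<infinity>"
      by (intro ennreal_tendsto_cmult) auto
    then show "(\<lambda>n. ennreal \<Lambda> / S n) \<longlonglongrightarrow> 0" by (simp add: divide_ennreal_def)
    show "\<forall>\<^sub>F n in sequentially. c n / S n \<le> ennreal \<Lambda> / S n"
      by (intro always_eventually allI divide_right_mono_ennreal that)
  qed auto
  define b where "b n A = (\<Sum>i<n. emeasure lam ((T ^^ i) -` A)) / S n" for n A
  show thesis
  proof (rule invariant_measure_of_asymptotically_invariant[of T lam E b "K i0 n0"])
    show "b n (A \<union> B) = b n A + b n B" if "A \<in> sets lam" "B \<in> sets lam" "A \<inter> B = {}" for n A B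
    proof -
      have "emeasure lam ((T ^^ i) -` (A \<union> B)) = emeasure lam ((T ^^ i) -` A) + emeasure lam ((T ^^ i) -` B)" for i
        using that by (subst plus_emeasure) (auto simp: iterate_vimage_measurable)
      then show ?thesis by (simp add: b_def sum.distrib add_divide_distrib_ennreal)
    qed
    show "b n A = 0" if "A \<in> null_sets lam" for n A
      using nonsingular[OF that] by (simp add: b_def null_setsD1)
    show "\<exists>C::real. \<forall>\<^sub>F n in sequentially. \<forall>A\<in>sets lam. A \<subseteq> E k \<longrightarrow> b n A \<le> ennreal C * emeasure lam A" for k
    proof -
      obtain C m0 where C: "\<And>\<nu> A. regular \<nu> \<Longrightarrow> A \<in> sets borel \<Longrightarrow> A \<subseteq> E k \<Longrightarrow>
          emeasure \<nu> A \<le> ennreal C * emeasure lam A * (\<Sum>m\<le>m0. emeasure \<nu> ((T ^^ m) -` K i0 n0))"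
        using sojourn_dominates[OF i0, of k n0] by blast
      \<comment> \<open>Shifting the time window by \<open>m\<close> adds at most
        \<open>m * \<Lambda>\<close>, which is at most \<open>m * \<Lambda> * S n\<close> as soon as
        \<open>S n > 1\<close>; hence the factors \<open>1 + m * \<Lambda>\<close>. The maximum with
        0 covers a negative \<open>C\<close>, for which \<open>ennreal C\<close> is 0.\<close>
      define D where "D = max 0 C * (\<Sum>m\<le>m0. 1 + real m * \<Lambda>)"
      have "b n A \<le> ennreal D * emeasure lam A" if n: "1 < S n" and A: "A \<in> sets borel" "A \<subseteq> E k" for n A
      proof -
        have "emeasure lam ((T ^^ i) -` A) \<le> ennreal C * emeasure lam A * (\<Sum>m\<le>m0. a (i + m))" for i
        proof -
          have "emeasure (distr lam borel (T ^^ i)) A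
              \<le> ennreal C * emeasure lam A * (\<Sum>m\<le>m0. emeasure (distr lam borel (T ^^ i)) ((T ^^ m) -` K i0 n0))"
            by (rule C[OF regular_iterate[OF regular_lam] A])
          moreover have "emeasure (distr lam borel (T ^^ i)) ((T ^^ m) -` K i0 n0) = a (i + m)" for m
            by (subst emeasure_iterate[OF regular_lam])
               (auto simp: a_def iterate_vimage_measurable vimage_comp funpow_add[symmetric] add.commute)
          ultimately show ?thesis using A by (simp add: emeasure_iterate[OF regular_lam])
        qed
        then have "(\<Sum>i<n. emeasure lam ((T ^^ i) -` A)) \<le> (\<Sum>i<n. ennreal C * emeasure lam A * (\<Sum>m\<le>m0. a (i + m)))"
          by (intro sum_mono)
        also have "\<dots> = ennreal C * emeasure lam A * (\<Sum>m\<le>m0. \<Sum>i<n. a (i + m))"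
          by (subst sum.swap) (simp add: sum_distrib_left)
        also have "\<dots> \<le> ennreal C * emeasure lam A * (\<Sum>m\<le>m0. ennreal (1 + real m * \<Lambda>) * S n)"
        proof (intro mult_left_mono sum_mono)
          fix m
          have "(\<Sum>i<n. a (i + m)) \<le> S n + of_nat m * ennreal \<Lambda>"
            unfolding S_def by (rule ennreal_sum_shift_le[OF a_le])
          also have "\<dots> \<le> S n + (of_nat m * ennreal \<Lambda>) * S n"
            using mult_left_mono[of 1 "S n" "of_nat m * ennreal \<Lambda>"] n by (intro add_left_mono) auto
          also have "\<dots> = ennreal (1 + real m * \<Lambda>) * S n"
            using \<Lambda>(2) by (simp add: ennreal_plus ennreal_mult ennreal_of_nat_eq_real_of_nat distrib_right)
          finally show "(\<Sum>i<n. a (i + m)) \<le> ennreal (1 + real m * \<Lambda>) * S n" .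
        qed auto
        also have "\<dots> = ennreal C * ennreal (\<Sum>m\<le>m0. 1 + real m * \<Lambda>) * emeasure lam A * S n"
          unfolding sum_distrib_right[symmetric] using \<Lambda>(2) by (subst sum_ennreal) (auto simp: mult_ac)
        also have "ennreal C * ennreal (\<Sum>m\<le>m0. 1 + real m * \<Lambda>) = ennreal D"
          unfolding D_def using \<Lambda>(2) by (subst ennreal_mult) (auto simp: ennreal_max_0 intro!: sum_nonneg)
        finally have "b n A \<le> (ennreal D * emeasure lam A * S n) / S n"
          unfolding b_def by (rule divide_right_mono_ennreal)
        also have "\<dots> = ennreal D * emeasure lam A"
          using n S_fin[of n] by (intro ennreal_mult_divide_eq) auto
        finally show ?thesis .
      qed
      then have "\<forall>\<^sub>F n in sequentially. \<forall>A\<in>sets lam. A \<subseteq> E k \<longrightarrow> b n A \<le> ennreal D * emeasure lam A"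
        using S1 by (auto elim!: eventually_mono)
      then show ?thesis by blast
    qed
    show "\<exists>d e. d \<longlonglongrightarrow> 0 \<and> e \<longlonglongrightarrow> 0 \<and> (\<forall>\<^sub>F n in sequentially. b n (T -` A \<inter> space lam) + d n = b n A + e n)"
      if A: "A \<in> sets lam" "A \<subseteq> E k" for k A
    proof (intro exI conjI always_eventually allI)
      show "(\<lambda>n. emeasure lam A / S n) \<longlonglongrightarrow> 0" "(\<lambda>n. emeasure lam ((T ^^ n) -` A) / S n) \<longlonglongrightarrow> 0"
        using A by (intro to0 lam_le iterate_vimage_measurable; simp)+
      fix n
      have "(\<Sum>i<n. emeasure lam ((T ^^ i) -` T -` A)) + emeasure lam A = (\<Sum>i<Suc n. emeasure lam ((T ^^ i) -` A))"
        by (subst sum.lessThan_Suc_shift) (simp add: vimage_comp add.commute)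
      also have "\<dots> = (\<Sum>i<n. emeasure lam ((T ^^ i) -` A)) + emeasure lam ((T ^^ n) -` A)" by simp
      finally show "b n (T -` A \<inter> space lam) + emeasure lam A / S n = b n A + emeasure lam ((T ^^ n) -` A) / S n"
        by (simp add: b_def add_divide_distrib_ennreal[symmetric])
    qed
    show "\<exists>k'. (T -` E k \<inter> space lam) - E k' \<in> null_sets lam" for k using preimage_E[of k] by simp
    show "K i0 n0 \<subseteq> E (max n0 (to_nat_on Ix i0))"
      using K_mono[OF i0, of n0 "max n0 (to_nat_on Ix i0)"] i0 by (fastforce simp: E_def idx_def)
    show "\<forall>\<^sub>F n in sequentially. b n (K i0 n0) = 1"
      using S1
    proof (rule eventually_mono)
      fix n assume "1 < S n"
      then show "b n (K i0 n0) = 1"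
        using S_fin[of n] by (auto simp: b_def a_def[symmetric] S_def[symmetric] intro!: ennreal_divide_self)
    qed
    show "space lam - (\<Union>k. E k) \<in> null_sets lam"
      by (auto simp: E_union null_sets_lam_iff)
    show "incseq E" by (intro monoI E_mono)
    show "emeasure lam (E k) < \<infinity>" for k using lam_le[of "E k"] by (auto simp: le_less_trans)
    show "T -` N \<inter> space lam \<in> null_sets lam" if "N \<in> null_sets lam" for N
      using nonsingular[OF that, of 1] by simp
    show "T \<in> measurable lam lam" using T_measurable by (simp cong: measurable_cong_sets)
  qed (use that in auto)
qed

text \<open>Here \<open>g k\<close> is the Green measure started from Lebesgue measure on the
  element \<open>J k\<close>. On \<open>K i0 n0\<close> it is finite by transience and positive by
  irreducibility, so it can be normalised there. Dropping the term at time 0 from its series shows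
  that the defect of invariance is exactly the starting measure.\<close>

lemma invariant_measure_if_transient:
  assumes i0: "i0 \<in> Ix" and trans: "(\<Sum>n. emeasure lam ((T ^^ n) -` K i0 n0)) < \<infinity>" and inf: "infinite Ix"
  obtains \<mu> where "sets \<mu> = sets borel" "emeasure \<mu> UNIV \<noteq> 0" "\<And>k. emeasure \<mu> (E k) < \<infinity>"
    "\<And>N. N \<in> null_sets lam \<Longrightarrow> emeasure \<mu> N = 0"
    "\<And>A. A \<in> sets borel \<Longrightarrow> emeasure \<mu> (T -` A) = emeasure \<mu> A"
proof -
  obtain J :: "nat \<Rightarrow> 'a" where J: "inj J" "range J \<subseteq> Ix"
    using infinite_countable_subset[OF inf] by blast
  have JI: "J k \<in> Ix" for k using J(2) by blast
  define \<nu> where "\<nu> k = density lborel (indicator (I (J k)))" for k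
  have reg: "regular (\<nu> k)" for k
    using regular_restrict[of "{J k}"] JI by (simp add: \<nu>_def)
  have sets_\<nu>[simp]: "sets (\<nu> k) = sets borel" for k by (simp add: \<nu>_def)
  have em: "emeasure (\<nu> k) A = emeasure lborel (I (J k) \<inter> A)" if "A \<in> sets borel" for k A
    using that by (simp add: \<nu>_def emeasure_restricted)
  have K0: "(T ^^ n) -` K i0 n0 \<in> sets borel" for n by (intro iterate_vimage_measurable) simp
  define g where "g k A = (\<Sum>n. emeasure (\<nu> k) ((T ^^ n) -` A))" for k A
  have g_fin: "g k (K i0 n0) < \<infinity>" for k
  proof -
    have "g k (K i0 n0) \<le> (\<Sum>n. emeasure lam ((T ^^ n) -` K i0 n0))"
      unfolding g_def using K0 I_subset_Y[OF JI] iterate_vimage_measurable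
      by (intro suminf_le) (auto simp: em emeasure_lam intro!: emeasure_mono)
    then show ?thesis using trans by (rule le_less_trans)
  qed
  have g_pos: "g k (K i0 n0) > 0" for k
  proof -
    obtain n where n: "emeasure lborel (I (J k) \<inter> (T ^^ n) -` interior (K i0 n0)) > 0"
    proof -
      have "interior (K i0 n0) \<subseteq> Y"
        using interior_subset K_subset_I[OF i0] I_subset_Y[OF i0] by blast
      moreover have "open (I (J k))" "I (J k) \<noteq> {}" using lo_less_hi[OF JI[of k]] by (auto simp: I_def)
      ultimately show ?thesis
        using irreducible[of "I (J k)" "interior (K i0 n0)"] K_interior[OF i0, of n0] I_subset_Y[OF JI[of k]] that by blast
    qed
    also have "\<dots> \<le> emeasure (\<nu> k) ((T ^^ n) -` K i0 n0)"
      unfolding em[OF K0] using K_interior(3)[OF i0, of n0] K0[of n] by (intro emeasure_mono) auto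
    also have "\<dots> \<le> g k (K i0 n0)"
      unfolding g_def using sum_le_suminf[of "\<lambda>n. emeasure (\<nu> k) ((T ^^ n) -` K i0 n0)" "{n}"] by simp
    finally show ?thesis .
  qed
  define b where "b k A = g k A / g k (K i0 n0)" for k A
  show thesis
  proof (rule invariant_measure_of_asymptotically_invariant[of T lam E b "K i0 n0"])
    show "b n (A \<union> B) = b n A + b n B" if "A \<in> sets lam" "B \<in> sets lam" "A \<inter> B = {}" for n A B
    proof -
      have "emeasure (\<nu> n) ((T ^^ i) -` (A \<union> B)) = emeasure (\<nu> n) ((T ^^ i) -` A) + emeasure (\<nu> n) ((T ^^ i) -` B)" for i
        using that by (subst plus_emeasure) (auto simp: iterate_vimage_measurable)
      then show ?thesis by (simp add: b_def g_def suminf_add[symmetric] add_divide_distrib_ennreal)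
    qed
    show "b n A = 0" if "A \<in> null_sets lam" for n A
      using regular_null[OF reg nonsingular[OF that]] by (simp add: b_def g_def null_setsD1)
    show "\<exists>C::real. \<forall>\<^sub>F n in sequentially. \<forall>A\<in>sets lam. A \<subseteq> E k \<longrightarrow> b n A \<le> ennreal C * emeasure lam A" for k
    proof -
      obtain C m0 where C: "\<And>\<nu> A. regular \<nu> \<Longrightarrow> A \<in> sets borel \<Longrightarrow> A \<subseteq> E k \<Longrightarrow>
          emeasure \<nu> A \<le> ennreal C * emeasure lam A * (\<Sum>m\<le>m0. emeasure \<nu> ((T ^^ m) -` K i0 n0))"
        using sojourn_dominates[OF i0, of k n0] by blast
      \<comment> \<open>A shift only drops terms of the series, so each of the \<open>m0 + 1\<close>
        shifted series is at most the normalising mass.\<close>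
      define D where "D = max 0 C * (real m0 + 1)"
      have "b n A \<le> ennreal D * emeasure lam A" if A: "A \<in> sets borel" "A \<subseteq> E k" for n A
      proof -
        let ?a = "\<lambda>i. emeasure (\<nu> n) ((T ^^ i) -` K i0 n0)"
        have "emeasure (\<nu> n) ((T ^^ i) -` A) \<le> ennreal C * emeasure lam A * (\<Sum>m\<le>m0. ?a (i + m))" for i
        proof -
          have "emeasure (distr (\<nu> n) borel (T ^^ i)) A
              \<le> ennreal C * emeasure lam A * (\<Sum>m\<le>m0. emeasure (distr (\<nu> n) borel (T ^^ i)) ((T ^^ m) -` K i0 n0))"
            by (rule C[OF regular_iterate[OF reg] A])
          moreover have "emeasure (distr (\<nu> n) borel (T ^^ i)) ((T ^^ m) -` K i0 n0) = ?a (i + m)" for m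
            by (subst emeasure_iterate[OF reg])
               (auto simp: iterate_vimage_measurable vimage_comp funpow_add[symmetric] add.commute)
          ultimately show ?thesis using A by (simp add: emeasure_iterate[OF reg])
        qed
        then have "g n A \<le> (\<Sum>i. ennreal C * emeasure lam A * (\<Sum>m\<le>m0. ?a (i + m)))"
          unfolding g_def by (intro suminf_le) auto
        also have "\<dots> = ennreal C * emeasure lam A * (\<Sum>m\<le>m0. \<Sum>i. ?a (i + m))"
          by (simp add: suminf_sum)
        also have "\<dots> \<le> ennreal C * emeasure lam A * (\<Sum>m\<le>m0. g n (K i0 n0))"
          unfolding g_def by (intro mult_left_mono sum_mono ennreal_suminf_shift_le) auto
        also have "\<dots> = ennreal C * ennreal (real m0 + 1) * emeasure lam A * g n (K i0 n0)"
          by (simp add: mult_ac ennreal_of_nat_eq_real_of_nat add.commute)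
        also have "ennreal C * ennreal (real m0 + 1) = ennreal D"
          unfolding D_def by (subst ennreal_mult) (auto simp: ennreal_max_0)
        finally have "b n A \<le> (ennreal D * emeasure lam A * g n (K i0 n0)) / g n (K i0 n0)"
          unfolding b_def by (rule divide_right_mono_ennreal)
        also have "\<dots> = ennreal D * emeasure lam A"
          using g_pos[of n] g_fin[of n] by (intro ennreal_mult_divide_eq) auto
        finally show ?thesis .
      qed
      then show ?thesis by (intro exI[of _ D] always_eventually) auto
    qed
    show "\<exists>d e. d \<longlonglongrightarrow> 0 \<and> e \<longlonglongrightarrow> 0 \<and> (\<forall>\<^sub>F n in sequentially. b n (T -` A \<inter> space lam) + d n = b n A + e n)"
      if A: "A \<in> sets lam" "A \<subseteq> E k" for k A
    proof (intro exI conjI always_eventually allI)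
      \<comment> \<open>Since \<open>J\<close> is injective and \<open>idx k\<close> is finite, the
        starting elements are eventually disjoint from \<open>E k\<close>, and the starting mass of
        \<open>A\<close> is then exactly 0.\<close>
      have "finite {n. J n \<in> idx k}"
        using finite_vimageI[OF idx_finite[of k] J(1)] by (simp add: vimage_def)
      then have "\<forall>\<^sub>F n in sequentially. J n \<notin> idx k"
        by (metis (mono_tags, lifting) cofinite_eq_sequentially eventually_cofinite mem_Collect_eq not_not Collect_cong)
      then have "\<forall>\<^sub>F n in sequentially. emeasure (\<nu> n) A / g n (K i0 n0) = 0"
      proof (rule eventually_mono)
        fix n assume n: "J n \<notin> idx k"
        have "I (J n) \<inter> E k = {}"
          using n I_disjoint[OF JI] K_subset_I idx_subset unfolding E_def by blast
        then have "I (J n) \<inter> A = {}" using A by blast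
        then show "emeasure (\<nu> n) A / g n (K i0 n0) = 0" using A by (simp add: em)
      qed
      then show "(\<lambda>n. emeasure (\<nu> n) A / g n (K i0 n0)) \<longlonglongrightarrow> 0" by (rule tendsto_eventually)
      show "(\<lambda>n. 0 :: ennreal) \<longlonglongrightarrow> 0" by simp
      fix n
      have "g n A = (\<Sum>i. emeasure (\<nu> n) ((T ^^ (i + 1)) -` A)) + (\<Sum>i<1. emeasure (\<nu> n) ((T ^^ i) -` A))"
        unfolding g_def by (rule suminf_offset) simp
      also have "\<dots> = g n (T -` A) + emeasure (\<nu> n) A"
        by (simp add: g_def vimage_comp)
      finally show "b n (T -` A \<inter> space lam) + emeasure (\<nu> n) A / g n (K i0 n0) = b n A + 0"
        by (simp add: b_def add_divide_distrib_ennreal[symmetric])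
    qed
    show "\<exists>k'. (T -` E k \<inter> space lam) - E k' \<in> null_sets lam" for k using preimage_E[of k] by simp
    show "K i0 n0 \<subseteq> E (max n0 (to_nat_on Ix i0))"
      using K_mono[OF i0, of n0 "max n0 (to_nat_on Ix i0)"] i0 by (fastforce simp: E_def idx_def)
    show "\<forall>\<^sub>F n in sequentially. b n (K i0 n0) = 1"
    proof (intro always_eventually allI)
      show "b n (K i0 n0) = 1" for n
        unfolding b_def using g_pos[of n] g_fin[of n] by (intro ennreal_divide_self) auto
    qed
    show "space lam - (\<Union>k. E k) \<in> null_sets lam"
      by (auto simp: E_union null_sets_lam_iff)
    show "incseq E" by (intro monoI E_mono)
    show "emeasure lam (E k) < \<infinity>" for k using emeasure_lam_le[of "E k"] finite_Y by (auto simp: le_less_trans)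
    show "T -` N \<inter> space lam \<in> null_sets lam" if "N \<in> null_sets lam" for N
      using nonsingular[OF that, of 1] by simp
    show "T \<in> measurable lam lam" using T_measurable by (simp cong: measurable_cong_sets)
  qed (use that in auto)
qed

end

section \<open>Recurrence of systems with finitely many intervals\<close>

lemma nonneg_schwarzian_on_strict_mono:
  assumes "nonneg_schwarzian_on {a<..<b} \<psi> \<psi>1"
  shows "(\<forall>s\<in>{a<..<b}. \<forall>t\<in>{a<..<b}. s < t \<longrightarrow> \<psi> s < \<psi> t) \<or>
    (\<forall>s\<in>{a<..<b}. \<forall>t\<in>{a<..<b}. s < t \<longrightarrow> \<psi> t < \<psi> s)"
proof -
  have D: "(\<psi> has_real_derivative \<psi>1 t) (at t)" if "t \<in> {a<..<b}" for t
    using assms that unfolding nonneg_schwarzian_on_def by blast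
  have sub: "x \<in> {a<..<b}" if "s \<in> {a<..<b}" "t \<in> {a<..<b}" "s \<le> x" "x \<le> t" for s t x
    using that by auto
  from nonneg_schwarzian_on_sign[OF assms] show ?thesis
  proof
    assume "\<forall>t\<in>{a<..<b}. 0 < \<psi>1 t"
    then have "\<psi> s < \<psi> t" if "s \<in> {a<..<b}" "t \<in> {a<..<b}" "s < t" for s t
      using D sub[OF that(1,2)] by (intro DERIV_pos_imp_increasing[OF that(3)]) blast
    then show ?thesis by blast
  next
    assume "\<forall>t\<in>{a<..<b}. \<psi>1 t < 0"
    then have "\<psi> t < \<psi> s" if "s \<in> {a<..<b}" "t \<in> {a<..<b}" "s < t" for s t
      using D sub[OF that(1,2)] by (intro DERIV_neg_imp_decreasing[OF that(3)]) blast
    then show ?thesis by blast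
  qed
qed

text \<open>
  If there are only finitely many intervals, transience would mean that almost every orbit
  eventually stays in the finitely many gaps between the compact middle intervals and the
  endpoints. Chosen small enough, each gap is mapped into a half of a single interval, so two
  orbits that start in the same gap and never leave the gaps trap the whole interval between
  them. This contradicts irreducibility.
\<close>

context irreducible_markov_line
begin

lemma recurrent_if_finite:
  assumes fin: "finite Ix"
  shows "\<exists>i\<in>Ix. \<exists>k. (\<Sum>n. emeasure lam ((T ^^ n) -` K i k)) = \<infinity>"
proof (rule ccontr)
  assume "\<not> ?thesis"
  then have trans: "(\<Sum>n. emeasure lam ((T ^^ n) -` K i k)) < \<infinity>" if "i \<in> Ix" for i k
    using that by (auto simp: less_top)
  define mid where "mid i = (lo i + hi i) / 2" for i
  define piece where "piece j i = \<psi> j i ` I i" for j i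
  have mid_K: "mid i \<in> K i k" if "i \<in> Ix" for i k
    using del_bounds[OF that, of k] by (auto simp: mid_def K_def field_simps)
  have connected_piece: "connected (piece j i)" if "i \<in> Ix" "j \<in> pre i" for i j
  proof -
    have "continuous_on (I i) (\<psi> j i)"
      using branch[OF that] unfolding nonneg_schwarzian_on_def
      by (auto intro!: continuous_at_imp_continuous_on intro: DERIV_isCont)
    then show ?thesis unfolding piece_def by (rule connected_continuous_image) (simp add: I_def)
  qed
  \<comment> \<open>These are the points that a gap has to avoid. Without a preimage of
    \<open>mid i\<close> in the gap, its image cannot stretch across the middle of
    \<open>I i\<close>. Without the right end of a piece, a gap whose left end lies in that piece
    stays in it; only right ends matter because the argument starts from the left end
    \<open>x\<close>.\<close>
  define Crit where "Crit j = I j \<inter> (\<Union>i\<in>Ix. {\<psi> j i (mid i), Sup (piece j i)})" for j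
  have "\<forall>\<^sub>F k in sequentially. \<forall>j\<in>Ix. Crit j \<subseteq> K j k"
  proof (intro eventually_ball_finite fin ballI compact_subset_K)
    show "compact (Crit j)" for j
      unfolding Crit_def using fin by (intro finite_imp_compact finite_Int) auto
  qed (auto simp: Crit_def)
  then obtain kk where kk: "\<And>j. j \<in> Ix \<Longrightarrow> Crit j \<subseteq> K j kk"
    unfolding eventually_sequentially by blast
  define KK where "KK = (\<Union>j\<in>Ix. K j kk)"
  have KK_I: "x \<in> K j kk" if "x \<in> KK" "x \<in> I j" "j \<in> Ix" for x j
    using that K_subset_I I_disjoint unfolding KK_def by blast
  define Gd where "Gd = (\<Union>i\<in>Ix. \<Union>j\<in>pre i. piece j i)"
  have Gd_Y: "Gd \<subseteq> Y" using branch_image I_subset_Y pre_subset unfolding Gd_def piece_def by blast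
  have Gd_borel[measurable]: "Gd \<in> sets borel"
    unfolding Gd_def piece_def using fin finite_pre branch_open by (intro sets.finite_UN borel_open) auto
  have Gd_full: "- Gd \<in> null_sets lam"
  proof -
    have "(\<Union>i\<in>Ix. (Y \<inter> T -` I i) - (\<Union>j\<in>pre i. \<psi> j i ` I i)) \<union> (Y \<inter> T -` (- Y)) \<in> null_sets lborel"
      using branches_cover countable_Ix T_Y by (intro null_sets.Un null_sets_UN') auto
    then have "Y \<inter> - Gd \<in> null_sets lborel"
    proof (rule null_sets_subset)
      show "Y \<inter> - Gd \<subseteq> (\<Union>i\<in>Ix. (Y \<inter> T -` I i) - (\<Union>j\<in>pre i. \<psi> j i ` I i)) \<union> (Y \<inter> T -` (- Y))"
      proof
        fix x assume x: "x \<in> Y \<inter> - Gd"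
        show "x \<in> (\<Union>i\<in>Ix. (Y \<inter> T -` I i) - (\<Union>j\<in>pre i. \<psi> j i ` I i)) \<union> (Y \<inter> T -` (- Y))"
        proof (cases "T x \<in> Y")
          case True
          then obtain i where "i \<in> Ix" "T x \<in> I i" unfolding Y_def by blast
          then show ?thesis using x unfolding Gd_def piece_def by (intro UnI1 UN_I[of i]) auto
        next
          case False
          then show ?thesis using x by (intro UnI2) simp
        qed
      qed
    qed simp
    then show ?thesis by (simp add: null_sets_lam_iff)
  qed
  define good where "good x \<longleftrightarrow> (\<forall>m. (T ^^ m) x \<in> Gd - KK)" for x
  have good_T: "good (T x)" if "good x" for x
    unfolding good_def
  proof
    fix m show "(T ^^ m) (T x) \<in> Gd - KK"
      using that[unfolded good_def, rule_format, of "Suc m"] by (simp add: funpow_swap1)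
  qed
  define gap where "gap x y \<longleftrightarrow> x \<le> y \<and> (\<exists>j\<in>Ix. {x..y} \<subseteq> I j - K j kk)" for x y
  have gap_disjoint: "z \<in> Y - KK" if "gap x y" "z \<in> {x..y}" for x y z
    using that KK_I I_subset_Y unfolding gap_def by blast
  \<comment> \<open>On a gap \<open>T\<close> is the inverse of one monotone branch, so the image is
    spanned by \<open>T x\<close> and \<open>T y\<close>. Both lie outside \<open>K i kk\<close>
    because the orbits are good. If the image interval met \<open>K i kk\<close>, it would contain
    it together with \<open>mid i\<close>, and the preimage of \<open>mid i\<close> would be a
    critical point in the gap.\<close>
  have gap_step: "gap (min (T x) (T y)) (max (T x) (T y)) \<and>
      (\<forall>s\<in>{x..y}. T s \<in> {min (T x) (T y)..max (T x) (T y)})"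
    if g: "gap x y" and x: "good x" and y: "good y" for x y
  proof -
    obtain j where j: "j \<in> Ix" "{x..y} \<subseteq> I j - K j kk" and xy: "x \<le> y"
      using g unfolding gap_def by blast
    have "x \<in> Gd" using x unfolding good_def by (metis DiffD1 funpow_0)
    then obtain i j' where i: "i \<in> Ix" "j' \<in> pre i" "x \<in> piece j' i" unfolding Gd_def by blast
    have "x \<in> I j'" using branch_image[OF i(1,2)] i(3) unfolding piece_def by blast
    moreover have "x \<in> I j" using j(2) xy by auto
    moreover have "j' \<in> Ix" using pre_subset[OF i(1)] i(2) by blast
    ultimately have "j' = j" using I_disjoint j(1) by blast
    note i = i[unfolded this]
    have bnd: "bdd_above (piece j i)"
      using branch_image[OF i(1,2)] unfolding piece_def I_def by (meson bdd_above_Ioo bdd_above_mono)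
    have avoid: "z \<notin> Crit j" if "z \<in> {x..y}" for z using kk[OF j(1)] j(2) that by blast
    have in_piece: "z \<in> piece j i" if z: "z \<in> {x..y}" for z
    proof (rule ccontr)
      assume nz: "z \<notin> piece j i"
      have "s \<le> z" if "s \<in> piece j i" for s
      proof (rule ccontr)
        assume "\<not> s \<le> z"
        then have "z \<in> piece j i"
          using connectedD_interval[OF connected_piece[OF i(1,2)] i(3) that, of z] z by simp
        then show False using nz by simp
      qed
      then have "Sup (piece j i) \<le> z" using i(3) by (intro cSup_least) auto
      moreover have "x \<le> Sup (piece j i)" by (rule cSup_upper[OF i(3) bnd])
      ultimately have S: "Sup (piece j i) \<in> {x..y}" using z by auto
      then have "Sup (piece j i) \<in> I j" using j(2) by blast
      then have "Sup (piece j i) \<in> Crit j"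
        unfolding Crit_def by (intro IntI UN_I[OF i(1)]) simp_all
      then show False using avoid S by blast
    qed
    have T_in: "T z \<in> I i" "\<psi> j i (T z) = z" if "z \<in> {x..y}" for z
      using in_piece[OF that] T_branch[OF i(1,2)] unfolding piece_def by auto
    have mono: "(\<forall>s\<in>I i. \<forall>t\<in>I i. s < t \<longrightarrow> \<psi> j i s < \<psi> j i t) \<or> (\<forall>s\<in>I i. \<forall>t\<in>I i. s < t \<longrightarrow> \<psi> j i t < \<psi> j i s)"
      using nonneg_schwarzian_on_strict_mono[OF branch[OF i(1,2), unfolded I_def]] unfolding I_def .
    define u v where "u = min (T x) (T y)" and "v = max (T x) (T y)"
    have xin: "x \<in> {x..y}" and yin: "y \<in> {x..y}" using xy by auto
    have uv_I: "{u..v} \<subseteq> I i" using T_in(1)[OF xin] T_in(1)[OF yin] by (auto simp: u_def v_def I_def)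
    note Tx = T_in[OF xin] and Ty = T_in[OF yin]
    have between: "T s \<in> {u..v}" if s: "s \<in> {x..y}" for s
    proof (rule ccontr)
      note Ts = T_in[OF s]
      assume "T s \<notin> {u..v}"
      then have out: "T s < T x \<and> T s < T y \<or> T x < T s \<and> T y < T s"
        by (auto simp: u_def v_def min_def max_def split: if_splits)
      from mono show False
      proof
        assume inc: "\<forall>s\<in>I i. \<forall>t\<in>I i. s < t \<longrightarrow> \<psi> j i s < \<psi> j i t"
        have "T s < T x \<Longrightarrow> s < x" "T y < T s \<Longrightarrow> y < s"
          using inc[rule_format, OF Ts(1) Tx(1)] inc[rule_format, OF Ty(1) Ts(1)] by (simp_all add: Ts(2) Tx(2) Ty(2))
        then show False using out s by auto
      next
        assume dec: "\<forall>s\<in>I i. \<forall>t\<in>I i. s < t \<longrightarrow> \<psi> j i t < \<psi> j i s"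
        have "T s < T y \<Longrightarrow> y < s" "T x < T s \<Longrightarrow> s < x"
          using dec[rule_format, OF Ts(1) Ty(1)] dec[rule_format, OF Tx(1) Ts(1)] by (simp_all add: Ts(2) Tx(2) Ty(2))
        then show False using out s by auto
      qed
    qed
    have pulled_back: "\<psi> j i t \<in> {x..y}" if t: "t \<in> {u..v}" for t
    proof -
      have tI: "t \<in> I i" using t uv_I by blast
      have weak: "t = T x \<or> t = T y \<or> T x < t \<and> t < T y \<or> T y < t \<and> t < T x"
        using t by (auto simp: u_def v_def min_def max_def split: if_splits)
      from mono show ?thesis
      proof
        assume inc: "\<forall>s\<in>I i. \<forall>t\<in>I i. s < t \<longrightarrow> \<psi> j i s < \<psi> j i t"
        have "T x < t \<Longrightarrow> x < \<psi> j i t" "t < T y \<Longrightarrow> \<psi> j i t < y" "T y < T x \<Longrightarrow> y < x"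
          using inc[rule_format, OF Tx(1) tI] inc[rule_format, OF tI Ty(1)] inc[rule_format, OF Ty(1) Tx(1)]
          by (simp_all add: Tx(2) Ty(2))
        then show ?thesis using weak xy Tx(2) Ty(2) by auto
      next
        assume dec: "\<forall>s\<in>I i. \<forall>t\<in>I i. s < t \<longrightarrow> \<psi> j i t < \<psi> j i s"
        have "T y < t \<Longrightarrow> \<psi> j i t < y" "t < T x \<Longrightarrow> x < \<psi> j i t" "T x < T y \<Longrightarrow> y < x"
          using dec[rule_format, OF Ty(1) tI] dec[rule_format, OF tI Tx(1)] dec[rule_format, OF Tx(1) Ty(1)]
          by (simp_all add: Tx(2) Ty(2))
        then show ?thesis using weak xy Tx(2) Ty(2) by auto
      qed
    qed
    have nK: "T x \<notin> K i kk" "T y \<notin> K i kk"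
      using good_T[OF x] good_T[OF y] i(1) unfolding good_def KK_def by (metis DiffD2 UN_I funpow_0)+
    have "z \<notin> K i kk" if z: "z \<in> {u..v}" for z
    proof
      assume "z \<in> K i kk"
      then have "mid i \<in> {u..v}"
        using mid_K[OF i(1), of kk] nK z unfolding K_def u_def v_def by (auto simp: min_def max_def split: if_splits)
      then have S: "\<psi> j i (mid i) \<in> {x..y}" by (rule pulled_back)
      then have "\<psi> j i (mid i) \<in> I j" using j(2) by blast
      then have "\<psi> j i (mid i) \<in> Crit j"
        unfolding Crit_def by (intro IntI UN_I[OF i(1)]) simp_all
      then show False using avoid S by blast
    qed
    then have "gap u v" using uv_I i(1) unfolding gap_def by (auto simp: u_def v_def)
    then show ?thesis using between unfolding u_def v_def by blast
  qed
  have trapped: "\<forall>s\<in>{x..y}. (T ^^ n) s \<in> Y - KK" if "gap x y" "good x" "good y" for x y n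
    using that
  proof (induction n arbitrary: x y)
    case 0
    then show ?case using gap_disjoint by simp
  next
    case (Suc n)
    note st = gap_step[OF Suc.prems]
    have "good (min (T x) (T y))" "good (max (T x) (T y))"
      using good_T Suc.prems by (auto simp: min_def max_def)
    then have IH: "\<forall>s\<in>{min (T x) (T y)..max (T x) (T y)}. (T ^^ n) s \<in> Y - KK"
      using st by (intro Suc.IH) auto
    show ?case
    proof
      fix s assume "s \<in> {x..y}"
      then have "(T ^^ n) (T s) \<in> Y - KK" using st IH by blast
      then show "(T ^^ Suc n) s \<in> Y - KK" by (simp add: funpow_swap1)
    qed
  qed
  have no_pair: "x = y" if g: "gap x y" "good x" "good y" for x y
  proof (rule ccontr)
    assume "x \<noteq> y"
    then have xy: "x < y" using g(1) unfolding gap_def by auto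
    obtain i0 where i0: "i0 \<in> Ix" using Ix_nonempty by blast
    have "{x<..<y} \<subseteq> Y" using gap_disjoint[OF g(1)] by fastforce
    moreover have "interior (K i0 kk) \<subseteq> Y" using interior_subset K_subset_I[OF i0] I_subset_Y[OF i0] by blast
    ultimately obtain n where n: "emeasure lborel ({x<..<y} \<inter> (T ^^ n) -` interior (K i0 kk)) > 0"
      using irreducible[of "{x<..<y}" "interior (K i0 kk)"] K_interior[OF i0, of kk] xy by auto
    then have "{x<..<y} \<inter> (T ^^ n) -` interior (K i0 kk) \<noteq> {}" by auto
    then obtain s where "s \<in> {x<..<y}" "(T ^^ n) s \<in> interior (K i0 kk)" by blast
    then have s: "s \<in> {x..y}" "(T ^^ n) s \<in> interior (K i0 kk)" by auto
    then have "(T ^^ n) s \<in> KK" using interior_subset i0 unfolding KK_def by blast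
    then show False using trapped[OF g, of n] s(1) by blast
  qed
  define Z where "Z = {x. good x}"
  have "finite Z"
  proof -
    have one: "finite A" if "\<And>x y. x \<in> A \<Longrightarrow> y \<in> A \<Longrightarrow> x \<le> y \<Longrightarrow> x = y" for A :: "real set"
    proof (cases "A = {}")
      case False
      then obtain x where "x \<in> A" by blast
      then have "A \<subseteq> {x}" using that by (metis linear singletonI subsetI)
      then show ?thesis by (rule finite_subset) simp
    qed simp
    \<comment> \<open>Two good points in the same half of an element bound a gap, hence coincide. So
      there are at most two good points per element.\<close>
    have "Z \<subseteq> (\<Union>j\<in>Ix. (Z \<inter> I j \<inter> {..mid j}) \<union> (Z \<inter> I j \<inter> {mid j..}))"
    proof
      fix x assume x: "x \<in> Z"
      then have "x \<in> Y" using Gd_Y unfolding Z_def good_def by (metis (mono_tags) DiffD1 funpow_0 mem_Collect_eq subsetD)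
      then show "x \<in> (\<Union>j\<in>Ix. (Z \<inter> I j \<inter> {..mid j}) \<union> (Z \<inter> I j \<inter> {mid j..}))" using x by (auto simp: Y_def)
    qed
    moreover have "finite (Z \<inter> I j \<inter> {..mid j})" "finite (Z \<inter> I j \<inter> {mid j..})" if j: "j \<in> Ix" for j
    proof -
      have nK: "x \<notin> K j kk" if "x \<in> Z" for x
        using that j unfolding Z_def good_def KK_def by (metis (mono_tags, lifting) DiffD2 UN_I funpow_0 mem_Collect_eq)
      have seg: "x = y" if "x \<in> Z" "y \<in> Z" "x \<in> I j" "y \<in> I j" "x \<le> y" "y \<le> mid j \<or> mid j \<le> x" for x y
      proof (rule no_pair)
        have "{x..y} \<inter> K j kk = {}"
          using nK[OF that(1)] nK[OF that(2)] that(5,6) mid_K[OF j, of kk] unfolding K_def by auto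
        moreover have "{x..y} \<subseteq> I j" using that(3,4) by (auto simp: I_def)
        ultimately show "gap x y" using that(5) j unfolding gap_def by blast
      qed (use that in \<open>auto simp: Z_def\<close>)
      show "finite (Z \<inter> I j \<inter> {..mid j})" by (rule one) (auto intro: seg)
      show "finite (Z \<inter> I j \<inter> {mid j..})" by (rule one) (auto intro: seg)
    qed
    ultimately show ?thesis using fin finite_subset by (metis (no_types, lifting) finite_UN finite_Un)
  qed
  then have "Z \<in> null_sets lborel" by (rule finite_imp_null_set_lborel)
  then have "Z \<in> null_sets lam"
    by (auto simp: null_sets_lam_iff intro: null_set_Int1)
  then have N: "(\<Union>n. (T ^^ n) -` Z) \<union> (\<Union>n. (T ^^ n) -` (- Gd)) \<in> null_sets lam"
    using Gd_full by (intro null_sets.Un null_sets_UN nonsingular)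
  have "AE x in lam. x \<notin> (\<Union>n. (T ^^ n) -` Z) \<union> (\<Union>n. (T ^^ n) -` (- Gd))"
    by (rule AE_not_in[OF N])
  \<comment> \<open>By the Borel-Cantelli lemma, transience makes almost every orbit visit each
    \<open>K j kk\<close> only finitely often. As there are finitely many \<open>j\<close>, almost
    every orbit eventually reaches a good point, although the points that ever do so form a null
    set.\<close>
  moreover have "AE x in lam. \<forall>j\<in>Ix. \<forall>\<^sub>F n in sequentially. x \<in> space lam - (T ^^ n) -` K j kk"
  proof (rule AE_finite_allI[OF fin])
    fix j assume j: "j \<in> Ix"
    have fm: "emeasure lam ((T ^^ n) -` K j kk) < \<infinity>" for n
      using emeasure_lam_le[OF iterate_vimage_measurable[of "K j kk" n]] finite_Y by (auto simp: le_less_trans)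
    have "(\<Sum>n. ennreal (measure lam ((T ^^ n) -` K j kk))) \<noteq> top"
      using trans[OF j, of kk] fm by (simp add: emeasure_eq_ennreal_measure[symmetric] less_top)
    then have "summable (\<lambda>n. measure lam ((T ^^ n) -` K j kk))"
      by (intro summable_suminf_not_top) auto
    then show "AE x in lam. \<forall>\<^sub>F n in sequentially. x \<in> space lam - (T ^^ n) -` K j kk"
      using fm by (intro borel_cantelli_AE1) (auto intro: iterate_vimage_measurable)
  qed
  ultimately have "AE x in lam. False"
  proof eventually_elim
    case (elim x)
    then have "\<forall>\<^sub>F n in sequentially. \<forall>j\<in>Ix. x \<in> space lam - (T ^^ n) -` K j kk"
      using fin by (intro eventually_ball_finite) auto
    then obtain n where n: "\<And>m. m \<ge> n \<Longrightarrow> (T ^^ m) x \<notin> KK"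
      unfolding eventually_sequentially KK_def by auto
    have "good ((T ^^ n) x)"
      unfolding good_def
    proof
      fix m
      have "(T ^^ m) ((T ^^ n) x) = (T ^^ (m + n)) x" by (simp add: funpow_add)
      then show "(T ^^ m) ((T ^^ n) x) \<in> Gd - KK" using n[of "m + n"] elim(1) by auto
    qed
    then show ?case using elim(1) unfolding Z_def by blast
  qed
  then have "emeasure lam UNIV = 0" by (simp add: AE_iff_null null_sets_def)
  then have "emeasure lborel Y = 0" by (simp add: emeasure_lam)
  moreover obtain i0 where i0: "i0 \<in> Ix" using Ix_nonempty by blast
  moreover have "emeasure lborel (I i0) \<le> emeasure lborel Y"
    using I_subset_Y[OF i0] by (intro emeasure_mono) auto
  ultimately show False using lo_less_hi[OF i0] by (simp add: I_def)
qed

theorem invariant_measure: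
  obtains \<mu> where "sets \<mu> = sets borel" "emeasure \<mu> UNIV \<noteq> 0" "\<And>k. emeasure \<mu> (E k) < \<infinity>"
    "\<And>N. N \<in> null_sets lam \<Longrightarrow> emeasure \<mu> N = 0"
    "\<And>A. A \<in> sets borel \<Longrightarrow> emeasure \<mu> (T -` A) = emeasure \<mu> A"
proof (cases "\<exists>i\<in>Ix. \<exists>k. (\<Sum>n. emeasure lam ((T ^^ n) -` K i k)) = \<infinity>")
  case True
  then show thesis using invariant_measure_if_recurrent that by blast
next
  case False
  then have "infinite Ix" using recurrent_if_finite by blast
  moreover obtain i where "i \<in> Ix" using Ix_nonempty by blast
  moreover have "(\<Sum>n. emeasure lam ((T ^^ n) -` K i 0)) < \<infinity>"
    using False \<open>i \<in> Ix\<close> by (auto simp: less_top)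
  ultimately show thesis using invariant_measure_if_transient that by blast
qed

end

section \<open>Lifting Markov maps to the real line\<close>

text \<open>With h the inverse of g, differentiating g(h(y)) = y three times gives Sh = - (Sg o h) *
  (h')^2, so inversion reverses the sign of the Schwarzian derivative.\<close>

lemma nonneg_schwarzian_on_inverse:
  assumes S: "open S" and g: "C3_diffeo_on S g" and neg: "\<And>x. x \<in> S \<Longrightarrow> schwarzian g x < 0"
  shows "nonneg_schwarzian_on (g ` S) (inv_into S g) (deriv (inv_into S g))"
proof -
  define h where "h = inv_into S g"
  define V where "V = g ` S"
  define g1 g2 g3 where "g1 = deriv g" and "g2 = deriv g1" and "g3 = deriv g2"
  define h1 h2 h3 where "h1 = deriv h" and "h2 = deriv h1" and "h3 = deriv h2"
  have V: "open V" and Cg: "C3_on S g" and Ch: "C3_on V h" and inj: "inj_on g S"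
    using g by (auto simp: C3_diffeo_on_def V_def h_def)
  have D3: "(u has_real_derivative deriv u x) (at x) \<and> (deriv u has_real_derivative deriv (deriv u) x) (at x) \<and>
      (deriv (deriv u) has_real_derivative deriv (deriv (deriv u)) x) (at x)"
    if "C3_on W u" "x \<in> W" for u :: "real \<Rightarrow> real" and W x
  proof -
    have "(deriv ^^ k) u field_differentiable at x" if "k < 3" for k
      using \<open>C3_on W u\<close> \<open>x \<in> W\<close> that unfolding C3_on_def by blast
    from this[of 0] this[of 1] this[of 2] show ?thesis
      by (simp add: DERIV_deriv_iff_field_differentiable eval_nat_numeral)
  qed
  have Dg: "(g has_real_derivative g1 x) (at x)" "(g1 has_real_derivative g2 x) (at x)" "(g2 has_real_derivative g3 x) (at x)"
    if "x \<in> S" for x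
    using D3[OF Cg that] by (auto simp: g1_def g2_def g3_def)
  have Dh: "(h has_real_derivative h1 y) (at y)" "(h1 has_real_derivative h2 y) (at y)" "(h2 has_real_derivative h3 y) (at y)"
    if "y \<in> V" for y
    using D3[OF Ch that] by (auto simp: h1_def h2_def h3_def)
  have hS: "h y \<in> S" and gh: "g (h y) = y" if "y \<in> V" for y
    using that by (auto simp: V_def h_def inv_into_into f_inv_into_f)
  \<comment> \<open>The derivative identities \<open>e1\<close>, \<open>e2\<close>,
    \<open>e3\<close> are each obtained by differentiating the previous one: a function that is
    constant on the open set \<open>V\<close> has derivative 0 there.\<close>
  have zero: "d = 0" if y: "y \<in> V" and D: "(u has_real_derivative d) (at y)" and c: "\<And>z. z \<in> V \<Longrightarrow> u z = c" for u d c y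
  proof (rule DERIV_unique[OF D])
    show "(u has_real_derivative 0) (at y)"
      by (rule has_field_derivative_transform_within_open[OF DERIV_const[of c] V y]) (simp add: c)
  qed
  have chain: "((\<lambda>z. u (h z)) has_real_derivative d * h1 y) (at y)"
    if "y \<in> V" "(u has_real_derivative d) (at (h y))" for u d y
    by (rule DERIV_chain2[OF that(2) Dh(1)[OF that(1)]])
  have e1: "g1 (h y) * h1 y = 1" if y: "y \<in> V" for y
  proof -
    have "((\<lambda>z. g (h z) - z) has_real_derivative g1 (h y) * h1 y - 1) (at y)"
      by (intro DERIV_diff chain[OF y Dg(1)[OF hS[OF y]]] DERIV_ident)
    from zero[OF y this, of 0] show ?thesis using gh by simp
  qed
  have e2: "g2 (h y) * h1 y * h1 y + h2 y * g1 (h y) = 0" if y: "y \<in> V" for y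
  proof (rule zero[OF y])
    show "((\<lambda>z. g1 (h z) * h1 z) has_real_derivative g2 (h y) * h1 y * h1 y + h2 y * g1 (h y)) (at y)"
      by (intro DERIV_mult chain[OF y Dg(2)[OF hS[OF y]]] Dh[OF y])
  qed (rule e1)
  have e3: "(g3 (h y) * h1 y * h1 y + h2 y * g2 (h y)) * h1 y + h2 y * (g2 (h y) * h1 y) +
      (h3 y * g1 (h y) + g2 (h y) * h1 y * h2 y) = 0" if y: "y \<in> V" for y
  proof (rule zero[OF y])
    show "((\<lambda>z. g2 (h z) * h1 z * h1 z + h2 z * g1 (h z)) has_real_derivative
      (g3 (h y) * h1 y * h1 y + h2 y * g2 (h y)) * h1 y + h2 y * (g2 (h y) * h1 y) +
      (h3 y * g1 (h y) + g2 (h y) * h1 y * h2 y)) (at y)"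
      by (intro DERIV_add DERIV_mult chain[OF y Dg(2)[OF hS[OF y]]] chain[OF y Dg(3)[OF hS[OF y]]] Dh[OF y])
  qed (rule e2)
  have "h1 y \<noteq> 0 \<and> 3 * (h2 y)\<^sup>2 \<le> 2 * h1 y * h3 y" if y: "y \<in> V" for y
  proof -
    define a b c where "a = g1 (h y)" and "b = g2 (h y)" and "c = g3 (h y)"
    have s: "c / a - 3 / 2 * (b / a)\<^sup>2 < 0"
      using neg[OF hS[OF y]] by (simp add: schwarzian_def a_def b_def c_def g1_def g2_def g3_def eval_nat_numeral)
    have a0: "a \<noteq> 0" using e1[OF y] by (auto simp: a_def)
    have h1: "h1 y = 1 / a" using e1[OF y] a0 by (simp add: a_def field_simps)
    have h2: "h2 y = - b / a ^ 3"
      using e2[OF y] a0 unfolding h1 a_def[symmetric] b_def[symmetric]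
      by (simp add: field_simps eval_nat_numeral)
    have h3: "h3 y = - c / a ^ 4 + 3 * b\<^sup>2 / a ^ 5"
    proof -
      have "h3 y * a = - ((c * (1 / a) * (1 / a) + (- b / a ^ 3) * b) * (1 / a) + (- b / a ^ 3) * (b * (1 / a)) + b * (1 / a) * (- b / a ^ 3))"
        using e3[OF y] unfolding h1 h2 a_def[symmetric] b_def[symmetric] c_def[symmetric] by linarith
      also have "\<dots> = (- c / a ^ 4 + 3 * b\<^sup>2 / a ^ 5) * a"
        using a0 by (simp add: field_simps eval_nat_numeral)
      finally show ?thesis using a0 by simp
    qed
    \<comment> \<open>The left side is \<open>2 * (h1 y)\<^sup>2\<close> times the Schwarzian
      derivative of \<open>h\<close>, and \<open>h1 y = 1 / a\<close>.\<close>
    have "2 * h1 y * h3 y - 3 * (h2 y)\<^sup>2 = - (2 / a ^ 4) * (c / a - 3 / 2 * (b / a)\<^sup>2)"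
      unfolding h1 h2 h3 using a0 by (simp add: field_simps eval_nat_numeral)
    also have "\<dots> \<ge> 0" using s by (intro mult_nonpos_nonpos) auto
    finally show ?thesis using h1 a0 by simp
  qed
  then show ?thesis
    unfolding nonneg_schwarzian_on_def V_def[symmetric] h_def[symmetric] h1_def[symmetric] using Dh by blast
qed

lemma nonneg_schwarzian_on_shift:
  assumes "nonneg_schwarzian_on V \<psi> \<psi>1" and "\<And>t. t \<in> S \<Longrightarrow> t + k \<in> V"
  shows "nonneg_schwarzian_on S (\<lambda>t. \<psi> (t + k)) (\<lambda>t. \<psi>1 (t + k))"
proof -
  obtain \<psi>2 \<psi>3 where D: "\<And>t. t\<in>V \<Longrightarrow> (\<psi> has_real_derivative \<psi>1 t) (at t)"
        "\<And>t. t\<in>V \<Longrightarrow> (\<psi>1 has_real_derivative \<psi>2 t) (at t)"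
        "\<And>t. t\<in>V \<Longrightarrow> (\<psi>2 has_real_derivative \<psi>3 t) (at t)"
        "\<And>t. t\<in>V \<Longrightarrow> \<psi>1 t \<noteq> 0 \<and> 3 * (\<psi>2 t)\<^sup>2 \<le> 2 * \<psi>1 t * \<psi>3 t"
    using assms(1) unfolding nonneg_schwarzian_on_def by blast
  show ?thesis unfolding nonneg_schwarzian_on_def
    using D[OF assms(2)]
    by (intro exI[of _ "\<lambda>t. \<psi>2 (t + k)"] exI[of _ "\<lambda>t. \<psi>3 (t + k)"]) (auto simp: DERIV_shift)
qed

text \<open>
  \<open>Per\<close> is the group of periods of the parametrisation: trivial for the interval, the integers
  for the circle.
\<close>

locale parametrised_space =
  fixes p :: "real \<Rightarrow> 'a::t2_space" and M :: "'a measure" and Per :: "real set" and X :: "'a set"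
  defines "X \<equiv> space M"
  assumes sets_M: "sets M = sets (restrict_space borel X)"
    and p_continuous: "continuous_on UNIV p"
    and p_eq_iff: "\<And>s t. p s = p t \<longleftrightarrow> s - t \<in> Per"
    and M_finite: "emeasure M X < \<infinity>" and M_nonzero: "emeasure M X \<noteq> 0"
    and p_open: "\<And>U. open U \<Longrightarrow> p ` U \<subseteq> X \<Longrightarrow> openin (top_of_set X) (p ` U)"
    and p_null: "\<And>N. N \<in> null_sets M \<Longrightarrow> p -` N \<in> null_sets lborel"
    and p_measure: "\<And>A. A \<in> sets borel \<Longrightarrow> inj_on p A \<Longrightarrow> p ` A \<in> sets M \<Longrightarrow> emeasure lborel A \<le> emeasure M (p ` A)"
begin

lemma p_shift: "k \<in> Per \<Longrightarrow> p (t + k) = p t"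
  by (simp add: p_eq_iff)

lemma p_measurable: "p \<in> borel_measurable borel"
  by (rule borel_measurable_continuous_onI[OF p_continuous])

lemma sets_M_subset: "A \<in> sets M \<Longrightarrow> A \<subseteq> X"
  using sets.sets_into_space X_def by blast

lemma openin_sets_M: "openin (top_of_set X) V \<Longrightarrow> V \<in> sets M"
  unfolding sets_M sets_restrict_space openin_open by auto

text \<open>The translates of \<open>V\<close> by periods are open and cover \<open>D\<close>; they
  are pairwise disjoint because \<open>p\<close> is injective on \<open>V\<close>. A connected
  \<open>D\<close> therefore lies in a single one.\<close>

lemma p_inj_lift:
  assumes V: "open V" "inj_on p V" and D: "connected D" "D \<noteq> {}" and sub: "p ` D \<subseteq> p ` V"
  shows "\<exists>k\<in>Per. \<forall>t\<in>D. t + k \<in> V"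
proof -
  define W where "W k = {t. t + k \<in> V}" for k
  have W_open: "open (W k)" for k
    unfolding W_def using open_vimage[OF V(1), of "\<lambda>t. t + k"] by (simp add: vimage_def continuous_intros)
  have cover: "\<exists>k\<in>Per. t \<in> W k" if "t \<in> D" for t
  proof -
    obtain s where s: "s \<in> V" "p s = p t" using sub \<open>t \<in> D\<close> by (metis image_iff subsetD imageI)
    then have "s - t \<in> Per" using p_eq_iff by blast
    moreover have "t \<in> W (s - t)" using s(1) by (simp add: W_def)
    ultimately show ?thesis by blast
  qed
  have disj: "k = l" if "k \<in> Per" "l \<in> Per" "t \<in> W k" "t \<in> W l" for k l t
  proof -
    have "p (t + k) = p (t + l)" using p_shift that by simp
    then have "t + k = t + l" by (rule inj_onD[OF V(2)]) (use that in \<open>simp_all add: W_def\<close>)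
    then show ?thesis by simp
  qed
  obtain t0 where t0: "t0 \<in> D" using D(2) by blast
  obtain k where k: "k \<in> Per" "t0 \<in> W k" using cover[OF t0] by blast
  have "D \<subseteq> W k"
  proof (rule ccontr)
    assume "\<not> D \<subseteq> W k"
    then obtain t where t: "t \<in> D" "t \<notin> W k" by blast
    let ?R = "\<Union>l\<in>Per - {k}. W l"
    have "open ?R" using W_open by blast
    moreover have "D \<subseteq> W k \<union> ?R" using cover by blast
    moreover have "W k \<inter> ?R \<inter> D = {}" using disj k(1) by blast
    moreover have "W k \<inter> D \<noteq> {}" "?R \<inter> D \<noteq> {}" using t0 k t cover by blast+
    ultimately show False using D(1) W_open[of k] unfolding connected_def by blast
  qed
  then show ?thesis using k(1) by (auto simp: W_def)
qed

end

text \<open>The witnesses in the definition of a finite-to-one Markov map become functions of the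
  element: \<open>D I\<close> is its coordinate interval, \<open>g I\<close> the lift of
  \<open>f\<close> on it, and \<open>F I\<close> the finite subcollection containing almost all of
  the preimage of \<open>I\<close>.\<close>

locale markov_lift = parametrised_space p M Per X
  for p :: "real \<Rightarrow> 'a::t2_space" and M :: "'a measure" and Per :: "real set" and X :: "'a set" +
  fixes f :: "'a \<Rightarrow> 'a" and P :: "'a set set" and a b :: "'a set \<Rightarrow> real" and g :: "'a set \<Rightarrow> real \<Rightarrow> real"
    and F :: "'a set \<Rightarrow> 'a set set" and D :: "'a set \<Rightarrow> real set"
  defines "D \<equiv> \<lambda>I. {a I<..<b I}"
  assumes P_countable: "countable P" and P_disjoint: "disjoint P"
    and P_sets: "\<And>I. I \<in> P \<Longrightarrow> I \<in> sets M" and P_full: "X - \<Union>P \<in> null_sets M"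
    and a_less_b: "\<And>I. I \<in> P \<Longrightarrow> a I < b I" and inj_D: "\<And>I. I \<in> P \<Longrightarrow> inj_on p (D I)"
    and P_eq: "\<And>I. I \<in> P \<Longrightarrow> I = p ` D I"
    and lift: "\<And>I t. I \<in> P \<Longrightarrow> t \<in> D I \<Longrightarrow> f (p t) = p (g I t)"
    and diffeo: "\<And>I. I \<in> P \<Longrightarrow> C3_diffeo_on (D I) (g I)"
    and schwarzian_neg: "\<And>I t. I \<in> P \<Longrightarrow> t \<in> D I \<Longrightarrow> schwarzian (g I) t < 0"
    and inj_image: "\<And>I. I \<in> P \<Longrightarrow> inj_on p (g I ` D I)"
    and markov: "markov_partition M f P"
    and F: "\<And>I. I \<in> P \<Longrightarrow> F I \<subseteq> P" "\<And>I. I \<in> P \<Longrightarrow> finite (F I)"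
      "\<And>I. I \<in> P \<Longrightarrow> AE x in M. f x \<in> I \<longrightarrow> x \<in> \<Union>(F I)"
    and f_X: "f \<in> X \<rightarrow> X" and dense: "has_dense_orbit X f"
begin

section \<open>The map and its inverse branches in the coordinate\<close>

definition Y :: "real set" where "Y = (\<Union>I\<in>P. D I)"

definition covers :: "'a set \<Rightarrow> 'a set \<Rightarrow> bool" where
  "covers J I \<longleftrightarrow> I \<subseteq> f ` J"

text \<open>When \<open>J\<close> covers \<open>I\<close>, this is the period that moves the
  coordinate interval of \<open>I\<close> into the range of the chosen lift \<open>g J\<close>. On
  the circle the two may lie in different periods.\<close>

definition shift :: "'a set \<Rightarrow> 'a set \<Rightarrow> real" where
  "shift J I = (SOME k. k \<in> Per \<and> (\<forall>t\<in>D I. t + k \<in> g J ` D J))"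

definition \<psi> :: "'a set \<Rightarrow> 'a set \<Rightarrow> real \<Rightarrow> real" where
  "\<psi> J I t = inv_into (D J) (g J) (t + shift J I)"

definition \<psi>1 :: "'a set \<Rightarrow> 'a set \<Rightarrow> real \<Rightarrow> real" where
  "\<psi>1 J I t = deriv (inv_into (D J) (g J)) (t + shift J I)"

text \<open>This is \<open>f\<close> in the coordinate wherever a point and its image both have a
  coordinate in \<open>Y\<close>, that is, on \<open>Gd\<close>. The default 0 elsewhere makes
  \<open>T\<close> Borel on the whole line although \<open>f\<close> may be arbitrary outside the
  partition.\<close>

definition T :: "real \<Rightarrow> real" where
  "T s = (if s \<in> Y \<and> f (p s) \<in> p ` Y then the_inv_into Y p (f (p s)) else 0)"

text \<open>\<open>F I\<close> may contain elements whose images miss \<open>I\<close>. Those that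
  remain have an inverse branch on all of \<open>D I\<close>.\<close>

definition pre :: "'a set \<Rightarrow> 'a set set" where
  "pre I = {J \<in> F I. covers J I}"

definition Gd :: "real set" where
  "Gd = {s \<in> Y. f (p s) \<in> p ` Y}"

lemma D_open[simp]: "open (D I)" and D_connected: "connected (D I)"
  by (simp_all add: D_def)

lemma D_nonempty: "I \<in> P \<Longrightarrow> D I \<noteq> {}"
  using a_less_b[of I] by (simp add: D_def)

lemma Y_open[simp]: "open Y"
  by (auto simp: Y_def)

lemma p_image: "I \<in> P \<Longrightarrow> p ` D I = I"
  using P_eq by blast

lemma p_mem: "I \<in> P \<Longrightarrow> t \<in> D I \<Longrightarrow> p t \<in> I"
  using p_image by blast

lemma p_memE:
  assumes "I \<in> P" "x \<in> I"
  obtains t where "t \<in> D I" "x = p t"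
  using p_image[OF assms(1)] assms(2) by blast

lemma p_D_X: "I \<in> P \<Longrightarrow> p ` D I \<subseteq> X"
  using p_image P_sets sets_M_subset by metis

lemma p_Y: "p ` Y = \<Union>P"
  unfolding Y_def image_UN using p_image by simp

lemma p_Y_X: "p ` Y \<subseteq> X"
  using p_Y P_sets sets_M_subset by blast

lemma same_element: "I \<in> P \<Longrightarrow> J \<in> P \<Longrightarrow> x \<in> I \<Longrightarrow> x \<in> J \<Longrightarrow> I = J"
  using P_disjoint unfolding disjoint_def by blast

lemma inj_Y: "inj_on p Y"
proof (rule inj_onI)
  fix s t assume st: "s \<in> Y" "t \<in> Y" "p s = p t"
  then obtain I J where I: "I \<in> P" "s \<in> D I" and J: "J \<in> P" "t \<in> D J" by (auto simp: Y_def)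
  have "p s \<in> I" "p s \<in> J" using p_mem[OF I] p_mem[OF J] st(3) by simp_all
  then have "I = J" using same_element I J by blast
  then show "s = t" using inj_D[OF I(1)] I J st(3) by (auto simp: inj_on_def)
qed

lemma g_deriv:
  assumes "J \<in> P" "t \<in> D J"
  shows "(g J has_real_derivative deriv (g J) t) (at t)"
  using diffeo[OF assms(1)] assms(2) unfolding C3_diffeo_on_def C3_on_def
  by (auto dest!: spec[of _ 0] simp: DERIV_deriv_iff_field_differentiable)

lemma g_continuous: "J \<in> P \<Longrightarrow> continuous_on (D J) (g J)"
  by (intro continuous_at_imp_continuous_on ballI DERIV_isCont[OF g_deriv])

lemma g_inj: "J \<in> P \<Longrightarrow> inj_on (g J) (D J)" and g_image_open: "J \<in> P \<Longrightarrow> open (g J ` D J)"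
  using diffeo by (auto simp: C3_diffeo_on_def)

lemma f_image: "J \<in> P \<Longrightarrow> f ` J = p ` (g J ` D J)"
proof -
  assume J: "J \<in> P"
  have "f ` (p ` D J) = p ` (g J ` D J)" unfolding image_image using lift[OF J] by (intro image_cong) auto
  then show ?thesis by (simp only: p_image[OF J])
qed

text \<open>If \<open>I\<close> is not one of the elements that make up the image of
  \<open>J\<close>, then its intersection with that image is null by the Markov property. In the
  coordinate the intersection is open, so it must be empty. This turns a property up to null sets
  into an exact one.\<close>

lemma covers_or_disjoint:
  assumes "I \<in> P" "J \<in> P"
  shows "covers J I \<or> I \<inter> f ` J = {}"
proof (rule ccontr)
  assume n: "\<not> ?thesis"
  have "\<exists>Q\<subseteq>P. \<Union>Q \<subseteq> f ` J \<and> f ` J - \<Union>Q \<in> null_sets M"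
    by (rule markov[unfolded markov_partition_def, THEN bspec, OF assms(2)])
  then obtain Q where Q: "Q \<subseteq> P" "\<Union>Q \<subseteq> f ` J" "f ` J - \<Union>Q \<in> null_sets M"
    by (elim exE conjE)
  have "I \<notin> Q"
  proof
    assume "I \<in> Q"
    then have "I \<subseteq> f ` J" using Q(2) Union_upper by (metis order_trans)
    then show False using n by (simp add: covers_def)
  qed
  have disj: "x \<notin> \<Union>Q" if "x \<in> I" for x
  proof
    assume "x \<in> \<Union>Q"
    then obtain I' where "I' \<in> Q" "x \<in> I'" by (elim UnionE)
    then show False using same_element[OF assms(1) _ that, of I'] Q(1) \<open>I \<notin> Q\<close> by auto
  qed
  obtain t s where t: "t \<in> D I" and s: "s \<in> g J ` D J" and ts: "p t = p s"
  proof -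
    obtain x where x: "x \<in> I" "x \<in> p ` (g J ` D J)" using n f_image[OF assms(2)] by blast
    obtain t where "t \<in> D I" "x = p t" by (rule p_memE[OF assms(1) x(1)])
    then show thesis using x(2) that by blast
  qed
  define k where "k = s - t"
  have k: "k \<in> Per" using ts p_eq_iff unfolding k_def by metis
  let ?W = "D I \<inter> (\<lambda>u. u + k) -` (g J ` D J)"
  have "open ?W"
    by (intro open_Int open_vimage g_image_open assms(2) continuous_intros) simp
  moreover have "t \<in> ?W" using t s by (simp add: k_def)
  moreover have "?W \<in> null_sets lborel"
  proof (rule null_sets_subset[OF p_null[OF Q(3)]])
    show "?W \<subseteq> p -` (f ` J - \<Union>Q)"
    proof
      fix u assume u: "u \<in> ?W"
      then have "p u \<in> I" using p_mem[OF assms(1)] by blast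
      moreover have "p (u + k) \<in> f ` J" using u unfolding f_image[OF assms(2)] by blast
      then have "p u \<in> f ` J" using p_shift[OF k, of u] by simp
      ultimately show "u \<in> p -` (f ` J - \<Union>Q)" using disj by blast
    qed
    show "?W \<in> sets lborel" using \<open>open ?W\<close> by simp
  qed
  ultimately show False using open_not_negligible[of ?W] negligible_iff_null_sets null_sets_completionI by blast
qed

lemma shift:
  assumes "I \<in> P" "J \<in> P" "covers J I"
  shows "shift J I \<in> Per" "\<And>t. t \<in> D I \<Longrightarrow> t + shift J I \<in> g J ` D J"
proof -
  have "p ` D I \<subseteq> p ` (g J ` D J)"
    using assms(3) unfolding p_image[OF assms(1)] f_image[OF assms(2), symmetric] covers_def .
  then have "\<exists>k. k \<in> Per \<and> (\<forall>t\<in>D I. t + k \<in> g J ` D J)"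
    using p_inj_lift[OF g_image_open[OF assms(2)] inj_image[OF assms(2)] D_connected D_nonempty[OF assms(1)]] by blast
  then have "shift J I \<in> Per \<and> (\<forall>t\<in>D I. t + shift J I \<in> g J ` D J)"
    unfolding shift_def by (rule someI_ex)
  then show "shift J I \<in> Per" "\<And>t. t \<in> D I \<Longrightarrow> t + shift J I \<in> g J ` D J" by auto
qed

lemma \<psi>:
  assumes "I \<in> P" "J \<in> P" "covers J I" "t \<in> D I"
  shows "\<psi> J I t \<in> D J" "g J (\<psi> J I t) = t + shift J I" "f (p (\<psi> J I t)) = p t"
proof -
  note s = shift(2)[OF assms]
  show 1: "\<psi> J I t \<in> D J" "g J (\<psi> J I t) = t + shift J I"
    unfolding \<psi>_def using inv_into_into[OF s] f_inv_into_f[OF s] by auto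
  show "f (p (\<psi> J I t)) = p t"
    using lift[OF assms(2) 1(1)] 1(2) p_shift[OF shift(1)[OF assms(1-3)]] by simp
qed

lemma \<psi>_image:
  assumes "I \<in> P" "J \<in> P" "covers J I"
  shows "\<psi> J I ` D I = D J \<inter> g J -` ((\<lambda>u. u + shift J I) ` D I)"
proof (intro set_eqI iffI)
  fix s assume "s \<in> D J \<inter> g J -` ((\<lambda>u. u + shift J I) ` D I)"
  then obtain t where t: "t \<in> D I" "s \<in> D J" "g J s = t + shift J I" by auto
  then have "\<psi> J I t = s"
    using \<psi>[OF assms t(1)] g_inj[OF assms(2)] by (auto simp: inj_on_def)
  then show "s \<in> \<psi> J I ` D I" using t(1) by blast
qed (use \<psi>[OF assms] in auto)

lemma \<psi>_open:
  assumes "I \<in> P" "J \<in> P" "covers J I"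
  shows "open (\<psi> J I ` D I)"
proof -
  have "open ((\<lambda>u. u + shift J I) ` D I)"
    using open_translation[OF D_open, of "shift J I" I] by (simp add: add.commute)
  then show ?thesis
    unfolding \<psi>_image[OF assms] by (intro continuous_open_preimage g_continuous assms) auto
qed

lemma T_\<psi>:
  assumes "I \<in> P" "J \<in> P" "covers J I" "t \<in> D I"
  shows "T (\<psi> J I t) = t"
proof -
  have "\<psi> J I t \<in> Y" "t \<in> Y" using \<psi>(1)[OF assms] assms by (auto simp: Y_def)
  then show ?thesis using \<psi>(3)[OF assms] inj_Y by (simp add: T_def the_inv_into_f_f)
qed

lemma T_Gd:
  assumes "s \<in> Gd"
  shows "T s \<in> Y" "p (T s) = f (p s)"
  using assms inj_Y by (auto simp: T_def Gd_def the_inv_into_f_f)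

text \<open>Injectivity of \<open>p\<close> on the range of \<open>g J\<close> upgrades the equality
  of points of the space to an equality of lifts, which identifies the inverse branch through
  \<open>s\<close>.\<close>

lemma Gd_cases:
  assumes s: "s \<in> Gd" "J \<in> P" "s \<in> D J" and I: "I \<in> P" "T s \<in> D I"
  shows "covers J I" "s = \<psi> J I (T s)"
proof -
  have fI: "f (p s) \<in> I" using T_Gd(2)[OF s(1)] p_mem[OF I] by simp
  have "p s \<in> J" using s p_mem by blast
  then show c: "covers J I" using covers_or_disjoint[OF I(1) s(2)] fI by blast
  have e: "p (T s + shift J I) = p (g J s)"
    using T_Gd(2)[OF s(1)] lift[OF s(2,3)] p_shift[OF shift(1)[OF I(1) s(2) c]] by simp
  have "T s + shift J I = g J s"
    using inj_image[OF s(2)] e shift(2)[OF I(1) s(2) c I(2)] s(3) by (auto simp: inj_on_def)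
  then show "s = \<psi> J I (T s)"
    unfolding \<psi>_def using inv_into_f_f[OF g_inj[OF s(2)] s(3)] by simp
qed

text \<open>This yields the openness of \<open>Gd\<close> and a countable cover on whose parts
  \<open>T\<close> is visibly continuous.\<close>

lemma Gd_eq: "Gd = (\<Union>(J, I)\<in>{(J, I). J \<in> P \<and> I \<in> P \<and> covers J I}. \<psi> J I ` D I)"
proof (intro set_eqI iffI)
  fix s assume s: "s \<in> Gd"
  then obtain J where J: "J \<in> P" "s \<in> D J" by (auto simp: Gd_def Y_def)
  obtain I where I: "I \<in> P" "T s \<in> D I" using T_Gd(1)[OF s] by (auto simp: Y_def)
  have "\<psi> J I (T s) \<in> \<psi> J I ` D I" using I(2) by blast
  then have "s \<in> \<psi> J I ` D I" unfolding Gd_cases(2)[OF s J I, symmetric] .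
  then show "s \<in> (\<Union>(J, I)\<in>{(J, I). J \<in> P \<and> I \<in> P \<and> covers J I}. \<psi> J I ` D I)"
    using J(1) I(1) Gd_cases(1)[OF s J I] by blast
next
  fix s assume "s \<in> (\<Union>(J, I)\<in>{(J, I). J \<in> P \<and> I \<in> P \<and> covers J I}. \<psi> J I ` D I)"
  then obtain J I t where J: "J \<in> P" "I \<in> P" "covers J I" "t \<in> D I" "s = \<psi> J I t" by blast
  then show "s \<in> Gd" using \<psi>[OF J(2,1,3,4)] by (auto simp: Gd_def Y_def)
qed

lemma Gd_open: "open Gd"
  unfolding Gd_eq using \<psi>_open by (intro open_UN) auto

lemma T_measurable: "T \<in> borel_measurable borel"
proof -
  let ?PP = "{(J, I). J \<in> P \<and> I \<in> P \<and> covers J I}"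
  let ?C = "insert (- Gd) ((\<lambda>(J, I). \<psi> J I ` D I) ` ?PP)"
  have "countable ?PP"
    by (rule countable_subset[OF _ countable_SIGMA[OF P_countable, of "\<lambda>_. P"]]) (use P_countable in auto)
  then have "countable ?C" by blast
  then show ?thesis
  proof (rule measurable_piecewise_restrict)
    show "\<Omega> \<inter> space borel \<in> sets borel" if "\<Omega> \<in> ?C" for \<Omega>
      using that Gd_open \<psi>_open by auto
    show "space borel \<subseteq> \<Union>?C" by (auto simp: Gd_eq)
    fix \<Omega> assume "\<Omega> \<in> ?C"
    then consider "\<Omega> = - Gd" | J I where "J \<in> P" "I \<in> P" "covers J I" "\<Omega> = \<psi> J I ` D I" by auto
    then show "T \<in> measurable (restrict_space borel \<Omega>) borel"
    proof cases
      case 1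
      have "T s = 0" if "s \<in> space (restrict_space borel \<Omega>)" for s
        using that 1 by (auto simp: T_def Gd_def space_restrict_space)
      then show ?thesis by (subst measurable_cong[where g = "\<lambda>_. 0"]) auto
    next
      case 2
      have e: "T s = g J s - shift J I" if "s \<in> space (restrict_space borel \<Omega>)" for s
        using that 2 T_\<psi>[OF 2(2,1,3)] \<psi>(2)[OF 2(2,1,3)] by (auto simp: space_restrict_space)
      have "\<Omega> \<subseteq> D J" using 2 \<psi>_image[OF 2(2,1,3)] by blast
      then have "continuous_on \<Omega> (\<lambda>s. g J s - shift J I)"
        by (intro continuous_intros continuous_on_subset[OF g_continuous[OF 2(1)]])
      then have "(\<lambda>s. g J s - shift J I) \<in> measurable (restrict_space borel \<Omega>) borel"
        by (rule borel_measurable_continuous_on_restrict)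
      then show ?thesis by (subst measurable_cong[OF e])
    qed
  qed
qed

text \<open>A bad point is sent by \<open>f\<close> into the null set outside the partition, so it
  lies in the image of a null set under the inverse of some \<open>g J\<close>. Differentiable maps
  of the line preserve null sets, and there are countably many \<open>J\<close>.\<close>

lemma Bad_null: "Y - Gd \<in> null_sets lborel"
proof -
  let ?N = "p -` (X - \<Union>P)"
  have N: "?N \<in> null_sets lborel" by (rule p_null[OF P_full])
  let ?B = "\<lambda>J. inv_into (D J) (g J) ` (g J ` D J \<inter> ?N)"
  have "negligible (?B J)" if J: "J \<in> P" for J
  proof (rule negligible_differentiable_image_negligible)
    have "?N \<in> null_sets lebesgue" using N by (rule null_sets_completionI)
    then show "negligible (g J ` D J \<inter> ?N)"
      using negligible_subset[of ?N] by (auto simp: negligible_iff_null_sets)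
    have "(inv_into (D J) (g J)) differentiable at y" if "y \<in> g J ` D J" for y
      using nonneg_schwarzian_on_inverse[OF D_open diffeo[OF J] schwarzian_neg[OF J]] that
      unfolding nonneg_schwarzian_on_def by (meson real_differentiable_def)
    then show "inv_into (D J) (g J) differentiable_on (g J ` D J \<inter> ?N)"
      by (auto simp: differentiable_on_def intro: differentiable_at_withinI)
  qed simp
  then have "negligible (\<Union>J\<in>P. ?B J)"
    using P_countable by (intro negligible_countable_Union[of "?B ` P", simplified]) auto
  moreover have "Y - Gd \<subseteq> (\<Union>J\<in>P. ?B J)"
  proof
    fix s assume s: "s \<in> Y - Gd"
    then obtain J where J: "J \<in> P" "s \<in> D J" by (auto simp: Y_def)
    have "f (p s) \<notin> \<Union>P" using s by (auto simp: Gd_def p_Y)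
    moreover have "f (p s) \<in> X" using f_X p_D_X[OF J(1)] J(2) by blast
    ultimately have "g J s \<in> ?N" using lift[OF J] by simp
    then have "inv_into (D J) (g J) (g J s) \<in> ?B J" using J(2) by blast
    then show "s \<in> (\<Union>J\<in>P. ?B J)" using inv_into_f_f[OF g_inj[OF J(1)] J(2)] J(1) by auto
  qed
  ultimately have "negligible (Y - Gd)" by (rule negligible_subset)
  moreover have "Y - Gd \<in> sets borel" using Gd_open by (intro sets.Diff) auto
  ultimately show ?thesis
    by (simp add: negligible_iff_null_sets null_sets_completion_iff)
qed

end

section \<open>The coordinate system is an irreducible Markov system on the line\<close>

context markov_lift
begin

lemma P_nonempty: "P \<noteq> {}"
proof
  assume "P = {}"
  then have "X \<in> null_sets M" using P_full by simp
  then show False using M_nonzero by (simp add: null_setsD1)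
qed

lemma finite_Y: "emeasure lborel Y < \<infinity>"
proof -
  have "p ` Y \<in> sets M"
    unfolding p_Y using P_countable P_sets by (intro sets.countable_Union) auto
  then have "emeasure lborel Y \<le> emeasure M (p ` Y)"
    using inj_Y by (intro p_measure) auto
  also have "\<dots> \<le> emeasure M X"
    using emeasure_space[of M "p ` Y"] by (simp add: X_def)
  finally show ?thesis using M_finite by (rule le_less_trans)
qed

lemma D_disjoint: "disjoint_family_on D P"
  unfolding disjoint_family_on_def
proof (intro ballI impI)
  fix I J assume IJ: "I \<in> P" "J \<in> P" "I \<noteq> J"
  show "D I \<inter> D J = {}"
    using same_element[OF IJ(1,2)] p_mem[OF IJ(1)] p_mem[OF IJ(2)] IJ(3) by blast
qed

lemma \<psi>_schwarzian:
  assumes "I \<in> P" "J \<in> P" "covers J I"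
  shows "nonneg_schwarzian_on (D I) (\<psi> J I) (\<psi>1 J I)"
proof -
  have "nonneg_schwarzian_on (D I) (\<lambda>t. inv_into (D J) (g J) (t + shift J I))
      (\<lambda>t. deriv (inv_into (D J) (g J)) (t + shift J I))"
    by (rule nonneg_schwarzian_on_shift[OF nonneg_schwarzian_on_inverse[OF D_open diffeo schwarzian_neg]])
       (use assms shift in auto)
  then show ?thesis by (simp add: \<psi>_def[abs_def] \<psi>1_def[abs_def])
qed

text \<open>A point of \<open>Gd\<close> that \<open>T\<close> sends into \<open>D I\<close> lies on
  the branch of its own element \<open>J\<close>. If that branch is missing from
  \<open>pre I\<close>, then \<open>J\<close> is not in \<open>F I\<close>, and the point belongs to
  the exceptional null set of finite-to-oneness.\<close>

lemma branches_cover: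
  assumes I: "I \<in> P"
  shows "(Y \<inter> T -` D I) - (\<Union>J\<in>pre I. \<psi> J I ` D I) \<in> null_sets lborel"
proof -
  obtain N where N: "N \<in> null_sets M" "\<And>x. x \<in> X \<Longrightarrow> f x \<in> I \<Longrightarrow> x \<notin> \<Union>(F I) \<Longrightarrow> x \<in> N"
  proof -
    obtain N where N: "{x \<in> space M. \<not> (f x \<in> I \<longrightarrow> x \<in> \<Union>(F I))} \<subseteq> N" "emeasure M N = 0" "N \<in> sets M"
      using AE_E[OF F(3)[OF I]] by blast
    then have "N \<in> null_sets M" by (simp add: null_sets_def)
    then show thesis using N(1) that unfolding X_def by blast
  qed
  have "(Y - Gd) \<union> p -` N \<in> null_sets lborel" by (intro null_sets.Un Bad_null p_null N)
  then show ?thesis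
  proof (rule null_sets_subset)
    have "T -` D I \<in> sets borel" using measurable_sets[OF T_measurable, of "D I"] by simp
    moreover have "\<psi> J I ` D I \<in> sets borel" if "J \<in> pre I" for J
      using that F(1)[OF I] \<psi>_open[OF I] by (auto simp: pre_def)
    moreover have "finite (pre I)" using F(2)[OF I] by (simp add: pre_def)
    ultimately show "(Y \<inter> T -` D I) - (\<Union>J\<in>pre I. \<psi> J I ` D I) \<in> sets lborel"
      by (intro sets.Diff sets.Int sets.finite_UN) auto
    show "(Y \<inter> T -` D I) - (\<Union>J\<in>pre I. \<psi> J I ` D I) \<subseteq> (Y - Gd) \<union> p -` N"
    proof
      fix s assume s: "s \<in> (Y \<inter> T -` D I) - (\<Union>J\<in>pre I. \<psi> J I ` D I)"
      show "s \<in> (Y - Gd) \<union> p -` N"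
      proof (cases "s \<in> Gd")
        case True
        obtain J where J: "J \<in> P" "s \<in> D J" using s by (auto simp: Y_def)
        have TI: "T s \<in> D I" using s by simp
        note G = Gd_cases[OF True J I TI]
        have "J \<notin> F I"
        proof
          assume "J \<in> F I"
          then have "J \<in> pre I" using G(1) by (simp add: pre_def)
          moreover have "\<psi> J I (T s) \<in> \<psi> J I ` D I" using TI by blast
          then have "s \<in> \<psi> J I ` D I" unfolding G(2)[symmetric] .
          ultimately show False using s by blast
        qed
        have "p s \<notin> \<Union>(F I)"
        proof
          assume "p s \<in> \<Union>(F I)"
          then obtain J' where J': "J' \<in> F I" "p s \<in> J'" by (elim UnionE)
          then have "J' = J" using same_element[of J' J "p s"] F(1)[OF I] J(1) p_mem[OF J] by auto
          then show False using J'(1) \<open>J \<notin> F I\<close> by simp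
        qed
        moreover have "f (p s) \<in> I" using T_Gd(2)[OF True] p_mem[OF I TI] by simp
        moreover have "p s \<in> X" using p_D_X[OF J(1)] J(2) by blast
        ultimately show ?thesis using N(2) by simp
      qed (use s in blast)
    qed
  qed
qed

lemma T_Y: "Y \<inter> T -` (- Y) \<in> null_sets lborel"
proof (rule null_sets_subset[OF Bad_null])
  have "T -` (- Y) \<in> sets borel" using measurable_sets[OF T_measurable, of "- Y"] by simp
  then show "Y \<inter> T -` (- Y) \<in> sets lborel" by simp
  show "Y \<inter> T -` (- Y) \<subseteq> Y - Gd" using T_Gd(1) by blast
qed

lemma D_Y_fold: "{a I<..<b I} = D I" "(\<Union>I\<in>P. D I) = Y"
  by (simp_all add: D_def Y_def)

lemma is_markov_line: "markov_line P a b T pre \<psi> \<psi>1"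
proof (unfold_locales, unfold D_Y_fold)
  show "finite (pre I)" "pre I \<subseteq> P" if "I \<in> P" for I
    using F(1,2)[OF that] by (auto simp: pre_def)
  fix I J assume I: "I \<in> P" and J: "J \<in> pre I"
  then have J': "J \<in> P" "covers J I" using F(1)[OF I] by (auto simp: pre_def)
  show "nonneg_schwarzian_on (D I) (\<psi> J I) (\<psi>1 J I)" "open (\<psi> J I ` D I)"
    "\<psi> J I ` D I \<subseteq> D J" using \<psi>_schwarzian \<psi>_open \<psi>(1) I J' by auto
  show "T (\<psi> J I t) = t" if "t \<in> D I" for t using T_\<psi> I J' that by blast
qed (fact P_countable P_nonempty a_less_b D_disjoint finite_Y T_measurable branches_cover T_Y | assumption)+

sublocale line: markov_line P a b T pre \<psi> \<psi>1 D Y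
  by (rule is_markov_line) (simp_all add: D_def Y_def)

lemma Bad_null_iterates: "(\<Union>n. (T ^^ n) -` (- Gd)) \<in> null_sets line.lam"
proof -
  have "Y \<inter> - Gd = Y - Gd" by blast
  then have "- Gd \<in> null_sets line.lam"
    using Bad_null Gd_open by (auto simp: line.null_sets_lam_iff)
  then show ?thesis by (intro null_sets_UN line.nonsingular)
qed

lemma conjugacy_iterate:
  assumes "\<And>n. (T ^^ n) s \<in> Gd"
  shows "p ((T ^^ n) s) = (f ^^ n) (p s)"
proof (induction n)
  case (Suc n)
  then show ?case using T_Gd(2)[OF assms[of n]] by simp
qed simp

lemma iterate_X: "x \<in> X \<Longrightarrow> (f ^^ n) x \<in> X"
  by (induction n) (use f_X in auto)

text \<open>The dense orbit visits \<open>U\<close> and, at the same time or later,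
  \<open>V\<close>. Late enough on the orbit \<open>f\<close> is continuous, so a whole
  neighbourhood in \<open>U\<close> follows the orbit into \<open>V\<close>; it is open and has
  positive measure. In the coordinate \<open>T\<close> follows \<open>f\<close> for all time outside
  a null set.\<close>

lemma irreducible:
  assumes U: "open U" "U \<noteq> {}" "U \<subseteq> Y" and V: "open V" "V \<noteq> {}" "V \<subseteq> Y"
  shows "\<exists>n. emeasure lborel (U \<inter> (T ^^ n) -` V) > 0"
proof -
  obtain x where x: "x \<in> X" "X \<subseteq> closure (range (\<lambda>n. (f ^^ n) x))"
    and ev: "\<forall>\<^sub>F n in sequentially. continuous (at ((f ^^ n) x) within X) f"
    using dense unfolding has_dense_orbit_def by blast
  define orb where "orb n = (f ^^ n) x" for n
  have orbX: "orb n \<in> X" for n unfolding orb_def by (rule iterate_X[OF x(1)])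
  have orb_add: "orb (m + n) = (f ^^ m) (orb n)" for m n by (simp add: orb_def funpow_add)
  obtain N where N: "\<And>n. n \<ge> N \<Longrightarrow> continuous (at (orb n) within X) f"
    using ev unfolding eventually_sequentially orb_def by blast
  \<comment> \<open>The image of \<open>S\<close> is relatively open and infinite, so it remains
    nonempty and relatively open when the first \<open>m\<close> points of the orbit are removed.
    The visit by the dense orbit then happens at time \<open>m\<close> or later.\<close>
  have visit: "\<exists>n\<ge>m. orb n \<in> p ` S" if S: "open S" "S \<noteq> {}" "S \<subseteq> Y" for S m
  proof -
    have "openin (top_of_set X) (p ` S)" using S p_Y_X by (intro p_open) auto
    then obtain W where W: "open W" "p ` S = X \<inter> W" unfolding openin_open by blast
    have "infinite (p ` S)"
    proof -
      have "infinite S" using S(1,2) finite_imp_not_open by blast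
      moreover have "inj_on p S" using inj_Y S(3) inj_on_subset by blast
      ultimately show ?thesis using finite_imageD by blast
    qed
    then have "\<not> p ` S \<subseteq> orb ` {..<m}" using finite_subset by blast
    then obtain z where z: "z \<in> p ` S" "z \<notin> orb ` {..<m}" by blast
    have "open (W - orb ` {..<m})" by (intro open_Diff W finite_imp_closed) auto
    moreover have "z \<in> W - orb ` {..<m}" "z \<in> closure (range orb)"
      using z W x(2) unfolding orb_def by auto
    ultimately have "(W - orb ` {..<m}) \<inter> range orb \<noteq> {}"
      using open_Int_closure_eq_empty[of "W - orb ` {..<m}" "range orb"] by blast
    then obtain n where n: "orb n \<in> W" "orb n \<notin> orb ` {..<m}" by blast
    then have "n \<ge> m" by (metis imageI lessThan_iff not_le)
    moreover have "orb n \<in> p ` S" using n(1) orbX W(2) by blast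
    ultimately show ?thesis by blast
  qed
  obtain k where k: "k \<ge> N" "orb k \<in> p ` U" using visit[OF U] by blast
  obtain l where l: "l \<ge> k" "orb l \<in> p ` V" using visit[OF V] by blast
  define m where "m = l - k"
  have lm: "orb l = (f ^^ m) (orb k)" using orb_add[of m k] l(1) by (simp add: m_def)
  have cont: "continuous (at (orb k) within X) (f ^^ j)" for j
  proof (induction j)
    case 0
    then show ?case by (simp add: id_def)
  next
    case (Suc j)
    have "continuous (at ((f ^^ j) (orb k)) within X) f"
      using N[of "j + k"] k(1) by (simp add: orb_add)
    moreover have "(f ^^ j) ` X \<subseteq> X" using iterate_X by blast
    ultimately have "continuous (at ((f ^^ j) (orb k)) within (f ^^ j) ` X) f"
      by (rule continuous_within_subset)
    from continuous_within_compose[OF Suc this] show ?case by (simp add: comp_def)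
  qed
  have "openin (top_of_set X) (p ` V)" using V p_Y_X by (intro p_open) auto
  then obtain W where W: "open W" "p ` V = X \<inter> W" unfolding openin_open by blast
  have "(f ^^ m) (orb k) \<in> W" using l(2) lm W(2) by simp
  then obtain A where A: "open A" "orb k \<in> A" "\<And>y. y \<in> X \<Longrightarrow> y \<in> A \<Longrightarrow> (f ^^ m) y \<in> W"
    using cont[of m, unfolded continuous_within_topological, rule_format, OF W(1)] by blast
  define U' where "U' = U \<inter> p -` A"
  have U'_open: "open U'"
    unfolding U'_def by (intro open_Int U open_vimage A p_continuous)
  have "U' \<noteq> {}" using k(2) A(2) unfolding U'_def by auto
  then have pos: "emeasure lborel U' > 0"
    using open_not_negligible[OF U'_open] U'_open
    by (auto simp: negligible_iff_null_sets null_sets_completion_iff null_sets_def zero_less_iff_neq_zero)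
  let ?N = "\<Union>n. (T ^^ n) -` (- Gd)"
  have NB: "Y \<inter> ?N \<in> null_sets lborel" using Bad_null_iterates by (simp add: line.null_sets_lam_iff)
  have VT: "(T ^^ m) -` V \<in> sets borel" using V by (intro line.iterate_vimage_measurable) auto
  have "U' \<subseteq> (U \<inter> (T ^^ m) -` V) \<union> (Y \<inter> ?N)"
  proof
    fix s assume s: "s \<in> U'"
    show "s \<in> (U \<inter> (T ^^ m) -` V) \<union> (Y \<inter> ?N)"
    proof (cases "s \<in> ?N")
      case True
      then show ?thesis using s U(3) unfolding U'_def by blast
    next
      case False
      then have G: "(T ^^ n) s \<in> Gd" for n by blast
      have "p s \<in> X" using s U(3) p_Y_X unfolding U'_def by blast
      then have "(f ^^ m) (p s) \<in> p ` V"
        unfolding W(2) using A(3)[of "p s"] s iterate_X unfolding U'_def by blast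
      then have "p ((T ^^ m) s) \<in> p ` V" using conjugacy_iterate[OF G] by simp
      moreover have "(T ^^ m) s \<in> Y" using G[of m] by (simp add: Gd_def)
      ultimately have "(T ^^ m) s \<in> V" using inj_on_image_mem_iff[OF inj_Y _ V(3)] by blast
      then show ?thesis using s unfolding U'_def by blast
    qed
  qed
  then have "emeasure lborel U' \<le> emeasure lborel ((U \<inter> (T ^^ m) -` V) \<union> (Y \<inter> ?N))"
    using U VT NB by (intro emeasure_mono) auto
  also have "\<dots> = emeasure lborel (U \<inter> (T ^^ m) -` V)"
    using U VT by (intro emeasure_Un_null_set NB) auto
  finally show ?thesis using pos by (intro exI[of _ m]) auto
qed

sublocale line: irreducible_markov_line P a b T pre \<psi> \<psi>1 D Y
  by (unfold_locales, unfold D_Y_fold) (rule irreducible)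

section \<open>Transport of the invariant measure to the space\<close>

definition p' :: "real \<Rightarrow> 'a" where
  "p' t = (if t \<in> Y then p t else (SOME x. x \<in> X))"

lemma X_nonempty: "X \<noteq> {}"
  using M_nonzero by auto

lemma p'_X: "p' t \<in> X"
  using p_Y_X X_nonempty by (auto simp: p'_def some_in_eq)

text \<open>Off \<open>Y\<close> the parametrisation may leave \<open>X\<close>, as it does for the
  interval. The fixed value of \<open>p'\<close> there makes it a map into \<open>M\<close> that is
  defined on the whole line.\<close>

lemma p'_measurable: "p' \<in> measurable borel M"
proof -
  have "p' \<in> borel_measurable borel"
    unfolding p'_def using p_measurable by (intro measurable_If_set) auto
  then have "p' \<in> measurable borel (restrict_space borel X)"
    using p'_X by (intro measurable_restrict_space2) auto
  then show ?thesis by (simp cong: measurable_cong_sets add: sets_M)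
qed

text \<open>The inverse \<open>q\<close> of \<open>p\<close> on \<open>Y\<close>, extended by 0, is
  Borel because \<open>p\<close> maps open subsets of \<open>Y\<close> to relatively open sets.
  Images under \<open>p\<close> are preimages under \<open>q\<close>.\<close>

lemma image_sets_M:
  assumes B: "B \<in> sets borel" "B \<subseteq> Y"
  shows "p ` B \<in> sets M"
proof -
  define q where "q x = (if x \<in> p ` Y then the_inv_into Y p x else 0)" for x
  have q: "q (p t) = t" if "t \<in> Y" for t using that inj_Y by (simp add: q_def the_inv_into_f_f)
  have pS: "p ` (S \<inter> Y) \<in> sets M" if "open S" for S
    using that p_Y_X by (intro openin_sets_M p_open open_Int) auto
  have YM: "p ` Y \<in> sets M" using pS[of UNIV] by simp
  have XM: "X \<in> sets M" by (simp add: X_def)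
  have "q \<in> borel_measurable M"
  proof (rule borel_measurableI)
    fix S :: "real set" assume S: "open S"
    have "q -` S \<inter> space M = p ` (S \<inter> Y) \<union> (if 0 \<in> S then X - p ` Y else {})"
    proof (intro set_eqI iffI)
      fix x assume x: "x \<in> q -` S \<inter> space M"
      show "x \<in> p ` (S \<inter> Y) \<union> (if 0 \<in> S then X - p ` Y else {})"
      proof (cases "x \<in> p ` Y")
        case True
        then obtain t where "t \<in> Y" "x = p t" by blast
        then show ?thesis using x q by auto
      next
        case False
        then have "q x = 0" by (simp add: q_def)
        then show ?thesis using x False by (simp add: X_def)
      qed
    next
      fix x assume "x \<in> p ` (S \<inter> Y) \<union> (if 0 \<in> S then X - p ` Y else {})"
      then consider t where "t \<in> S" "t \<in> Y" "x = p t" | "0 \<in> S" "x \<in> X" "x \<notin> p ` Y"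
        by (auto split: if_splits)
      then show "x \<in> q -` S \<inter> space M"
      proof cases
        case 1
        then show ?thesis using q p_Y_X unfolding X_def by auto
      next
        case 2
        then show ?thesis by (simp add: q_def X_def)
      qed
    qed
    then show "q -` S \<inter> space M \<in> sets M" using pS[OF S] YM XM by auto
  qed
  then have "q -` B \<inter> space M \<in> sets M" using B(1) by (rule measurable_sets)
  moreover have "p ` B = (q -` B \<inter> space M) \<inter> p ` Y"
    using q B(2) p_Y_X unfolding X_def by auto
  ultimately show ?thesis using YM by auto
qed

text \<open>The measure on the line gives no mass to the complement of \<open>Y\<close>, and
  \<open>p\<close> is injective on \<open>Y\<close>, so its image under \<open>p'\<close> inherits
  every property. Invariance passes from \<open>T\<close> to \<open>f\<close> because the two
  correspond to each other on \<open>Gd\<close>.\<close>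

theorem acim_exists:
  "\<exists>\<mu>. sets \<mu> = sets M \<and> emeasure \<mu> (space \<mu>) \<noteq> 0 \<and>
     sigma_finite_measure \<mu> \<and> absolutely_continuous M \<mu> \<and> invariant_measure f \<mu>"
proof -
  obtain \<nu> where \<nu>: "sets \<nu> = sets borel" "emeasure \<nu> UNIV \<noteq> 0" "\<And>k. emeasure \<nu> (line.E k) < \<infinity>"
    "\<And>N. N \<in> null_sets line.lam \<Longrightarrow> emeasure \<nu> N = 0"
    "\<And>A. A \<in> sets borel \<Longrightarrow> emeasure \<nu> (T -` A) = emeasure \<nu> A"
    using line.invariant_measure by blast
  note [simp] = \<nu>(1)
  have space_\<nu>: "space \<nu> = UNIV" using sets_eq_imp_space_eq[OF \<nu>(1)] by simp
  have p'm: "p' \<in> measurable \<nu> M" using p'_measurable by (simp cong: measurable_cong_sets)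
  have p'b: "p' -` A \<in> sets borel" if "A \<in> sets M" for A
    using measurable_sets[OF p'_measurable that] by simp
  define \<mu> where "\<mu> = distr \<nu> M p'"
  have sets_\<mu>[simp]: "sets \<mu> = sets M" and space_\<mu>[simp]: "space \<mu> = X" by (simp_all add: \<mu>_def X_def)
  have em: "emeasure \<mu> A = emeasure \<nu> (p' -` A)" if "A \<in> sets M" for A
    unfolding \<mu>_def using that by (simp add: emeasure_distr[OF p'm] space_\<nu>)
  have nullY: "S \<in> null_sets \<nu>" if "S \<in> sets borel" "Y \<inter> S \<in> null_sets lborel" for S
  proof -
    have "S \<in> null_sets line.lam" using that by (simp add: line.null_sets_lam_iff)
    then have "emeasure \<nu> S = 0" by (rule \<nu>(4))
    then show ?thesis using that(1) by (simp add: null_sets_def)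
  qed
  have notY: "- Y \<in> null_sets \<nu>" by (rule nullY) auto
  have off: "emeasure \<nu> S = emeasure \<nu> S'" if "S \<in> sets borel" "S' \<in> sets borel" "Y \<inter> S = Y \<inter> S'" for S S'
  proof -
    have *: "emeasure \<nu> S = emeasure \<nu> ((Y \<inter> S) \<union> - Y)" if "S \<in> sets borel" for S
    proof -
      have "(Y \<inter> S) \<union> - Y = S \<union> - Y" by blast
      then show ?thesis using emeasure_Un_null_set[OF _ notY, of S] that by simp
    qed
    show ?thesis using *[OF that(1)] *[OF that(2)] that(3) by simp
  qed
  have p'_image: "Y \<inter> p' -` (p ` B) = B" if "B \<subseteq> Y" for B
  proof (intro set_eqI)
    show "t \<in> Y \<inter> p' -` (p ` B) \<longleftrightarrow> t \<in> B" for t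
      using inj_on_image_mem_iff[OF inj_Y _ that, of t] that by (cases "t \<in> Y") (simp_all add: p'_def subset_eq, blast)
  qed
  have em_image: "emeasure \<mu> (p ` B) = emeasure \<nu> B" if B: "B \<in> sets borel" "B \<subseteq> Y" for B
  proof -
    note m = image_sets_M[OF B]
    show ?thesis unfolding em[OF m] using p'_image[OF B(2)] B by (intro off p'b m) auto
  qed
  have YM: "p ` Y \<in> sets M" by (rule image_sets_M) auto
  have null_compl: "X - p ` B \<in> null_sets \<mu>" if B: "B \<in> sets borel" "B \<subseteq> Y" "Y - B \<in> null_sets lborel" for B
  proof -
    have m: "X - p ` B \<in> sets M" using image_sets_M[OF B(1,2)] X_def by auto
    have "Y \<inter> p' -` (X - p ` B) \<subseteq> Y - B" by (auto simp: p'_def)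
    then have "Y \<inter> p' -` (X - p ` B) \<in> null_sets lborel"
      using p'b[OF m] by (intro null_sets_subset[OF B(3)]) auto
    then have "p' -` (X - p ` B) \<in> null_sets \<nu>" using p'b[OF m] by (intro nullY)
    then show ?thesis using m by (simp add: null_sets_def em)
  qed
  have "emeasure \<mu> (space \<mu>) \<noteq> 0"
  proof -
    have "p' -` X = UNIV" using p'_X by blast
    then show ?thesis using em[of X] \<nu>(2) X_def by simp
  qed
  moreover have "sigma_finite_measure \<mu>"
  proof
    \<comment> \<open>The images of the sets \<open>E k\<close> have finite measure and fill the
      image of \<open>Y\<close>, whose complement is null.\<close>
    let ?A = "insert (X - p ` Y) (range (\<lambda>k. p ` line.E k))"
    have E: "line.E k \<in> sets borel" "line.E k \<subseteq> Y" for k using line.E_subset_Y by auto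
    have "(\<Union>k. p ` line.E k) = p ` Y" using line.E_union by (metis image_UN)
    then have U: "\<Union>?A = space \<mu>" using p_Y_X by auto
    have S: "?A \<subseteq> sets \<mu>" using YM image_sets_M[OF E] X_def by auto
    have fin: "emeasure \<mu> A \<noteq> \<infinity>" if "A \<in> ?A" for A
    proof -
      have "emeasure \<mu> (p ` line.E k) \<noteq> \<infinity>" for k using em_image[OF E] \<nu>(3)[of k] by simp
      moreover have "emeasure \<mu> (X - p ` Y) = 0" using null_compl[of Y] by auto
      ultimately show ?thesis using that by auto
    qed
    have "countable ?A" by simp
    then show "\<exists>A. countable A \<and> A \<subseteq> sets \<mu> \<and> \<Union>A = space \<mu> \<and> (\<forall>a\<in>A. emeasure \<mu> a \<noteq> \<infinity>)"
      by (intro exI[of _ ?A] conjI ballI fin S U)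
  qed
  moreover have "absolutely_continuous M \<mu>"
    unfolding absolutely_continuous_def
  proof
    fix N assume N: "N \<in> null_sets M"
    then have m: "N \<in> sets M" by auto
    have "Y \<inter> p' -` N \<in> null_sets lborel"
      by (rule null_sets_subset[OF p_null[OF N]]) (use p'b[OF m] in \<open>auto simp: p'_def\<close>)
    then have "p' -` N \<in> null_sets \<nu>" using p'b[OF m] by (intro nullY)
    then show "N \<in> null_sets \<mu>" using m by (simp add: null_sets_def em)
  qed
  moreover have "invariant_measure f \<mu>"
    unfolding invariant_measure_def
  proof
    fix A assume "A \<in> sets \<mu>"
    then have A: "A \<in> sets M" by simp
    define A' where "A' = p' -` A"
    have A': "A' \<in> sets borel" using p'b[OF A] by (simp add: A'_def)
    have TA': "T -` A' \<in> sets borel" using measurable_sets[OF T_measurable A'] by simp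
    \<comment> \<open>The preimage of \<open>A\<close> under \<open>f\<close> splits into the image
      of \<open>R\<close>, which is Borel, and a remainder outside the image of \<open>Gd\<close>.
      The remainder lies in a null set but need not be Borel, which is why the completion
      appears.\<close>
    define R where "R = Gd \<inter> T -` A'"
    have Gd: "Gd \<in> sets borel" "Gd \<subseteq> Y" using Gd_open by (auto simp: Gd_def)
    have R: "R \<in> sets borel" "R \<subseteq> Y" using Gd TA' by (auto simp: R_def)
    have R_iff: "s \<in> R \<longleftrightarrow> f (p s) \<in> A" if "s \<in> Gd" for s
      using that T_Gd[OF that] by (simp add: R_def A'_def p'_def)
    define N where "N = (f -` A \<inter> X) - p ` Gd"
    have N0: "X - p ` Gd \<in> null_sets \<mu>" by (rule null_compl[OF Gd Bad_null])
    have dec: "f -` A \<inter> space \<mu> = p ` R \<union> N"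
    proof (intro set_eqI iffI)
      fix x assume x: "x \<in> f -` A \<inter> space \<mu>"
      show "x \<in> p ` R \<union> N"
      proof (cases "x \<in> p ` Gd")
        case True
        then obtain s where "s \<in> Gd" "x = p s" by blast
        then show ?thesis using x R_iff by auto
      qed (use x in \<open>auto simp: N_def\<close>)
    next
      fix x assume "x \<in> p ` R \<union> N"
      then consider s where "s \<in> R" "x = p s" | "x \<in> N" by blast
      then show "x \<in> f -` A \<inter> space \<mu>"
      proof cases
        case 1
        then have "s \<in> Gd" "p s \<in> X" using R(2) p_Y_X by (auto simp: R_def)
        then show ?thesis using R_iff 1 by auto
      qed (auto simp: N_def)
    qed
    have RM: "p ` R \<in> sets \<mu>" using image_sets_M[OF R] by simp
    have NN: "N \<in> null_sets (completion \<mu>)"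
      by (rule null_sets_completion_subset[OF _ null_sets_completionI[OF N0]]) (auto simp: N_def)
    have RC: "p ` R \<in> sets (completion \<mu>)" using RM by (rule sets_completionI_sets)
    have "emeasure (completion \<mu>) (f -` A \<inter> space \<mu>) = emeasure (completion \<mu>) (p ` R)"
      unfolding dec by (rule emeasure_Un_null_set[OF RC NN])
    also have "\<dots> = emeasure \<mu> (p ` R)" using RM by simp
    also have "\<dots> = emeasure \<nu> R" by (rule em_image[OF R])
    also have "\<dots> = emeasure \<nu> (T -` A')"
    proof -
      have "(Y \<inter> T -` A') - R \<in> null_sets lborel"
        by (rule null_sets_subset[OF Bad_null]) (use R(1) TA' in \<open>auto simp: R_def\<close>)
      moreover have "Y \<inter> (T -` A' - R) = (Y \<inter> T -` A') - R" by blast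
      ultimately have "T -` A' - R \<in> null_sets \<nu>" using R(1) TA' by (intro nullY) auto
      moreover have "T -` A' = R \<union> (T -` A' - R)" by (auto simp: R_def)
      ultimately show ?thesis using emeasure_Un_null_set[of R \<nu> "T -` A' - R"] R(1) by simp
    qed
    also have "\<dots> = emeasure \<nu> A'" by (rule \<nu>(5)[OF A'])
    also have "\<dots> = emeasure \<mu> A" by (simp add: em[OF A] A'_def)
    finally show "f -` A \<inter> space \<mu> \<in> sets (completion \<mu>) \<and>
        emeasure (completion \<mu>) (f -` A \<inter> space \<mu>) = emeasure \<mu> A"
      using RC NN unfolding dec by auto
  qed
  ultimately show ?thesis by (intro exI[of _ \<mu>]) simp
qed

end

section \<open>The interval and the circle\<close>

theorem (in parametrised_space) acim_of_finite_to_one_markov_map: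
  assumes f: "finite_to_one_markov_map p M f"
  shows "\<exists>\<mu>. sets \<mu> = sets M \<and> emeasure \<mu> (space \<mu>) \<noteq> 0 \<and>
     sigma_finite_measure \<mu> \<and> absolutely_continuous M \<mu> \<and> invariant_measure f \<mu>"
proof -
  obtain P where P: "neg_schwarzian_partition p M f P" "markov_partition M f P" "finite_to_one_partition M f P"
    and D: "f \<in> X \<rightarrow> X" "has_dense_orbit X f"
    using f unfolding finite_to_one_markov_map_def class_D_def X_def by blast
  have lp: "lambda_partition M P" and br: "\<And>I. I \<in> P \<Longrightarrow> neg_schwarzian_branch p f I"
    using P(1) by (auto simp: neg_schwarzian_partition_def)
  \<comment> \<open>The end points and the lift are packed into one triple, so that a single choice
    yields all three as functions of the element.\<close>
  have "\<forall>I\<in>P. \<exists>d. fst d < fst (snd d) \<and> inj_on p {fst d<..<fst (snd d)} \<and> I = p ` {fst d<..<fst (snd d)} \<and>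
        (\<forall>t\<in>{fst d<..<fst (snd d)}. f (p t) = p (snd (snd d) t)) \<and>
        C3_diffeo_on {fst d<..<fst (snd d)} (snd (snd d)) \<and> (\<forall>t\<in>{fst d<..<fst (snd d)}. schwarzian (snd (snd d)) t < 0) \<and>
        inj_on p (snd (snd d) ` {fst d<..<fst (snd d)})"
    using br unfolding neg_schwarzian_branch_def by auto
  from bchoice[OF this] obtain d where d: "\<forall>I\<in>P. fst (d I) < fst (snd (d I)) \<and> inj_on p {fst (d I)<..<fst (snd (d I))} \<and> I = p ` {fst (d I)<..<fst (snd (d I))} \<and>
        (\<forall>t\<in>{fst (d I)<..<fst (snd (d I))}. f (p t) = p (snd (snd (d I)) t)) \<and>
        C3_diffeo_on {fst (d I)<..<fst (snd (d I))} (snd (snd (d I))) \<and> (\<forall>t\<in>{fst (d I)<..<fst (snd (d I))}. schwarzian (snd (snd (d I))) t < 0) \<and>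
        inj_on p (snd (snd (d I)) ` {fst (d I)<..<fst (snd (d I))})"
    by (elim exE)
  have "\<forall>I\<in>P. \<exists>F. F \<subseteq> P \<and> finite F \<and> (AE x in M. f x \<in> I \<longrightarrow> x \<in> \<Union>F)"
    using P(3) unfolding finite_to_one_partition_def by blast
  from bchoice[OF this] obtain F where F: "\<forall>I\<in>P. F I \<subseteq> P \<and> finite (F I) \<and> (AE x in M. f x \<in> I \<longrightarrow> x \<in> \<Union>(F I))"
    by (elim exE)
  define a b g where "a I = fst (d I)" and "b I = fst (snd (d I))" and "g I = snd (snd (d I))" for I
  have "markov_lift p M Per f P a b g F"
  proof (intro markov_lift.intro markov_lift_axioms.intro parametrised_space_axioms)
    fix I assume I: "I \<in> P"
    note dI = d[THEN bspec, OF I, folded a_def b_def g_def]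
    show "a I < b I" using dI by (elim conjE)
    show "inj_on p {a I<..<b I}" using dI by (elim conjE)
    show "I = p ` {a I<..<b I}" using dI by (elim conjE)
    show "C3_diffeo_on {a I<..<b I} (g I)" using dI by (elim conjE)
    show "inj_on p (g I ` {a I<..<b I})" using dI by (elim conjE)
    have "\<forall>t\<in>{a I<..<b I}. f (p t) = p (g I t)" using dI by (elim conjE)
    then show "f (p t) = p (g I t)" if "t \<in> {a I<..<b I}" for t using that by (rule bspec)
    have "\<forall>t\<in>{a I<..<b I}. schwarzian (g I) t < 0" using dI by (elim conjE)
    then show "schwarzian (g I) t < 0" if "t \<in> {a I<..<b I}" for t using that by (rule bspec)
    show "F I \<subseteq> P" using F[THEN bspec, OF I] by (elim conjE)
    show "finite (F I)" using F[THEN bspec, OF I] by (elim conjE)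
    show "AE x in M. f x \<in> I \<longrightarrow> x \<in> \<Union>(F I)" using F[THEN bspec, OF I] by (elim conjE)
  qed (use lp P(2) D in \<open>auto simp: lambda_partition_def X_def\<close>)
  then show ?thesis by (rule markov_lift.acim_exists)
qed

lemma parametrised_interval: "parametrised_space interval_param interval_lebesgue {0}"
proof
  have p: "interval_param = (\<lambda>t. t)" by (simp add: fun_eq_iff interval_param_def)
  have X: "space interval_lebesgue = {0..1}" by (simp add: interval_lebesgue_def space_restrict_space)
  have em: "emeasure interval_lebesgue A = emeasure lborel A" if "A \<in> sets borel" "A \<subseteq> {0..1}" for A
    using that by (simp add: interval_lebesgue_def emeasure_restrict_space)
  show sets: "sets interval_lebesgue = sets (restrict_space borel (space interval_lebesgue))"
    by (simp add: X interval_lebesgue_def sets_restrict_space)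
  have S: "A \<in> sets borel \<and> A \<subseteq> {0..1}" if "A \<in> sets interval_lebesgue" for A
    using that unfolding sets X sets_restrict_space by auto
  show "continuous_on UNIV interval_param"
    "\<And>s t. interval_param s = interval_param t \<longleftrightarrow> s - t \<in> {0}"
    by (auto simp: p continuous_on_id)
  show "emeasure interval_lebesgue (space interval_lebesgue) < \<infinity>"
    "emeasure interval_lebesgue (space interval_lebesgue) \<noteq> 0"
    unfolding X by (simp_all add: em)
  show "openin (top_of_set (space interval_lebesgue)) (interval_param ` U)"
    if "open U" "interval_param ` U \<subseteq> space interval_lebesgue" for U
    using that by (simp add: p open_subset)
  show "interval_param -` N \<in> null_sets lborel" if N: "N \<in> null_sets interval_lebesgue" for N
    using S[OF null_setsD2[OF N]] N em[of N] by (auto simp: p null_sets_def)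
  show "emeasure lborel A \<le> emeasure interval_lebesgue (interval_param ` A)"
    if "interval_param ` A \<in> sets interval_lebesgue" for A
    using S[OF that] em[of A] by (simp add: p)
qed

section \<open>The circle as a quotient of the line by the integers\<close>

lemma circle_param_eq_iff: "circle_param s = circle_param t \<longleftrightarrow> s - t \<in> \<int>"
proof -
  have "circle_param s = circle_param t \<longleftrightarrow> (\<exists>n::int. \<i> * complex_of_real (2 * pi * s) = \<i> * complex_of_real (2 * pi * t) + complex_of_real (of_int (2 * n) * pi) * \<i>)"
    unfolding circle_param_def cis_conv_exp exp_eq by simp
  also have "\<dots> \<longleftrightarrow> (\<exists>n::int. s = t + of_int n)"
  proof (intro ex_cong1)
    fix n :: int
    have "\<i> * complex_of_real (2 * pi * s) = \<i> * complex_of_real (2 * pi * t) + complex_of_real (of_int (2 * n) * pi) * \<i> \<longleftrightarrow>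
        2 * pi * s = 2 * pi * (t + of_int n)"
      by (simp add: complex_eq_iff algebra_simps)
    then show "\<i> * complex_of_real (2 * pi * s) = \<i> * complex_of_real (2 * pi * t) + complex_of_real (of_int (2 * n) * pi) * \<i> \<longleftrightarrow> s = t + of_int n"
      by simp
  qed
  also have "\<dots> \<longleftrightarrow> s - t \<in> \<int>"
    by (auto simp: Ints_def algebra_simps image_iff)
  finally show ?thesis .
qed

lemma circle_param_frac: "circle_param (frac t) = circle_param t"
  by (simp add: circle_param_eq_iff frac_def)

lemma circle_param_image_sphere: "circle_param t \<in> sphere 0 1"
  by (simp add: circle_param_def)

lemma sphere_circle_param: "z \<in> sphere 0 1 \<Longrightarrow> \<exists>t\<in>{0..1}. z = circle_param t"
proof -
  assume "z \<in> sphere 0 1"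
  then have "z = cis (Arg z)" using cis_Arg[of z] by (cases "z = 0") (simp_all add: sgn_eq)
  also have "\<dots> = circle_param (Arg z / (2 * pi))" by (simp add: circle_param_def)
  also have "\<dots> = circle_param (frac (Arg z / (2 * pi)))" by (simp add: circle_param_frac)
  finally show "\<exists>t\<in>{0..1}. z = circle_param t"
    using frac_ge_0 frac_lt_1 less_imp_le by (metis atLeastAtMost_iff)
qed

lemma continuous_circle_param: "continuous_on UNIV circle_param"
  unfolding circle_param_def cis_conv_exp by (intro continuous_intros)

lemma circle_param_vimage: "A \<in> sets borel \<Longrightarrow> circle_param -` A \<in> sets borel"
  using measurable_sets[OF borel_measurable_continuous_onI[OF continuous_circle_param], of A] by simp

lemma circle_param_measurable:
  "circle_param \<in> measurable (restrict_space lborel {0..1}) (restrict_space borel (sphere 0 1))"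
  using circle_param_image_sphere borel_measurable_continuous_onI[OF continuous_circle_param]
  by (intro measurable_restrict_space2 measurable_restrict_space1) auto

lemma emeasure_circle_lebesgue:
  assumes "A \<in> sets borel" "A \<subseteq> sphere 0 1"
  shows "emeasure circle_lebesgue A = emeasure lborel ({0..1} \<inter> circle_param -` A)"
proof -
  have "A \<in> sets (restrict_space borel (sphere 0 1))"
    using assms by (auto simp: sets_restrict_space)
  then have "emeasure circle_lebesgue A =
      emeasure (restrict_space lborel {0..1}) (circle_param -` A \<inter> space (restrict_space lborel {0..1}))"
    unfolding circle_lebesgue_def by (rule emeasure_distr[OF circle_param_measurable])
  also have "\<dots> = emeasure lborel (circle_param -` A \<inter> {0..1})"
    by (subst emeasure_restrict_space) (auto simp: space_restrict_space)
  finally show ?thesis by (simp add: Int_commute)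
qed

lemma emeasure_lborel_shift:
  fixes A :: "real set"
  assumes "A \<in> sets borel"
  shows "(\<lambda>t. t + k) -` A \<in> sets borel" "emeasure lborel ((\<lambda>t. t + k) -` A) = emeasure lborel A"
proof -
  have m: "(\<lambda>t::real. t + k) \<in> borel_measurable borel" by simp
  show "(\<lambda>t. t + k) -` A \<in> sets borel" using measurable_sets[OF m assms] by simp
  have "emeasure lborel A = emeasure (distr lborel borel ((+) k)) A"
    by (simp add: lborel_distr_plus)
  also have "\<dots> = emeasure lborel ((+) k -` A \<inter> space lborel)"
    using assms by (intro emeasure_distr) auto
  finally show "emeasure lborel ((\<lambda>t. t + k) -` A) = emeasure lborel A"
    by (simp add: vimage_def add.commute)
qed

lemma parametrised_circle: "parametrised_space circle_param circle_lebesgue \<int>"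
proof
  have X: "space circle_lebesgue = sphere 0 1" by (simp add: circle_lebesgue_def space_restrict_space)
  show sets: "sets circle_lebesgue = sets (restrict_space borel (space circle_lebesgue))"
    unfolding X by (simp add: circle_lebesgue_def)
  have S: "A \<in> sets borel" "A \<subseteq> sphere 0 1" if "A \<in> sets circle_lebesgue" for A
    using that unfolding sets X sets_restrict_space by auto
  show "continuous_on UNIV circle_param" by (rule continuous_circle_param)
  show "circle_param s = circle_param t \<longleftrightarrow> s - t \<in> \<int>" for s t by (rule circle_param_eq_iff)
  have "{0..1} \<inter> circle_param -` sphere 0 1 = {0..1}" using circle_param_image_sphere by auto
  then show "emeasure circle_lebesgue (space circle_lebesgue) < \<infinity>"
    "emeasure circle_lebesgue (space circle_lebesgue) \<noteq> 0"
    unfolding X by (simp_all add: emeasure_circle_lebesgue)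
  show "openin (top_of_set (space circle_lebesgue)) (circle_param ` U)" if U: "open U" for U
  proof -
    \<comment> \<open>\<open>W\<close> is the saturation of \<open>U\<close> under integer
      translations. The complement of the image of \<open>U\<close> in the circle is thus the image
      of the compact set \<open>{0..1} - W\<close>, hence closed.\<close>
    define W where "W = (\<Union>k\<in>\<int>. (\<lambda>t. t + k) -` U)"
    have "open W"
      unfolding W_def by (intro open_UN ballI open_vimage U continuous_intros)
    have "compact ({0..1} - W)" using \<open>open W\<close> by (intro compact_diff) auto
    then have "compact (circle_param ` ({0..1} - W))"
      by (intro compact_continuous_image continuous_on_subset[OF continuous_circle_param]) auto
    then have cl: "closed (circle_param ` ({0..1} - W))" by (rule compact_imp_closed)
    have W_iff: "t \<in> W \<longleftrightarrow> circle_param t \<in> circle_param ` U" for t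
    proof
      assume "t \<in> W"
      then obtain k where k: "k \<in> \<int>" "t + k \<in> U" by (auto simp: W_def)
      have "circle_param t = circle_param (t + k)" using k by (simp add: circle_param_eq_iff)
      then show "circle_param t \<in> circle_param ` U" using k by blast
    next
      assume "circle_param t \<in> circle_param ` U"
      then obtain u where u: "u \<in> U" "circle_param u = circle_param t" by auto
      then have "u - t \<in> \<int>" by (simp add: circle_param_eq_iff)
      moreover have "t + (u - t) \<in> U" using u by simp
      ultimately show "t \<in> W" unfolding W_def by blast
    qed
    have "circle_param ` U = sphere 0 1 \<inter> - circle_param ` ({0..1} - W)"
    proof (intro set_eqI iffI)
      fix z assume z: "z \<in> circle_param ` U"
      then have "z \<notin> circle_param ` ({0..1} - W)" using W_iff by blast
      then show "z \<in> sphere 0 1 \<inter> - circle_param ` ({0..1} - W)" using z circle_param_image_sphere by blast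
    next
      fix z assume z: "z \<in> sphere 0 1 \<inter> - circle_param ` ({0..1} - W)"
      then obtain t where t: "t \<in> {0..1}" "z = circle_param t" using sphere_circle_param[of z] by blast
      then have "t \<in> W" using z by blast
      then show "z \<in> circle_param ` U" using W_iff t by blast
    qed
    then show ?thesis unfolding X openin_open using cl by (intro exI[of _ "- circle_param ` ({0..1} - W)"]) auto
  qed
  show "circle_param -` N \<in> null_sets lborel" if N: "N \<in> null_sets circle_lebesgue" for N
  proof -
    note SN = S[OF null_setsD2[OF N]]
    \<comment> \<open>One period of the preimage is null by the definition of the measure on the
      circle, and countably many translates of it cover the whole preimage.\<close>
    let ?Z = "{0..1} \<inter> circle_param -` N"
    have Z: "?Z \<in> sets borel" using circle_param_vimage[OF SN(1)] by simp
    have "emeasure lborel ?Z = 0" using N emeasure_circle_lebesgue[OF SN] by (simp add: null_setsD1)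
    then have "(\<lambda>t. t + k) -` ?Z \<in> null_sets lborel" for k
      using emeasure_lborel_shift[OF Z, of k] by (simp add: null_sets_def)
    then have "(\<Union>k\<in>\<int>. (\<lambda>t. t + k) -` ?Z) \<in> null_sets lborel"
      by (intro null_sets_UN' countable_int)
    moreover have "circle_param -` N \<subseteq> (\<Union>k\<in>\<int>. (\<lambda>t. t + k) -` ?Z)"
    proof
      fix t assume t: "t \<in> circle_param -` N"
      have "t + (- of_int \<lfloor>t\<rfloor>) = frac t" by (simp add: frac_def)
      moreover have "frac t \<in> ?Z" using t circle_param_frac[of t] frac_ge_0[of t] frac_lt_1[of t] by simp
      ultimately have "t \<in> (\<lambda>u. u + (- of_int \<lfloor>t\<rfloor>)) -` ?Z" by simp
      moreover have "(- of_int \<lfloor>t\<rfloor> :: real) \<in> \<int>" by simp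
      ultimately show "t \<in> (\<Union>k\<in>\<int>. (\<lambda>t. t + k) -` ?Z)" by blast
    qed
    ultimately show ?thesis
      using circle_param_vimage[OF SN(1)] by (auto intro: null_sets_subset)
  qed
  show "emeasure lborel A \<le> emeasure circle_lebesgue (circle_param ` A)"
    if A: "A \<in> sets borel" "inj_on circle_param A" "circle_param ` A \<in> sets circle_lebesgue" for A
  proof -
    note SA = S[OF A(3)]
    \<comment> \<open>\<open>A\<close> is cut at the integers and its pieces are moved into
      \<open>{0..<1}\<close>. They stay disjoint there because the parametrisation is injective on
      \<open>A\<close>, so the measure of \<open>A\<close> is that of a subset of a single
      period.\<close>
    define B where "B k = {0..<1} \<inter> (\<lambda>t. t + of_int k) -` A" for k :: int
    have B: "B k \<in> sets borel" for k unfolding B_def using emeasure_lborel_shift(1)[OF A(1)] by simp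
    have Bsh: "(\<lambda>t. t + - of_int k) -` B k = A \<inter> {of_int k..<of_int k + 1}" for k
      by (auto simp: B_def)
    have "A = (\<Union>k. (\<lambda>t. t + - of_int k) -` B k)"
    proof
      show "A \<subseteq> (\<Union>k. (\<lambda>t. t + - of_int k) -` B k)"
      proof
        fix t assume t: "t \<in> A"
        have "t \<in> A \<inter> {of_int \<lfloor>t\<rfloor>..<of_int \<lfloor>t\<rfloor> + 1}" using t by simp
        then show "t \<in> (\<Union>k. (\<lambda>t. t + - of_int k) -` B k)" unfolding Bsh by blast
      qed
    qed (unfold Bsh, blast)
    have disj1: "disjoint_family (\<lambda>k. (\<lambda>t. t + - of_int k) -` B k)"
      unfolding Bsh disjoint_family_on_def
    proof (intro ballI impI)
      fix m n :: int assume "m \<noteq> n"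
      then have "m + 1 \<le> n \<or> n + 1 \<le> m" by linarith
      then have "real_of_int m + 1 \<le> real_of_int n \<or> real_of_int n + 1 \<le> real_of_int m" by linarith
      then show "A \<inter> {real_of_int m..<real_of_int m + 1} \<inter> (A \<inter> {real_of_int n..<real_of_int n + 1}) = {}" by auto
    qed
    have disj2: "disjoint_family B"
      unfolding disjoint_family_on_def
    proof (intro ballI impI, rule ccontr)
      fix m n :: int assume mn: "m \<noteq> n" "B m \<inter> B n \<noteq> {}"
      then obtain t where t: "t + of_int m \<in> A" "t + of_int n \<in> A" by (auto simp: B_def)
      have "circle_param (t + of_int m) = circle_param (t + of_int n)" by (simp add: circle_param_eq_iff)
      then have "t + of_int m = t + of_int n" by (rule inj_onD[OF A(2) _ t])
      then show False using mn(1) by simp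
    qed
    have "emeasure lborel A = emeasure lborel (\<Union>k. (\<lambda>t. t + - of_int k) -` B k)"
      using \<open>A = _\<close> by simp
    also have "\<dots> = (\<integral>\<^sup>+k. emeasure lborel ((\<lambda>t. t + - of_int k) -` B k) \<partial>count_space UNIV)"
    proof (intro emeasure_UN_countable disj1)
      show "(\<lambda>t. t + - of_int k) -` B k \<in> sets lborel" for k
        using emeasure_lborel_shift(1)[OF B, of "- of_int k" k] by simp
    qed simp
    also have "\<dots> = (\<integral>\<^sup>+k. emeasure lborel (B k) \<partial>count_space UNIV)"
      by (intro nn_integral_cong emeasure_lborel_shift(2)[OF B])
    also have "\<dots> = emeasure lborel (\<Union>k. B k)"
      using disj2 B by (intro emeasure_UN_countable[symmetric]) auto
    also have "\<dots> \<le> emeasure lborel ({0..1} \<inter> circle_param -` (circle_param ` A))"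
    proof (rule emeasure_mono)
      show "(\<Union>k. B k) \<subseteq> {0..1} \<inter> circle_param -` (circle_param ` A)"
      proof
        fix t assume "t \<in> (\<Union>k. B k)"
        then obtain k where k: "t \<in> {0..<1}" "t + of_int k \<in> A" by (auto simp: B_def)
        have "circle_param t = circle_param (t + of_int k)" by (simp add: circle_param_eq_iff)
        then show "t \<in> {0..1} \<inter> circle_param -` (circle_param ` A)" using k by auto
      qed
      show "{0..1} \<inter> circle_param -` (circle_param ` A) \<in> sets lborel"
        using circle_param_vimage[OF SA(1)] by simp
    qed
    also have "\<dots> = emeasure circle_lebesgue (circle_param ` A)"
      by (rule emeasure_circle_lebesgue[OF SA, symmetric])
    finally show ?thesis .
  qed
qed

theorem mainTheorem4:
  "(\<forall>f :: real \<Rightarrow> real.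
      finite_to_one_markov_map interval_param interval_lebesgue f \<longrightarrow>
      (\<exists>\<mu>. sets \<mu> = sets interval_lebesgue \<and> emeasure \<mu> (space \<mu>) \<noteq> 0 \<and>
           sigma_finite_measure \<mu> \<and> absolutely_continuous interval_lebesgue \<mu> \<and>
           invariant_measure f \<mu>)) \<and>
   (\<forall>f :: complex \<Rightarrow> complex.
      finite_to_one_markov_map circle_param circle_lebesgue f \<longrightarrow>
      (\<exists>\<mu>. sets \<mu> = sets circle_lebesgue \<and> emeasure \<mu> (space \<mu>) \<noteq> 0 \<and>
           sigma_finite_measure \<mu> \<and> absolutely_continuous circle_lebesgue \<mu> \<and>
           invariant_measure f \<mu>))"
  using parametrised_space.acim_of_finite_to_one_markov_map[OF parametrised_interval]
    parametrised_space.acim_of_finite_to_one_markov_map[OF parametrised_circle]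
  by blast

end
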